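(* Let $X$ be the interval $[0,1]$ or the circle, let $\lambda$ be Lebesgue measure on $X$, and let $f:X\to X$ be a $C^3$ map satisfying: 1) $f$ has only finitely many critical points (points where the derivative $Df$ vanishes), and the Schwarzian derivative $Sf$ is negative at every point that is not a critical point; 2) there exists a point of $X$ whose orbit under $f$ is dense in $X$; 3) there is a closed set $\Lambda\subset X$ with $f(\Lambda)\subset\Lambda$ and $\lambda(\Lambda)=0$ which contains the orbits of all critical points. Then $f$ has a nonzero $\sigma$-finite invariant Borel measure which is absolutely continuous with respect to $\lambda$.
   Context: The Schwarzian derivative of a $C^3$ map $g$ at a point where $Dg\neq0$ is $$Sg(x)=\frac{D^3g(x)}{Dg(x)}-\frac32\left(\frac{D^2g(x)}{Dg(x)}\right)^2 .$$ The orbit of $x$ is $\{f^n(x): n\ge 0\}$. A measure $\mu$ is invariant if $\mu(f^{-1}(A))=\mu(A)$ for all Borel sets $A$; it is $\sigma$-finite if, up to a set of $\mu$-measure zero, $X$ is a countable disjoint union of measurable sets of finite $\mu$-measure. *)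

theory Defs
  imports "HOL-Analysis.Analysis"
begin

text \<open>
  Iterated derivatives on \<open>S\<close> are taken within \<open>S\<close>; for \<open>S = {0..1}\<close> this means one-sided
  derivatives at the end points, and for \<open>S = UNIV\<close> the usual derivatives.
\<close>

definition nderiv :: "real set \<Rightarrow> nat \<Rightarrow> (real \<Rightarrow> real) \<Rightarrow> real \<Rightarrow> real" where
  "nderiv S k f = ((\<lambda>g x. vector_derivative g (at x within S)) ^^ k) f"

definition Ck_on :: "nat \<Rightarrow> real set \<Rightarrow> (real \<Rightarrow> real) \<Rightarrow> bool" where
  "Ck_on k S f \<longleftrightarrow>
     (\<forall>j<k. nderiv S j f differentiable_on S) \<and> continuous_on S (nderiv S k f)"

text \<open>
  The circle is \<open>\<real>/\<int>\<close>, realised as the unit circle in the complex plane with coordinate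
  \<open>circ\<close>. Smoothness and derivatives of a circle map are those of its lifts to \<open>\<real>\<close>.
\<close>

abbreviation circle :: "complex set" where
  "circle \<equiv> sphere 0 1"

definition circ :: "real \<Rightarrow> complex" where
  "circ t = cis (2 * pi * t)"

definition circle_lift :: "(complex \<Rightarrow> complex) \<Rightarrow> (real \<Rightarrow> real) \<Rightarrow> bool" where
  "circle_lift f F \<longleftrightarrow> continuous_on UNIV F \<and> (\<forall>t. circ (F t) = f (circ t))"

definition Ck_circle :: "nat \<Rightarrow> (complex \<Rightarrow> complex) \<Rightarrow> bool" where
  "Ck_circle k f \<longleftrightarrow> (\<exists>F. circle_lift f F \<and> Ck_on k UNIV F)"

text \<open>
  The \<open>k\<close>-th derivative of a circle map, meaningful for \<open>k > 0\<close>; by \<open>circle_nderiv_circ\<close>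
  below it does not depend on the lift or on the parameter of the point.
\<close>

definition circle_nderiv :: "nat \<Rightarrow> (complex \<Rightarrow> complex) \<Rightarrow> complex \<Rightarrow> real" where
  "circle_nderiv k f z = (THE d. \<exists>F t. circle_lift f F \<and> circ t = z \<and> d = nderiv UNIV k F t)"

lemma circ_eq_iff: "circ s = circ t \<longleftrightarrow> (\<exists>n::int. s = t + of_int n)"
proof -
  have "circ s = circ t \<longleftrightarrow> exp (\<i> * of_real (2 * pi * s)) = exp (\<i> * of_real (2 * pi * t))"
    by (simp add: circ_def cis_conv_exp)
  also have "\<dots> \<longleftrightarrow> (\<exists>n::int. \<i> * of_real (2 * pi * s) = \<i> * of_real (2 * pi * t) + (of_int (2 * n) * pi) * \<i>)"
    by (rule exp_eq)
  also have "\<dots> \<longleftrightarrow> (\<exists>n::int. s = t + of_int n)"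
  proof (rule ex_cong1)
    fix n :: int
    have "\<i> * of_real (2 * pi * s) = \<i> * of_real (2 * pi * t) + (of_int (2 * n) * pi) * \<i>
        \<longleftrightarrow> 2 * pi * s = 2 * pi * t + 2 * of_int n * pi"
      by (simp add: complex_eq_iff)
    also have "\<dots> \<longleftrightarrow> 2 * pi * s = 2 * pi * (t + of_int n)"
      by (simp add: algebra_simps)
    also have "\<dots> \<longleftrightarrow> s = t + of_int n"
      by simp
    finally show "\<i> * of_real (2 * pi * s) = \<i> * of_real (2 * pi * t) + (of_int (2 * n) * pi) * \<i>
        \<longleftrightarrow> s = t + of_int n" .
  qed
  finally show ?thesis .
qed

lemma nderiv_Suc:
  "nderiv S (Suc k) f x = vector_derivative (nderiv S k f) (at x within S)"
  by (simp add: nderiv_def)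

lemma vector_derivative_translate:
  "vector_derivative (\<lambda>x. g (x + a) + c) (at x) = vector_derivative g (at (x + a))"
  for g :: "real \<Rightarrow> real"
proof -
  have "((\<lambda>x. g (x + a) + c) has_vector_derivative d) (at x)
      \<longleftrightarrow> (g has_vector_derivative d) (at (x + a))" for d
  proof -
    have "((\<lambda>x. g (x + a) + c) has_real_derivative d) (at x)
        \<longleftrightarrow> ((\<lambda>x. g (x + a)) has_real_derivative d) (at x)"
    proof
      assume "((\<lambda>x. g (x + a) + c) has_real_derivative d) (at x)"
      from DERIV_add[OF this DERIV_const[of "-c"]]
      show "((\<lambda>x. g (x + a)) has_real_derivative d) (at x)"
        by simp
    next
      assume "((\<lambda>x. g (x + a)) has_real_derivative d) (at x)"
      from DERIV_add[OF this DERIV_const[of c]]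
      show "((\<lambda>x. g (x + a) + c) has_real_derivative d) (at x)"
        by simp
    qed
    then show ?thesis
      by (simp add: has_real_derivative_iff_has_vector_derivative[symmetric] DERIV_shift)
  qed
  then show ?thesis
    by (simp add: vector_derivative_def)
qed

lemma nderiv_translate:
  assumes "\<And>x. G x = F (x + a) + c"
  shows "nderiv UNIV (Suc k) G x = nderiv UNIV (Suc k) F (x + a)"
proof (induction k arbitrary: x)
  case 0
  have "G = (\<lambda>x. F (x + a) + c)"
    using assms by blast
  then show ?case
    by (simp add: nderiv_def vector_derivative_translate)
next
  case (Suc k)
  have "nderiv UNIV (Suc k) G = (\<lambda>x. nderiv UNIV (Suc k) F (x + a) + 0)"
    using Suc by auto
  then show ?case
    unfolding nderiv_Suc[of _ "Suc k"] by (simp only: vector_derivative_translate)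
qed

lemma circle_nderiv_circ:
  assumes F: "circle_lift f F" and k: "k > 0"
  shows "circle_nderiv k f (circ t) = nderiv UNIV k F t"
  unfolding circle_nderiv_def
proof (rule the_equality)
  show "\<exists>F' t'. circle_lift f F' \<and> circ t' = circ t \<and> nderiv UNIV k F t = nderiv UNIV k F' t'"
    using F by blast
next
  fix d
  assume "\<exists>G s. circle_lift f G \<and> circ s = circ t \<and> d = nderiv UNIV k G s"
  then obtain G s where G: "circle_lift f G" and s: "circ s = circ t"
    and d: "d = nderiv UNIV k G s"
    by blast
  obtain n :: int where n: "s = t + of_int n"
    using s circ_eq_iff by blast
  define h where "h x = F x - G (x + of_int n)" for x
  have h_int: "h x \<in> \<int>" for x
  proof -
    have "circ (x + of_int n) = circ x"
      using circ_eq_iff by blast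
    then have "circ (F x) = circ (G (x + of_int n))"
      using F G by (simp add: circle_lift_def)
    then obtain m :: int where "F x = G (x + of_int n) + of_int m"
      using circ_eq_iff by blast
    then show ?thesis
      by (simp add: h_def)
  qed
  have "continuous_on UNIV F" "continuous_on UNIV G"
    using F G by (simp_all add: circle_lift_def)
  moreover have "continuous_on UNIV (\<lambda>x. G (x + of_int n))"
    by (rule continuous_on_compose2[OF \<open>continuous_on UNIV G\<close>])
      (auto intro: continuous_intros)
  ultimately have "continuous_on UNIV h"
    unfolding h_def by (intro continuous_on_diff)
  moreover have "\<exists>e>0. \<forall>y. y \<in> UNIV \<and> h y \<noteq> h x \<longrightarrow> e \<le> norm (h y - h x)" for x
  proof (intro exI[of _ 1] conjI allI impI)
    fix y assume y: "y \<in> UNIV \<and> h y \<noteq> h x"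
    have "h y - h x \<in> \<int>"
      using h_int by (rule Ints_diff) (rule h_int)
    moreover have "h y - h x \<noteq> 0"
      using y by simp
    ultimately show "1 \<le> norm (h y - h x)"
      using Ints_nonzero_abs_ge1 by fastforce
  qed simp
  ultimately have "h constant_on UNIV"
    by (intro continuous_discrete_range_constant) auto
  then obtain c where "\<And>x. h x = c"
    by (auto simp: constant_on_def)
  then have "F x = G (x + of_int n) + c" for x
    by (simp add: h_def algebra_simps)
  moreover obtain j where "k = Suc j"
    using k gr0_implies_Suc by blast
  ultimately show "d = nderiv UNIV k F t"
    using nderiv_translate[of F G "of_int n" c j t] n d by simp
qed

text \<open>
  In the following, \<open>D k x\<close> stands for the \<open>k\<close>-th derivative at \<open>x\<close> of the map
  under consideration, and \<open>lam\<close> for Lebesgue measure on \<open>X\<close>.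
\<close>

definition critical_points :: "'a set \<Rightarrow> (nat \<Rightarrow> 'a \<Rightarrow> real) \<Rightarrow> 'a set" where
  "critical_points X D = {x \<in> X. D 1 x = 0}"

definition schwarzian :: "(nat \<Rightarrow> 'a \<Rightarrow> real) \<Rightarrow> 'a \<Rightarrow> real" where
  "schwarzian D x = D 3 x / D 1 x - 3 / 2 * (D 2 x / D 1 x)\<^sup>2"

definition orbit_of :: "('a \<Rightarrow> 'a) \<Rightarrow> 'a \<Rightarrow> 'a set" where
  "orbit_of f x = {(f ^^ n) x | n. True}"

definition interval_lebesgue :: "real measure" where
  "interval_lebesgue = restrict_space lborel {0..1}"

definition circle_lebesgue :: "complex measure" where
  "circle_lebesgue = distr (restrict_space lborel {0..<1}) (restrict_space borel circle) circ"

lemma measurable_circ: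
  "circ \<in> measurable (restrict_space lborel {0..<1}) (restrict_space borel circle)"
proof (rule measurable_restrict_space2)
  have "circ \<in> borel_measurable lborel"
    unfolding circ_def by (simp add: borel_measurable_continuous_onI continuous_intros)
  then show "circ \<in> borel_measurable (restrict_space lborel {0..<1})"
    by (rule measurable_restrict_space1)
qed (simp add: circ_def)

definition invariant_measure :: "('a \<Rightarrow> 'a) \<Rightarrow> 'a measure \<Rightarrow> bool" where
  "invariant_measure f \<mu> \<longleftrightarrow>
     f \<in> measurable \<mu> \<mu> \<and>
     (\<forall>A\<in>sets \<mu>. emeasure \<mu> (f -` A \<inter> space \<mu>) = emeasure \<mu> A)"

definition dynamical_hypotheses ::
  "'a::topological_space set \<Rightarrow> (nat \<Rightarrow> 'a \<Rightarrow> real) \<Rightarrow> 'a measure \<Rightarrow> ('a \<Rightarrow> 'a) \<Rightarrow> bool" where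
  "dynamical_hypotheses X D lam f \<longleftrightarrow>
     finite (critical_points X D) \<and>
     (\<forall>x \<in> X - critical_points X D. schwarzian D x < 0) \<and>
     (\<exists>x\<in>X. X \<subseteq> closure (orbit_of f x)) \<and>
     (\<exists>\<Lambda>. closed \<Lambda> \<and> \<Lambda> \<subseteq> X \<and> f ` \<Lambda> \<subseteq> \<Lambda> \<and> emeasure lam \<Lambda> = 0 \<and>
        (\<forall>c \<in> critical_points X D. orbit_of f c \<subseteq> \<Lambda>))"

definition has_sigma_finite_acim :: "'a measure \<Rightarrow> ('a \<Rightarrow> 'a) \<Rightarrow> bool" where
  "has_sigma_finite_acim lam f \<longleftrightarrow>
     (\<exists>\<mu>. sets \<mu> = sets lam \<and> emeasure \<mu> (space \<mu>) \<noteq> 0 \<and> sigma_finite_measure \<mu> \<and>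
        invariant_measure f \<mu> \<and> absolutely_continuous lam \<mu>)"

end

theory Submission
  imports Defs
begin

text \<open>
  Write \<open>Y\<close> for the complement of \<open>\<Lambda>\<close>. Since \<open>\<Lambda>\<close> is forward invariant and contains the critical orbits,
  every branch of an inverse iterate near a point of \<open>Y\<close> extends to the whole component of \<open>Y\<close>. For such a
  branch \<open>\<psi>\<close>, negativity of the Schwarzian derivative says that \<open>\<bar>\<psi>'\<bar> powr (- 1/2)\<close> is positive and concave.
  A positive concave function is comparable to a constant on compact subintervals, so the distortion of
  \<open>\<psi>\<close> is bounded there independently of the branch and of the iterate.

  Let \<open>p\<^sub>k\<close> be the density of the push-forward of Lebesgue measure \<open>\<lambda>\<close> by the \<open>k\<close>-th iterate. By bounded
  distortion and transitivity, \<open>\<Sum>\<^sub>k p\<^sub>k\<close> either diverges everywhere or converges locally. In the first case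
  the map is conservative; the lower limit \<open>h\<close> of the suitably normalised partial sums is subinvariant by
  Fatou's lemma, hence invariant. In the second case there is a wandering set \<open>W\<close> of positive measure, and an
  invariant density is the sum over all integers \<open>k\<close> of the push-forwards of \<open>\<lambda>\<close> restricted to \<open>W\<close>, where
  for negative \<open>k\<close> one uses iterates of the right inverse \<open>u \<mapsto> (u / p\<^sub>1) \<circ> T\<close> of the transfer operator.
\<close>

section \<open>Invariant densities of nonsingular maps\<close>

text \<open>The distortion bound depends on the chosen compact interval and degenerates near
  \<open>\<Lambda>\<close>, which is why the measure obtained is only \<sigma>-finite. Uniformity in
  the iterate costs nothing: concavity of \<open>\<bar>\<psi>'\<bar> powr (- 1/2)\<close> survives
  composition, so no distortion has to be summed along orbits and no expansion is required. Neither
  ergodicity nor convergence of averages is established, so a lower limit must do in the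
  conservative case. It gives one inequality only, and the absence of wandering sets supplies the
  other. The remaining obstacle is the boundary of the domain, where an inverse branch could be cut
  off. On the interval this is a discussion of the two end points. The circle is cut open at a point
  of \<open>\<Lambda>\<close>; there is one, since negative Schwarzian derivative forces a circle
  map to have a critical point. Both cases thereby become maps of a bounded set of reals, and
  measure theory and distortion are treated once, in locales.\<close>

lemma (in finite_measure) AE_le_of_set_nn_integral_le:
  assumes [measurable]: "q \<in> borel_measurable M" "w \<in> borel_measurable M"
    and le: "\<And>A. A \<in> sets M \<Longrightarrow> (\<integral>\<^sup>+x\<in>A. q x \<partial>M) \<le> (\<integral>\<^sup>+x\<in>A. w x \<partial>M)"
  shows "AE x in M. q x \<le> w x"
proof -
  \<comment> \<open>The truncation \<open>w x \<le> of_nat n\<close> makes the integral of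
    \<open>w\<close> over \<open>A n\<close> finite, as the strict comparison of integrals requires.
    Where \<open>w\<close> is infinite the claim is trivial.\<close>
  define A where "A n = {x\<in>space M. w x < q x \<and> w x \<le> of_nat n}" for n :: nat
  have [measurable]: "A n \<in> sets M" for n
    unfolding A_def by measurable
  have "AE x in M. x \<notin> A n" for n
  proof -
    have "(\<integral>\<^sup>+x\<in>A n. w x \<partial>M) \<le> (\<integral>\<^sup>+x. of_nat n \<partial>M)"
      by (intro nn_integral_mono) (auto simp: A_def split: split_indicator)
    also have "\<dots> < \<infinity>"
      unfolding nn_integral_const infinity_ennreal_def ennreal_mult_less_top
      by (simp add: less_top[symmetric] of_nat_less_top)
    finally have fin: "(\<integral>\<^sup>+x\<in>A n. w x \<partial>M) \<noteq> \<infinity>"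
      by simp
    have "AE x in M. q x * indicator (A n) x \<le> w x * indicator (A n) x"
    proof (rule ccontr)
      assume "\<not> ?thesis"
      then have "(\<integral>\<^sup>+x\<in>A n. w x \<partial>M) < (\<integral>\<^sup>+x\<in>A n. q x \<partial>M)"
        using fin by (intro nn_integral_less) (auto simp: A_def split: split_indicator)
      with le[of "A n"] show False
        by simp
    qed
    then show ?thesis
      by eventually_elim (auto simp: A_def split: split_indicator_asm)
  qed
  then have "AE x in M. \<forall>n. x \<notin> A n"
    by (simp add: AE_all_countable)
  with AE_space show ?thesis
  proof eventually_elim
    case (elim x)
    show ?case
    proof (rule ccontr)
      assume "\<not> q x \<le> w x"
      then have *: "w x < q x" by simp
      then have "w x < top"
        using less_le_trans[OF * top_greatest] by simp
      then obtain n where "w x \<le> of_nat n"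
        using ennreal_Ex_less_of_nat less_imp_le by fastforce
      with elim * show False
        by (auto simp: A_def)
    qed
  qed
qed

locale nonsingular_map = finite_measure M for M :: "'a measure" +
  fixes T :: "'a \<Rightarrow> 'a"
  assumes T_measurable [measurable]: "T \<in> measurable M M"
    and null_preimage: "A \<in> null_sets M \<Longrightarrow> T -` A \<inter> space M \<in> null_sets M"
begin

definition pre :: "nat \<Rightarrow> 'a set \<Rightarrow> 'a set" where
  "pre n A = (T ^^ n) -` A \<inter> space M"

text \<open>The transfer operator of \<open>T ^^ n\<close> applied to the density \<open>u\<close>.
  As a Radon-Nikodym derivative it needs only nonsingularity, not a sum over inverse
  branches.\<close>

definition push :: "('a \<Rightarrow> ennreal) \<Rightarrow> nat \<Rightarrow> 'a \<Rightarrow> ennreal" where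
  "push u n = RN_deriv M (distr (density M u) M (T ^^ n))"

lemma iterate_measurable [measurable]: "T ^^ n \<in> measurable M M"
  by (induction n) (auto intro: measurable_compose measurable_ident simp: o_def)

lemma pre_sets [measurable]: "A \<in> sets M \<Longrightarrow> pre n A \<in> sets M"
  unfolding pre_def by measurable

lemma iterate_space: "x \<in> space M \<Longrightarrow> (T ^^ n) x \<in> space M"
  using measurable_space[OF iterate_measurable] .

lemma pre_pre: "pre m (pre n A) = pre (m + n) A"
  by (auto simp: pre_def add.commute[of m] funpow_add iterate_space)

lemma pre_0: "A \<in> sets M \<Longrightarrow> pre 0 A = A"
  using sets.sets_into_space by (auto simp: pre_def)

lemma pre_mono: "A \<subseteq> B \<Longrightarrow> pre n A \<subseteq> pre n B"
  by (auto simp: pre_def)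

lemma pre_null: "A \<in> null_sets M \<Longrightarrow> pre n A \<in> null_sets M"
proof (induction n)
  case 0
  then show ?case by (simp add: pre_0 null_setsD2)
next
  case (Suc n)
  from null_preimage[OF Suc.IH[OF Suc.prems]]
  have "pre 1 (pre n A) \<in> null_sets M"
    by (simp add: pre_def[of "Suc 0"])
  then show ?case
    by (simp add: pre_pre)
qed

lemma push_measurable [measurable]: "push u n \<in> borel_measurable M"
  by (simp add: push_def)

lemma nn_integral_push:
  assumes u [measurable]: "u \<in> borel_measurable M" and A [measurable]: "A \<in> sets M"
  shows "(\<integral>\<^sup>+x\<in>A. push u n x \<partial>M) = (\<integral>\<^sup>+x\<in>pre n A. u x \<partial>M)"
proof -
  let ?N = "distr (density M u) M (T ^^ n)"
  have ac: "absolutely_continuous M ?N"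
    unfolding absolutely_continuous_def
  proof
    fix B assume B: "B \<in> null_sets M"
    then have [measurable]: "B \<in> sets M" by auto
    have "AE x in M. x \<notin> pre n B"
      using pre_null[OF B] by (rule AE_not_in)
    then have "(\<integral>\<^sup>+x\<in>pre n B. u x \<partial>M) = (\<integral>\<^sup>+x. 0 \<partial>M)"
      by (intro nn_integral_cong_AE) auto
    then have "emeasure ?N B = 0"
      by (simp add: emeasure_distr emeasure_density pre_def[symmetric])
    then show "B \<in> null_sets ?N"
      by auto
  qed
  have "density M (push u n) = ?N"
    unfolding push_def by (rule density_RN_deriv[OF ac]) simp
  then have "emeasure (density M (push u n)) A = emeasure ?N A"
    by simp
  then show ?thesis
    by (simp add: emeasure_distr emeasure_density pre_def[symmetric])
qed

lemma nn_integral_push_one: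
  "A \<in> sets M \<Longrightarrow> (\<integral>\<^sup>+x\<in>A. push (\<lambda>_. 1) n x \<partial>M) = ennreal (measure M (pre n A))"
  by (simp add: nn_integral_push emeasure_eq_measure)

definition wandering :: "'a set \<Rightarrow> bool" where
  "wandering W \<longleftrightarrow> W \<in> sets M \<and> (\<forall>n>0. W \<inter> pre n W = {})"

lemma disjoint_pre_wandering:
  assumes "wandering W"
  shows "disjoint_family (\<lambda>n. pre n W)"
proof -
  have "pre m W \<inter> pre n W = {}" if "m < n" for m n
  proof -
    have "pre m W \<inter> pre n W = pre m (W \<inter> pre (n - m) W)"
      using that pre_pre[of m "n - m" W] by (auto simp: pre_def)
    also have "W \<inter> pre (n - m) W = {}"
      using assms that by (simp add: wandering_def)
    finally show ?thesis
      by (simp add: pre_def)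
  qed
  then show ?thesis
    unfolding disjoint_family_on_def by (metis Int_commute nat_neq_iff)
qed

lemma wandering_summable:
  assumes "wandering W"
  shows "summable (\<lambda>n. measure M (pre n W))"
proof -
  have "range (\<lambda>n. pre n W) \<subseteq> sets M"
    using assms by (auto simp: wandering_def)
  from finite_measure_UNION[OF this disjoint_pre_wandering[OF assms]] show ?thesis
    by (rule sums_summable)
qed

text \<open>If the return measures are summable, almost every point of \<open>B\<close> has a last visit to \<open>B\<close>.\<close>

lemma exists_wandering:
  assumes B [measurable]: "B \<in> sets M" and pos: "B \<notin> null_sets M"
    and sum: "summable (\<lambda>n. measure M (B \<inter> pre n B))"
  obtains W where "wandering W" "W \<subseteq> B" "W \<notin> null_sets M"
proof
  \<comment> \<open>The points of \<open>B\<close> that never return. A last visit to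
    \<open>B\<close> is a point of \<open>W\<close>, so the sets \<open>pre n W\<close> cover almost
    all of \<open>B\<close>; if \<open>W\<close> were null, \<open>B\<close> would be null
    too.\<close>
  define W where "W = B - (\<Union>n. pre (Suc n) B)"
  have [measurable]: "W \<in> sets M"
    unfolding W_def by measurable
  show "W \<subseteq> B"
    by (auto simp: W_def)
  show "wandering W"
    unfolding wandering_def
  proof (intro conjI allI impI)
    fix n :: nat assume "n > 0"
    then obtain m where "n = Suc m"
      using gr0_implies_Suc by blast
    moreover have "pre n W \<subseteq> pre n B"
      using \<open>W \<subseteq> B\<close> by (rule pre_mono)
    ultimately show "W \<inter> pre n W = {}"
      by (auto simp: W_def)
  qed simp
  show "W \<notin> null_sets M"
  proof
    assume "W \<in> null_sets M"
    then have "AE x in M. \<forall>n. x \<notin> pre n W"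
      unfolding AE_all_countable by (intro allI AE_not_in pre_null)
    moreover have "AE x in M. eventually (\<lambda>n. x \<in> space M - (B \<inter> pre n B)) sequentially"
      using sum by (intro borel_cantelli_AE1) (auto simp: emeasure_eq_measure)
    ultimately have "AE x in M. x \<notin> B"
      using AE_space
    proof eventually_elim
      case (elim x)
      show ?case
      proof
        assume "x \<in> B"
        define S where "S = {n. (T ^^ n) x \<in> B}"
        from elim(2) obtain N where "\<And>n. n \<ge> N \<Longrightarrow> n \<notin> S"
          using \<open>x \<in> B\<close> elim(3) by (auto simp: eventually_sequentially S_def pre_def)
        then have "S \<subseteq> {..<N}"
          using not_le by blast
        then have fin: "finite S"
          using finite_subset by blast
        have "S \<noteq> {}"
          using \<open>x \<in> B\<close> by (auto simp: S_def intro!: exI[of _ "0::nat"])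
        then have max: "Max S \<in> S"
          by (rule Max_in[OF fin])
        have "(T ^^ Max S) x \<notin> pre (Suc n) B" for n
        proof
          assume "(T ^^ Max S) x \<in> pre (Suc n) B"
          then have "Suc n + Max S \<in> S"
            using funpow_add[of "Suc n" "Max S" T] by (simp add: pre_def S_def o_def del: funpow.simps)
          then have "Suc n + Max S \<le> Max S"
            using fin by simp
          then show False by simp
        qed
        moreover have "(T ^^ Max S) x \<in> B"
          using max unfolding S_def by blast
        ultimately have "x \<in> pre (Max S) W"
          using elim(3) by (auto simp: pre_def[of "Max S"] W_def)
        with elim(1) show False by blast
      qed
    qed
    then have "B \<in> null_sets M"
      by (simp add: AE_iff_null_sets)
    with pos show False by simp
  qed
qed

text \<open>Let \<open>u\<close> be the defect, \<open>h\<close> minus its push-forward. Iteration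
  turns \<open>h\<close> into the sum of the first \<open>n\<close> push-forwards of
  \<open>u\<close> plus a nonnegative remainder. Where \<open>u\<close> is bounded below and
  \<open>h\<close> above, this bounds the expected number of returns, which yields a wandering set
  unless the defect vanishes.\<close>

lemma subinvariant_density_is_invariant:
  assumes conservative: "\<And>W. wandering W \<Longrightarrow> W \<in> null_sets M"
    and h [measurable]: "h \<in> borel_measurable M" and fin: "AE x in M. h x < \<infinity>"
    and sub: "\<And>A. A \<in> sets M \<Longrightarrow> (\<integral>\<^sup>+x\<in>pre 1 A. h x \<partial>M) \<le> (\<integral>\<^sup>+x\<in>A. h x \<partial>M)"
    and A [measurable]: "A \<in> sets M"
  shows "(\<integral>\<^sup>+x\<in>pre 1 A. h x \<partial>M) = (\<integral>\<^sup>+x\<in>A. h x \<partial>M)"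
proof -
  define q where "q = push h 1"
  have [measurable]: "q \<in> borel_measurable M"
    by (simp add: q_def)
  have le: "AE x in M. q x \<le> h x"
    using sub by (intro AE_le_of_set_nn_integral_le) (simp_all add: q_def nn_integral_push)
  define u where "u x = h x - q x" for x
  have [measurable]: "u \<in> borel_measurable M"
    unfolding u_def by measurable
  have split: "(\<integral>\<^sup>+x\<in>B. h x \<partial>M) = (\<integral>\<^sup>+x\<in>B. u x \<partial>M) + (\<integral>\<^sup>+x\<in>pre 1 B. h x \<partial>M)"
    if [measurable]: "B \<in> sets M" for B
  proof -
    have "(\<integral>\<^sup>+x\<in>B. h x \<partial>M) = (\<integral>\<^sup>+x. u x * indicator B x + q x * indicator B x \<partial>M)"
      using le by (intro nn_integral_cong_AE, eventually_elim)
        (auto simp: u_def diff_add_cancel_ennreal split: split_indicator)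
    also have "\<dots> = (\<integral>\<^sup>+x\<in>B. u x \<partial>M) + (\<integral>\<^sup>+x\<in>B. q x \<partial>M)"
      by (intro nn_integral_add) auto
    finally show ?thesis
      by (simp add: q_def nn_integral_push)
  qed
  have iter: "(\<integral>\<^sup>+x\<in>B. h x \<partial>M) = (\<Sum>k<n. \<integral>\<^sup>+x\<in>pre k B. u x \<partial>M) + (\<integral>\<^sup>+x\<in>pre n B. h x \<partial>M)"
    if [measurable]: "B \<in> sets M" for B n
  proof (induction n)
    case 0
    then show ?case by (simp add: pre_0)
  next
    case (Suc n)
    then show ?case
      using split[of "pre n B"] by (simp add: pre_pre add.assoc)
  qed
  \<comment> \<open>On \<open>B m\<close> the return measures weighted by \<open>1 / Suc m\<close>
    sum to at most the integral of \<open>h\<close>, hence to at most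
    \<open>Suc m * measure M (B m)\<close>. As \<open>h\<close> is finite almost everywhere, the
    sets \<open>B m\<close> exhaust \<open>u \<noteq> 0\<close>.\<close>
  define B where "B m = {x\<in>space M. ennreal (1 / Suc m) \<le> u x \<and> h x \<le> ennreal (Suc m)}" for m :: nat
  have Bs [measurable]: "B m \<in> sets M" for m
    unfolding B_def by measurable
  have "B m \<in> null_sets M" for m
  proof (rule ccontr)
    assume pos: "B m \<notin> null_sets M"
    have bound: "(\<Sum>k<n. measure M (B m \<inter> pre k (B m))) \<le> real (Suc m) * (real (Suc m) * measure M (B m))" for n
    proof -
      have "ennreal (\<Sum>k<n. 1 / Suc m * measure M (B m \<inter> pre k (B m)))
          = (\<Sum>k<n. ennreal (1 / Suc m * measure M (B m \<inter> pre k (B m))))"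
        by (intro sum_ennreal[symmetric]) simp
      also have "\<dots> \<le> (\<Sum>k<n. \<integral>\<^sup>+x\<in>pre k (B m). u x \<partial>M)"
      proof (rule sum_mono)
        fix k
        have "ennreal (1 / Suc m * measure M (B m \<inter> pre k (B m)))
            = (\<integral>\<^sup>+x. ennreal (1 / Suc m) * indicator (B m \<inter> pre k (B m)) x \<partial>M)"
          by (subst nn_integral_cmult_indicator) (auto simp: emeasure_eq_measure simp flip: ennreal_mult')
        also have "\<dots> \<le> (\<integral>\<^sup>+x\<in>pre k (B m). u x \<partial>M)"
          by (intro nn_integral_mono) (auto simp: B_def split: split_indicator)
        finally show "ennreal (1 / Suc m * measure M (B m \<inter> pre k (B m))) \<le> (\<integral>\<^sup>+x\<in>pre k (B m). u x \<partial>M)" .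
      qed
      also have "\<dots> \<le> (\<integral>\<^sup>+x\<in>B m. h x \<partial>M)"
        using iter[of "B m" n] by simp
      also have "\<dots> \<le> (\<integral>\<^sup>+x. ennreal (Suc m) * indicator (B m) x \<partial>M)"
        by (intro nn_integral_mono) (auto simp: B_def split: split_indicator)
      also have "\<dots> = ennreal (Suc m * measure M (B m))"
        by (subst nn_integral_cmult_indicator) (auto simp: emeasure_eq_measure ennreal_mult' simp del: of_nat_Suc)
      finally have "(\<Sum>k<n. 1 / Suc m * measure M (B m \<inter> pre k (B m))) \<le> Suc m * measure M (B m)"
        by (subst (asm) ennreal_le_iff) simp_all
      then have "1 / Suc m * (\<Sum>k<n. measure M (B m \<inter> pre k (B m))) \<le> Suc m * measure M (B m)"
        by (simp only: sum_distrib_left)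
      then show ?thesis
        by (simp only: mult_1_left times_divide_eq_left pos_divide_le_eq[OF of_nat_0_less_iff[THEN iffD2, OF zero_less_Suc]] mult_ac)
    qed
    have "summable (\<lambda>n. measure M (B m \<inter> pre n (B m)))"
      by (rule summableI_nonneg_bounded[OF _ bound]) simp
    from exists_wandering[OF Bs pos this] conservative show False
      by blast
  qed
  then have "AE x in M. \<forall>m. x \<notin> B m"
    unfolding AE_all_countable by (intro allI AE_not_in)
  then have "AE x in M. u x = 0"
    using fin AE_space
  proof eventually_elim
    case (elim x)
    show ?case
    proof (rule ccontr)
      assume "u x \<noteq> 0"
      obtain c where c: "h x = ennreal c" "c \<ge> 0"
        using elim(2) by (cases "h x") auto
      obtain d where d: "u x = ennreal d" "d > 0"
      proof -
        have "u x \<le> h x"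
          unfolding u_def by (rule diff_le_self_ennreal)
        then show thesis
          using \<open>u x \<noteq> 0\<close> c that by (cases "u x") (auto simp: less_le top_unique)
      qed
      obtain m :: nat where m: "m > c" "m > 1 / d"
        using reals_Archimedean2[of "max c (1 / d)"] by auto
      have "1 / Suc m \<le> d"
        using m d by (auto simp: field_simps)
      then have "x \<in> B m"
        using m c d elim(3) by (auto simp: B_def simp del: of_nat_Suc intro!: ennreal_leI)
      with elim show False by blast
    qed
  qed
  then have "(\<integral>\<^sup>+x\<in>A. u x \<partial>M) = (\<integral>\<^sup>+x. 0 \<partial>M)"
    by (intro nn_integral_cong_AE) auto
  then show ?thesis
    using split[OF A] by simp
qed

text \<open>An infinite total integral is harmless: finiteness of the density almost everywhere
  already makes the measure \<sigma>-finite.\<close>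

lemma has_sigma_finite_acimI:
  assumes h [measurable]: "h \<in> borel_measurable M" and fin: "AE x in M. h x \<noteq> \<infinity>"
    and inv: "\<And>A. A \<in> sets M \<Longrightarrow> (\<integral>\<^sup>+x\<in>pre 1 A. h x \<partial>M) = (\<integral>\<^sup>+x\<in>A. h x \<partial>M)"
    and nonzero: "\<not> (AE x in M. h x = 0)"
  shows "has_sigma_finite_acim M T"
  unfolding has_sigma_finite_acim_def
proof (intro exI[of _ "density M h"] conjI)
  show "emeasure (density M h) (space (density M h)) \<noteq> 0"
    using nonzero by (simp add: emeasure_density nn_integral_0_iff_AE)
  show "sigma_finite_measure (density M h)"
    using fin by (simp add: sigma_finite_iff_density_finite)
  show "invariant_measure T (density M h)"
    using inv by (auto simp: invariant_measure_def emeasure_density pre_def)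
  show "absolutely_continuous M (density M h)"
    by (rule absolutely_continuousI_density) simp
qed simp

end

text \<open>The bounds in \<open>distortion\<close> are products so that they stay meaningful when
  \<open>pre n J\<close> is null; the constant may depend on \<open>J\<close> but not on
  \<open>n\<close>. \<open>transitive\<close> serves to compare growth on different pieces.
  \<open>null_reflect\<close> makes the density of the push-forward of \<open>M\<close> nonzero
  almost everywhere, so that the dissipative case can divide by it.\<close>

locale bounded_distortion_map = nonsingular_map M T for M :: "'a measure" and T +
  fixes \<J> :: "'a set set"
  assumes \<J>_countable: "countable \<J>"
    and \<J>_sets: "J \<in> \<J> \<Longrightarrow> J \<in> sets M"
    and \<J>_pos: "J \<in> \<J> \<Longrightarrow> 0 < measure M J"
    and \<J>_cover: "AE x in M. x \<in> \<Union>\<J>"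
    and \<J>_nonempty: "\<J> \<noteq> {}"
    and distortion: "J \<in> \<J> \<Longrightarrow> \<exists>C>0. \<forall>n. \<forall>A\<in>sets M. A \<subseteq> J \<longrightarrow>
          measure M (pre n A) * measure M J \<le> C * measure M A * measure M (pre n J) \<and>
          measure M A * measure M (pre n J) \<le> C * measure M (pre n A) * measure M J"
    and transitive: "J \<in> \<J> \<Longrightarrow> J' \<in> \<J> \<Longrightarrow> \<exists>n. 0 < measure M (J \<inter> pre n J')"
    and null_reflect: "A \<in> sets M \<Longrightarrow> pre 1 A \<in> null_sets M \<Longrightarrow> A \<in> null_sets M"
begin

section \<open>Accumulated mass of preimages and its growth on different pieces\<close>

definition mass :: "nat \<Rightarrow> 'a set \<Rightarrow> real" where
  "mass n A = (\<Sum>k<n. measure M (pre k A))"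

definition dens :: "nat \<Rightarrow> 'a \<Rightarrow> ennreal" where
  "dens n x = (\<Sum>k<n. push (\<lambda>_. 1) k x)"

lemma dens_measurable [measurable]: "dens n \<in> borel_measurable M"
  unfolding dens_def by measurable

lemma mass_nonneg: "0 \<le> mass n A"
  by (simp add: mass_def sum_nonneg)

lemma nn_integral_dens: "A \<in> sets M \<Longrightarrow> (\<integral>\<^sup>+x\<in>A. dens n x \<partial>M) = ennreal (mass n A)"
proof -
  assume [measurable]: "A \<in> sets M"
  have "(\<integral>\<^sup>+x\<in>A. dens n x \<partial>M) = (\<integral>\<^sup>+x. (\<Sum>k<n. push (\<lambda>_. 1) k x * indicator A x) \<partial>M)"
    by (simp only: dens_def sum_distrib_right)
  also have "\<dots> = (\<Sum>k<n. \<integral>\<^sup>+x\<in>A. push (\<lambda>_. 1) k x \<partial>M)"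
    by (rule nn_integral_sum) measurable
  finally show ?thesis
    by (simp add: mass_def nn_integral_push_one)
qed

lemma AE_of_parts:
  assumes "\<And>J. J \<in> \<J> \<Longrightarrow> AE x in M. x \<in> J \<longrightarrow> P x"
  shows "AE x in M. P x"
proof -
  have "AE x in M. \<forall>J\<in>\<J>. x \<in> J \<longrightarrow> P x"
    unfolding AE_ball_countable[OF \<J>_countable] using assms by blast
  with \<J>_cover show ?thesis
    by eventually_elim auto
qed

lemma mass_distortion:
  assumes "J \<in> \<J>"
  obtains C where "C > 0"
    "\<And>n A. A \<in> sets M \<Longrightarrow> A \<subseteq> J \<Longrightarrow> mass n A \<le> C * mass n J * measure M A"
    "\<And>n A. A \<in> sets M \<Longrightarrow> A \<subseteq> J \<Longrightarrow> mass n J * measure M A \<le> C * mass n A"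
proof -
  obtain C where C: "C > 0"
    and D: "\<And>n A. A \<in> sets M \<Longrightarrow> A \<subseteq> J \<Longrightarrow>
        measure M (pre n A) * measure M J \<le> C * measure M A * measure M (pre n J) \<and>
        measure M A * measure M (pre n J) \<le> C * measure M (pre n A) * measure M J"
    using distortion[OF assms] by blast
  \<comment> \<open>The factor \<open>measure M J\<close> stands on opposite sides of the two
    distortion bounds; one constant absorbs it in both.\<close>
  define K where "K = max (C / measure M J) (C * measure M J)"
  have J: "0 < measure M J"
    using \<J>_pos[OF assms] .
  have K: "K > 0" "C \<le> K * measure M J" "C * measure M J \<le> K"
    using C J by (auto simp: K_def less_max_iff_disj le_max_iff_disj simp flip: pos_divide_le_eq)
  show thesis
  proof
    show "K > 0" by fact
    fix n A assume A: "A \<in> sets M" "A \<subseteq> J"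
    have 1: "measure M (pre k A) \<le> K * measure M (pre k J) * measure M A" for k
    proof -
      have "measure M (pre k A) * measure M J \<le> C * (measure M A * measure M (pre k J))"
        using D[OF A, of k] by (simp add: mult_ac)
      also have "\<dots> \<le> (K * measure M J) * (measure M A * measure M (pre k J))"
        using K by (intro mult_right_mono) auto
      finally have "measure M (pre k A) * measure M J
          \<le> (K * measure M (pre k J) * measure M A) * measure M J"
        by (simp add: mult_ac)
      then show ?thesis
        using J by simp
    qed
    have 2: "measure M (pre k J) * measure M A \<le> K * measure M (pre k A)" for k
    proof -
      have "measure M (pre k J) * measure M A \<le> (C * measure M J) * measure M (pre k A)"
        using D[OF A, of k] by (simp add: mult_ac)
      also have "\<dots> \<le> K * measure M (pre k A)"
        using K by (intro mult_right_mono) auto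
      finally show ?thesis .
    qed
    show "mass n A \<le> K * mass n J * measure M A"
      using 1 by (auto simp: mass_def sum_distrib_left sum_distrib_right intro!: sum_mono)
    show "mass n J * measure M A \<le> K * mass n A"
      using 2 by (auto simp: mass_def sum_distrib_left sum_distrib_right intro!: sum_mono)
  qed
qed

lemma mass_Suc: "mass (Suc n) A = mass n A + measure M (pre n A)"
  by (simp add: mass_def)

lemma mass_mono: "m \<le> n \<Longrightarrow> mass m A \<le> mass n A"
  unfolding mass_def by (intro sum_mono2) auto

text \<open>Passing to \<open>pre m A\<close> shifts the window of summation by \<open>m\<close>,
  and each of the \<open>m\<close> new terms is at most the total mass.\<close>

lemma mass_pre_le: "mass n (pre m A) \<le> mass n A + m * measure M (space M)"
proof (induction m)
  case (Suc m)
  have "mass n (pre (Suc m) A) = (\<Sum>k<n. measure M (pre (Suc k) (pre m A)))"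
    by (simp add: mass_def pre_pre)
  also have "\<dots> = mass (Suc n) (pre m A) - measure M (pre 0 (pre m A))"
    by (subst mass_def, subst sum.lessThan_Suc_shift) simp
  also have "\<dots> \<le> mass n (pre m A) + measure M (space M)"
    using bounded_measure[of "pre n (pre m A)"] by (simp add: mass_Suc add_increasing2 algebra_simps
        add_mono_thms_linordered_semiring(1))
  finally show ?case
    using Suc by (simp add: algebra_simps)
qed (simp add: mass_def pre_pre)

text \<open>A subset of \<open>J\<close> of positive measure lands in \<open>J'\<close> after
  \<open>m\<close> steps. By distortion it carries a fixed share of \<open>mass n J\<close>, and
  delaying by \<open>m\<close> changes masses only by a bounded amount. So all pieces grow at
  comparable speed, and summability on one of them is summability on all.\<close>

lemma mass_compare:
  assumes J: "J \<in> \<J>" and J': "J' \<in> \<J>"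
  obtains K where "K > 0" "\<And>n. mass n J \<le> K * (mass n J' + K)"
proof -
  obtain m where pos: "0 < measure M (J \<inter> pre m J')"
    using transitive[OF J J'] by blast
  obtain C where C: "C > 0" "\<And>n A. A \<in> sets M \<Longrightarrow> A \<subseteq> J \<Longrightarrow> mass n J * measure M A \<le> C * mass n A"
    using mass_distortion[OF J] by metis
  let ?V = "J \<inter> pre m J'"
  have V: "?V \<in> sets M"
    using \<J>_sets J J' by simp
  \<comment> \<open>The same \<open>K\<close> serves as multiplicative constant and as bound for the
    delay by \<open>m\<close> steps.\<close>
  define K where "K = max (C / measure M ?V) (m * measure M (space M))"
  have K: "K > 0"
    using C pos by (auto simp: K_def less_max_iff_disj)
  have "mass n J \<le> K * (mass n J' + K)" for n
  proof -
    have "mass n J * measure M ?V \<le> C * mass n ?V"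
      by (rule C) (use V in auto)
    then have "mass n J \<le> (C / measure M ?V) * mass n ?V"
      using pos by (simp add: field_simps)
    also have "\<dots> \<le> K * mass n ?V"
      by (intro mult_right_mono mass_nonneg) (simp add: K_def)
    also have "mass n ?V \<le> mass n (pre m J')"
      unfolding mass_def using J'[THEN \<J>_sets]
      by (intro sum_mono finite_measure_mono pre_mono) auto
    also have "\<dots> \<le> mass n J' + K"
      using mass_pre_le[of n m J'] by (simp add: K_def)
    finally show ?thesis
      using K by simp
  qed
  with K that show thesis
    by blast
qed

lemma summable_transfer:
  assumes J: "J \<in> \<J>" and J': "J' \<in> \<J>" and sum: "summable (\<lambda>n. measure M (pre n J'))"
  shows "summable (\<lambda>n. measure M (pre n J))"
proof -
  obtain K where K: "K > 0" "\<And>n. mass n J \<le> K * (mass n J' + K)"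
    using mass_compare[OF J J'] by blast
  have "mass n J' \<le> (\<Sum>n. measure M (pre n J'))" for n
    unfolding mass_def by (rule sum_le_suminf[OF sum]) auto
  then have "mass n J \<le> K * ((\<Sum>n. measure M (pre n J')) + K)" for n
    using K by (meson add_right_mono mult_left_mono less_imp_le order_trans)
  then show ?thesis
    by (intro summableI_nonneg_bounded) (auto simp: mass_def)
qed

section \<open>The conservative case\<close>

lemma wandering_null:
  assumes div: "\<And>J. J \<in> \<J> \<Longrightarrow> \<not> summable (\<lambda>n. measure M (pre n J))" and W: "wandering W"
  shows "W \<in> null_sets M"
proof -
  have [measurable]: "W \<in> sets M"
    using W by (simp add: wandering_def)
  have "AE x in M. x \<notin> W"
  proof (rule AE_of_parts)
    fix J assume J: "J \<in> \<J>"
    then have [measurable]: "J \<in> sets M"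
      by (rule \<J>_sets)
    \<comment> \<open>If \<open>W \<inter> J\<close> had positive measure, it would carry a fixed
      share of \<open>mass n J\<close>. Its own masses stay bounded because the preimages of
      \<open>W\<close> are disjoint, so \<open>mass n J\<close> would be bounded as well.\<close>
    have "measure M (W \<inter> J) = 0"
    proof (rule ccontr)
      assume "measure M (W \<inter> J) \<noteq> 0"
      then have pos: "measure M (W \<inter> J) > 0"
        by (simp add: zero_less_measure_iff)
      obtain C where C: "C > 0" "\<And>n A. A \<in> sets M \<Longrightarrow> A \<subseteq> J \<Longrightarrow> mass n J * measure M A \<le> C * mass n A"
        using mass_distortion[OF J] by metis
      have sum: "summable (\<lambda>n. measure M (pre n W))"
        by (rule wandering_summable[OF W])
      have "mass n J \<le> C * (\<Sum>n. measure M (pre n W)) / measure M (W \<inter> J)" for n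
      proof -
        have "mass n J * measure M (W \<inter> J) \<le> C * mass n (W \<inter> J)"
          by (rule C) auto
        also have "mass n (W \<inter> J) \<le> mass n W"
          unfolding mass_def by (intro sum_mono finite_measure_mono pre_mono) auto
        also have "mass n W \<le> (\<Sum>n. measure M (pre n W))"
          unfolding mass_def by (rule sum_le_suminf[OF sum]) auto
        finally show ?thesis
          using pos C(1) by (simp add: field_simps)
      qed
      then have "summable (\<lambda>n. measure M (pre n J))"
        by (intro summableI_nonneg_bounded) (auto simp: mass_def)
      with div[OF J] show False by simp
    qed
    then have "W \<inter> J \<in> null_sets M"
      by (intro null_setsI) (auto simp: emeasure_eq_measure)
    then have "AE x in M. x \<notin> W \<inter> J"
      by (rule AE_not_in)
    then show "AE x in M. x \<in> J \<longrightarrow> x \<notin> W"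
      by eventually_elim auto
  qed
  then show ?thesis
    by (simp add: AE_iff_null_sets)
qed

text \<open>Pushing the partial sum \<open>dens n\<close> forward only drops its term
  \<open>k = 0\<close> and adds one at the other end. After normalisation subinvariance survives in
  the limit provided consecutive normalising constants have ratio tending to 1. Distortion and
  \<open>mass_compare\<close> keep the limit density finite on every piece and positive on
  \<open>J\<^sub>0\<close>.\<close>

lemma conservative_acim:
  assumes div: "\<And>J. J \<in> \<J> \<Longrightarrow> \<not> summable (\<lambda>n. measure M (pre n J))"
  shows "has_sigma_finite_acim M T"
proof -
  obtain J\<^sub>0 where J\<^sub>0: "J\<^sub>0 \<in> \<J>"
    using \<J>_nonempty by blast
  then have [measurable]: "J\<^sub>0 \<in> sets M"
    by (rule \<J>_sets)
  \<comment> \<open>The index \<open>Suc n\<close> includes the term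
    \<open>measure M J\<^sub>0\<close>, so that \<open>a n\<close> is bounded away from 0 from the
    start.\<close>
  define a where "a n = mass (Suc n) J\<^sub>0" for n
  define c where "c = measure M J\<^sub>0"
  have c: "c > 0"
    using \<J>_pos[OF J\<^sub>0] by (simp add: c_def)
  have a_c: "c \<le> a n" for n
    using mass_mono[of 1 "Suc n" J\<^sub>0] by (simp add: a_def c_def mass_def pre_0)
  have a_pos: "0 < a n" for n
    using c a_c[of n] by linarith
  have a_step: "a n \<le> a (Suc n)" "a (Suc n) \<le> a n + measure M (space M)" for n
    using bounded_measure by (auto simp: a_def mass_Suc)
  \<comment> \<open>Divergence enters here: \<open>a\<close> tends to infinity while each increment
    is at most the total mass.\<close>
  have a_lim: "(\<lambda>n. a n / a (Suc n)) \<longlonglongrightarrow> 1"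
  proof -
    have "filterlim (\<lambda>n. mass n J\<^sub>0) at_top sequentially"
    proof (rule ccontr)
      assume "\<not> ?thesis"
      then obtain B where B: "\<exists>\<^sub>F n in sequentially. mass n J\<^sub>0 < B"
        by (auto simp: filterlim_at_top frequently_def not_less)
      have "mass n J\<^sub>0 \<le> B" for n
      proof -
        obtain m where "m \<ge> n" "mass m J\<^sub>0 < B"
          using B by (auto simp: frequently_sequentially)
        with mass_mono[of n m J\<^sub>0] show ?thesis by linarith
      qed
      then have "summable (\<lambda>n. measure M (pre n J\<^sub>0))"
        by (intro summableI_nonneg_bounded) (auto simp: mass_def)
      with div[OF J\<^sub>0] show False by simp
    qed
    then have "filterlim (\<lambda>n. a (Suc n)) at_top sequentially"
      unfolding a_def by (rule filterlim_compose) (intro filterlim_compose[OF filterlim_Suc filterlim_Suc])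
    then have "(\<lambda>n. measure M (space M) / a (Suc n)) \<longlonglongrightarrow> 0"
      by (rule real_tendsto_divide_at_top[OF tendsto_const])
    then have lim: "(\<lambda>n. 1 - measure M (space M) / a (Suc n)) \<longlonglongrightarrow> 1 - 0"
      by (intro tendsto_intros)
    show ?thesis
    proof (rule tendsto_sandwich[OF _ _ lim[simplified] tendsto_const])
      show "\<forall>\<^sub>F n in sequentially. 1 - measure M (space M) / a (Suc n) \<le> a n / a (Suc n)"
      proof (intro always_eventually allI)
        fix n
        have "a (Suc n) - measure M (space M) \<le> a n"
          using a_step(2)[of n] by simp
        from divide_right_mono[OF this less_imp_le[OF a_pos[of "Suc n"]]]
        show "1 - measure M (space M) / a (Suc n) \<le> a n / a (Suc n)"
          using a_pos[of "Suc n"] by (simp add: diff_divide_distrib)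
      qed
      show "\<forall>\<^sub>F n in sequentially. a n / a (Suc n) \<le> 1"
        using a_step(1) a_pos by (intro always_eventually) (auto simp: field_simps)
    qed
  qed
  define s where "s n x = dens (Suc n) x / ennreal (a n)" for n x
  define h where "h x = liminf (\<lambda>n. s n x)" for x
  have [measurable]: "s n \<in> borel_measurable M" for n
    unfolding s_def by measurable
  have [measurable]: "h \<in> borel_measurable M"
    unfolding h_def by measurable

  have upper: "\<exists>B. AE x in M. x \<in> J \<longrightarrow> h x \<le> ennreal B" if J: "J \<in> \<J>" for J
  proof -
    have [measurable]: "J \<in> sets M"
      using \<J>_sets[OF J] .
    obtain C where C: "C > 0"
      "\<And>n A. A \<in> sets M \<Longrightarrow> A \<subseteq> J \<Longrightarrow> mass n A \<le> C * mass n J * measure M A"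
      using mass_distortion[OF J] by metis
    obtain K where K: "K > 0" "\<And>n. mass n J \<le> K * (mass n J\<^sub>0 + K)"
      using mass_compare[OF J J\<^sub>0] by blast
    \<comment> \<open>\<open>C\<close> is the distortion on \<open>J\<close>; \<open>K\<close>
      converts the mass of \<open>J\<close> into at most \<open>K * (a n + K)\<close>; and
      \<open>a n \<ge> c\<close> bounds the quotient of this by \<open>a n\<close>.\<close>
    define B where "B = C * K * (1 + K / c)"
    have "AE x in M. s n x * indicator J x \<le> ennreal B * indicator J x" for n
    proof (rule AE_le_of_set_nn_integral_le)
      fix A assume [measurable]: "A \<in> sets M"
      have "mass (Suc n) (J \<inter> A) \<le> C * mass (Suc n) J * measure M (J \<inter> A)"
        by (rule C) auto
      also have "\<dots> \<le> C * (K * (a n + K)) * measure M (J \<inter> A)"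
        using C(1) K(2)[of "Suc n"] by (intro mult_right_mono mult_left_mono) (auto simp: a_def)
      finally have "mass (Suc n) (J \<inter> A) / a n \<le> C * (K * (a n + K)) * measure M (J \<inter> A) / a n"
        using a_pos[of n] by (simp add: divide_right_mono)
      also have "\<dots> = C * K * (1 + K / a n) * measure M (J \<inter> A)"
        using a_pos[of n] by (simp add: field_simps)
      also have "\<dots> \<le> B * measure M (J \<inter> A)"
        unfolding B_def using C K c a_c[of n]
        by (intro mult_right_mono mult_left_mono add_left_mono divide_left_mono) auto
      finally have le: "mass (Suc n) (J \<inter> A) / a n \<le> B * measure M (J \<inter> A)" .
      have "(\<integral>\<^sup>+x\<in>A. s n x * indicator J x \<partial>M) = (\<integral>\<^sup>+x. dens (Suc n) x * indicator (J \<inter> A) x / ennreal (a n) \<partial>M)"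
        by (intro nn_integral_cong) (auto simp: s_def split: split_indicator)
      also have "\<dots> = ennreal (mass (Suc n) (J \<inter> A) / a n)"
        using a_pos[of n] by (simp add: nn_integral_divide nn_integral_dens divide_ennreal mass_nonneg)
      also have "\<dots> \<le> ennreal (B * measure M (J \<inter> A))"
        by (rule ennreal_leI[OF le])
      also have "\<dots> = (\<integral>\<^sup>+x. ennreal B * indicator (J \<inter> A) x \<partial>M)"
        using C K c by (subst nn_integral_cmult_indicator) (auto simp: emeasure_eq_measure ennreal_mult B_def)
      also have "\<dots> = (\<integral>\<^sup>+x\<in>A. ennreal B * indicator J x \<partial>M)"
        by (intro nn_integral_cong) (auto split: split_indicator)
      finally show "(\<integral>\<^sup>+x\<in>A. s n x * indicator J x \<partial>M) \<le> (\<integral>\<^sup>+x\<in>A. ennreal B * indicator J x \<partial>M)" .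
    qed auto
    then have "AE x in M. \<forall>n. s n x * indicator J x \<le> ennreal B * indicator J x"
      by (simp add: AE_all_countable)
    then have "AE x in M. x \<in> J \<longrightarrow> h x \<le> ennreal B"
    proof eventually_elim
      case (elim x)
      show ?case
      proof
        assume "x \<in> J"
        then have "s n x \<le> ennreal B" for n
          using elim by (auto dest: spec[of _ n])
        then have "h x \<le> liminf (\<lambda>n. ennreal B)"
          unfolding h_def by (intro Liminf_mono always_eventually) auto
        then show "h x \<le> ennreal B"
          by (simp add: Liminf_const)
      qed
    qed
    then show ?thesis by blast
  qed
  have fin: "AE x in M. h x < \<infinity>"
  proof (rule AE_of_parts)
    fix J assume "J \<in> \<J>"
    from upper[OF this] obtain B where "AE x in M. x \<in> J \<longrightarrow> h x \<le> ennreal B"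
      by blast
    then show "AE x in M. x \<in> J \<longrightarrow> h x < \<infinity>"
      by eventually_elim (auto intro: le_less_trans)
  qed
  \<comment> \<open>The normalising constant is the mass of \<open>J\<^sub>0\<close> itself, so
    distortion on \<open>J\<^sub>0\<close> bounds every \<open>s n\<close> below by
    \<open>1 / C\<close> there.\<close>
  have lower: "\<exists>b>0. AE x in M. x \<in> J\<^sub>0 \<longrightarrow> ennreal b \<le> h x"
  proof -
    obtain C where C: "C > 0"
      "\<And>n A. A \<in> sets M \<Longrightarrow> A \<subseteq> J\<^sub>0 \<Longrightarrow> mass n J\<^sub>0 * measure M A \<le> C * mass n A"
      using mass_distortion[OF J\<^sub>0] by metis
    have "AE x in M. ennreal (1 / C) * indicator J\<^sub>0 x \<le> s n x * indicator J\<^sub>0 x" for n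
    proof (rule AE_le_of_set_nn_integral_le)
      fix A assume [measurable]: "A \<in> sets M"
      have "a n * measure M (J\<^sub>0 \<inter> A) \<le> C * mass (Suc n) (J\<^sub>0 \<inter> A)"
        unfolding a_def by (rule C) auto
      then have le: "1 / C * measure M (J\<^sub>0 \<inter> A) \<le> mass (Suc n) (J\<^sub>0 \<inter> A) / a n"
        using C a_pos[of n] by (simp add: field_simps)
      have "(\<integral>\<^sup>+x\<in>A. ennreal (1 / C) * indicator J\<^sub>0 x \<partial>M) = (\<integral>\<^sup>+x. ennreal (1 / C) * indicator (J\<^sub>0 \<inter> A) x \<partial>M)"
        by (intro nn_integral_cong) (auto split: split_indicator)
      also have "\<dots> = ennreal (1 / C * measure M (J\<^sub>0 \<inter> A))"
        using C by (subst nn_integral_cmult_indicator) (auto simp: emeasure_eq_measure simp flip: ennreal_mult')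
      also have "\<dots> \<le> ennreal (mass (Suc n) (J\<^sub>0 \<inter> A) / a n)"
        by (rule ennreal_leI[OF le])
      also have "\<dots> = (\<integral>\<^sup>+x. dens (Suc n) x * indicator (J\<^sub>0 \<inter> A) x / ennreal (a n) \<partial>M)"
        using a_pos[of n] by (simp add: nn_integral_divide nn_integral_dens divide_ennreal mass_nonneg)
      also have "\<dots> = (\<integral>\<^sup>+x\<in>A. s n x * indicator J\<^sub>0 x \<partial>M)"
        by (intro nn_integral_cong) (auto simp: s_def split: split_indicator)
      finally show "(\<integral>\<^sup>+x\<in>A. ennreal (1 / C) * indicator J\<^sub>0 x \<partial>M) \<le> (\<integral>\<^sup>+x\<in>A. s n x * indicator J\<^sub>0 x \<partial>M)" .
    qed auto
    then have "AE x in M. \<forall>n. ennreal (1 / C) * indicator J\<^sub>0 x \<le> s n x * indicator J\<^sub>0 x"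
      by (simp add: AE_all_countable)
    then have "AE x in M. x \<in> J\<^sub>0 \<longrightarrow> ennreal (1 / C) \<le> h x"
    proof eventually_elim
      case (elim x)
      show ?case
      proof
        assume "x \<in> J\<^sub>0"
        then have "ennreal (1 / C) \<le> s n x" for n
          using elim by (auto dest: spec[of _ n])
        then have "liminf (\<lambda>n. ennreal (1 / C)) \<le> h x"
          unfolding h_def by (intro Liminf_mono always_eventually) auto
        then show "ennreal (1 / C) \<le> h x"
          by (simp add: Liminf_const)
      qed
    qed
    then show ?thesis
      using C(1) by (intro exI[of _ "1 / C"]) auto
  qed

  \<comment> \<open>Tail infima increase to \<open>h\<close>, and \<open>i N\<close> lies below
    every \<open>s n\<close> with \<open>n \<ge> N\<close>. Its push-forward is therefore below
    \<open>s (Suc n)\<close>, up to the ratio of normalising constants, hence below the lower limit.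
    Monotone convergence in \<open>N\<close> then gives subinvariance of \<open>h\<close>.\<close>
  define i where "i N x = (INF n\<in>{N..}. s n x)" for N x
  have [measurable]: "i N \<in> borel_measurable M" for N
    unfolding i_def by measurable
  have push_i: "AE x in M. push (i N) 1 x \<le> h x" for N
  proof -
    have "AE x in M. push (i N) 1 x * ennreal (a n / a (Suc n)) \<le> s (Suc n) x" if n: "n \<ge> N" for n
    proof (rule AE_le_of_set_nn_integral_le)
      fix A assume [measurable]: "A \<in> sets M"
      have "(\<integral>\<^sup>+x\<in>pre 1 A. i N x \<partial>M) \<le> (\<integral>\<^sup>+x\<in>pre 1 A. s n x \<partial>M)"
        using n by (intro nn_integral_mono mult_right_mono) (auto simp: i_def intro: INF_lower)
      also have "\<dots> = (\<integral>\<^sup>+x. dens (Suc n) x * indicator (pre 1 A) x / ennreal (a n) \<partial>M)"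
        by (intro nn_integral_cong) (auto simp: s_def split: split_indicator)
      also have "\<dots> = ennreal (mass (Suc n) (pre 1 A) / a n)"
        using a_pos[of n] by (simp add: nn_integral_divide nn_integral_dens divide_ennreal mass_nonneg)
      \<comment> \<open>The right side has the additional term \<open>k = 0\<close>, namely
        \<open>measure M A\<close>.\<close>
      also have "mass (Suc n) (pre 1 A) \<le> mass (Suc (Suc n)) A"
        by (simp add: mass_def pre_pre sum.lessThan_Suc_shift[of _ "Suc n"] del: sum.lessThan_Suc)
      finally have le: "(\<integral>\<^sup>+x\<in>pre 1 A. i N x \<partial>M) \<le> ennreal (mass (Suc (Suc n)) A / a n)"
        using a_pos[of n] by (simp add: divide_right_mono ennreal_leI)
      have "(\<integral>\<^sup>+x\<in>A. push (i N) 1 x * ennreal (a n / a (Suc n)) \<partial>M)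
          = (\<integral>\<^sup>+x. ennreal (a n / a (Suc n)) * (push (i N) 1 x * indicator A x) \<partial>M)"
        by (simp add: mult_ac)
      also have "\<dots> = ennreal (a n / a (Suc n)) * (\<integral>\<^sup>+x\<in>pre 1 A. i N x \<partial>M)"
        by (simp add: nn_integral_cmult nn_integral_push del: One_nat_def)
      also have "\<dots> \<le> ennreal (a n / a (Suc n)) * ennreal (mass (Suc (Suc n)) A / a n)"
        by (intro mult_left_mono le) simp
      also have "\<dots> = ennreal (mass (Suc (Suc n)) A / a (Suc n))"
        using a_pos[of n] a_pos[of "Suc n"] mass_nonneg by (simp flip: ennreal_mult')
      also have "\<dots> = (\<integral>\<^sup>+x. dens (Suc (Suc n)) x * indicator A x / ennreal (a (Suc n)) \<partial>M)"
        using a_pos[of "Suc n"] by (simp add: nn_integral_divide nn_integral_dens divide_ennreal mass_nonneg)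
      also have "\<dots> = (\<integral>\<^sup>+x\<in>A. s (Suc n) x \<partial>M)"
        by (intro nn_integral_cong) (auto simp: s_def split: split_indicator)
      finally show "(\<integral>\<^sup>+x\<in>A. push (i N) 1 x * ennreal (a n / a (Suc n)) \<partial>M) \<le> (\<integral>\<^sup>+x\<in>A. s (Suc n) x \<partial>M)" .
    qed auto
    then have "AE x in M. \<forall>n\<in>{N..}. push (i N) 1 x * ennreal (a n / a (Suc n)) \<le> s (Suc n) x"
      by (simp add: AE_ball_countable)
    then show ?thesis
    proof eventually_elim
      case (elim x)
      have "(\<lambda>n. push (i N) 1 x * ennreal (a n / a (Suc n))) \<longlonglongrightarrow> push (i N) 1 x * ennreal 1"
        by (intro tendsto_mult_ennreal tendsto_const tendsto_ennrealI a_lim) auto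
      then have "push (i N) 1 x = liminf (\<lambda>n. push (i N) 1 x * ennreal (a n / a (Suc n)))"
        by (simp add: lim_imp_Liminf)
      also have "\<dots> \<le> liminf (\<lambda>n. s (n + 1) x)"
        using elim by (intro Liminf_mono) (auto simp: eventually_sequentially)
      also have "\<dots> = h x"
        unfolding h_def by (rule liminf_shift)
      finally show ?case .
    qed
  qed
  have sub: "(\<integral>\<^sup>+x\<in>pre 1 A. h x \<partial>M) \<le> (\<integral>\<^sup>+x\<in>A. h x \<partial>M)" if [measurable]: "A \<in> sets M" for A
  proof -
    have "(\<integral>\<^sup>+x\<in>pre 1 A. h x \<partial>M) = (\<integral>\<^sup>+x. (SUP N. i N x * indicator (pre 1 A) x) \<partial>M)"
      by (intro nn_integral_cong) (simp add: h_def liminf_SUP_INF i_def SUP_mult_right_ennreal)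
    also have "\<dots> = (SUP N. \<integral>\<^sup>+x\<in>pre 1 A. i N x \<partial>M)"
    proof (rule nn_integral_monotone_convergence_SUP)
      show "incseq (\<lambda>N x. i N x * indicator (pre 1 A) x)"
        by (auto simp: incseq_def le_fun_def i_def intro!: mult_right_mono INF_superset_mono)
    qed auto
    also have "\<dots> \<le> (\<integral>\<^sup>+x\<in>A. h x \<partial>M)"
    proof (rule SUP_least)
      fix N
      have "(\<integral>\<^sup>+x\<in>pre 1 A. i N x \<partial>M) = (\<integral>\<^sup>+x\<in>A. push (i N) 1 x \<partial>M)"
        by (simp add: nn_integral_push)
      also have "\<dots> \<le> (\<integral>\<^sup>+x\<in>A. h x \<partial>M)"
        using push_i[of N] by (intro nn_integral_mono_AE, eventually_elim) (auto intro: mult_right_mono)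
      finally show "(\<integral>\<^sup>+x\<in>pre 1 A. i N x \<partial>M) \<le> (\<integral>\<^sup>+x\<in>A. h x \<partial>M)" .
    qed
    finally show ?thesis .
  qed
  show ?thesis
  proof (rule has_sigma_finite_acimI)
    show "h \<in> borel_measurable M" by measurable
    show "AE x in M. h x \<noteq> \<infinity>"
      using fin by eventually_elim auto
    show "(\<integral>\<^sup>+x\<in>pre 1 A. h x \<partial>M) = (\<integral>\<^sup>+x\<in>A. h x \<partial>M)" if "A \<in> sets M" for A
      using wandering_null[OF div] fin sub that by (intro subinvariant_density_is_invariant) auto
    show "\<not> (AE x in M. h x = 0)"
    proof
      assume "AE x in M. h x = 0"
      moreover obtain b where "b > 0" "AE x in M. x \<in> J\<^sub>0 \<longrightarrow> ennreal b \<le> h x"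
        using lower by blast
      ultimately have "AE x in M. x \<notin> J\<^sub>0"
        by (auto elim!: eventually_elim2)
      then have "J\<^sub>0 \<in> null_sets M"
        by (simp add: AE_iff_null_sets)
      with \<J>_pos[OF J\<^sub>0] show False
        by (simp add: measure_eq_0_null_sets)
    qed
  qed
qed

section \<open>The dissipative case\<close>

lemma dissipative_acim:
  assumes sum: "\<And>J. J \<in> \<J> \<Longrightarrow> summable (\<lambda>n. measure M (pre n J))"
  shows "has_sigma_finite_acim M T"
proof -
  obtain J\<^sub>0 where J\<^sub>0: "J\<^sub>0 \<in> \<J>"
    using \<J>_nonempty by blast
  then have [measurable]: "J\<^sub>0 \<in> sets M"
    by (rule \<J>_sets)
  have "summable (\<lambda>n. measure M (J\<^sub>0 \<inter> pre n J\<^sub>0))"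
    by (rule summable_comparison_test'[OF sum[OF J\<^sub>0]]) (auto intro: finite_measure_mono)
  moreover have "J\<^sub>0 \<notin> null_sets M"
    using \<J>_pos[OF J\<^sub>0] by (auto dest: measure_eq_0_null_sets)
  ultimately obtain W where W: "wandering W" "W \<notin> null_sets M"
    using exists_wandering[of J\<^sub>0] by auto
  then have [measurable]: "W \<in> sets M"
    by (simp add: wandering_def)

  define p where "p = push (\<lambda>_. 1) 1"
  have [measurable]: "p \<in> borel_measurable M"
    by (simp add: p_def)
  \<comment> \<open>The zero set of \<open>p\<close> has a null preimage, hence is null by
    \<open>null_reflect\<close>.\<close>
  have p_pos: "AE x in M. p x \<noteq> 0"
  proof -
    let ?Z = "{x\<in>space M. p x = 0}"
    have "ennreal (measure M (pre 1 ?Z)) = (\<integral>\<^sup>+x\<in>?Z. p x \<partial>M)"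
      by (simp add: p_def nn_integral_push_one)
    also have "\<dots> = (\<integral>\<^sup>+x. 0 \<partial>M)"
      by (intro nn_integral_cong) (auto split: split_indicator)
    finally have "pre 1 ?Z \<in> null_sets M"
      by (intro null_setsI) (auto simp: emeasure_eq_measure)
    then have "?Z \<in> null_sets M"
      by (rule null_reflect[rotated]) measurable
    then have "AE x in M. x \<notin> ?Z"
      by (rule AE_not_in)
    with AE_space show ?thesis
      by eventually_elim auto
  qed
  have p_fin: "AE x in M. p x \<noteq> \<infinity>"
  proof (rule nn_integral_noteq_infinite)
    have "(\<integral>\<^sup>+x. p x \<partial>M) = (\<integral>\<^sup>+x\<in>space M. p x \<partial>M)"
      by (intro nn_integral_cong) auto
    also have "\<dots> = ennreal (measure M (pre 1 (space M)))"
      unfolding p_def by (rule nn_integral_push_one) simp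
    finally show "(\<integral>\<^sup>+x. p x \<partial>M) \<noteq> \<infinity>"
      by simp
  qed simp

  \<comment> \<open>\<open>w (Suc k)\<close> is a past of \<open>w k\<close>: since
    \<open>distr M M T\<close> has density \<open>p\<close>, composing with \<open>T\<close> and
    dividing by \<open>p \<circ> T\<close> is undone by one push-forward.\<close>
  define w where "w = rec_nat (indicator W) (\<lambda>_ v x. v (T x) / p (T x))"
  have w_0: "w 0 = indicator W" and w_Suc: "w (Suc k) = (\<lambda>x. w k (T x) / p (T x))" for k
    by (simp_all add: w_def)
  have w_measurable [measurable]: "w k \<in> borel_measurable M" for k
    by (induction k) (auto simp: w_0 w_Suc)
  have distr: "distr M M T = density M p"
  proof (rule measure_eqI)
    fix A assume "A \<in> sets (distr M M T)"
    then have "A \<in> sets M" by simp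
    then show "emeasure (distr M M T) A = emeasure (density M p) A"
      by (simp add: emeasure_distr emeasure_density p_def nn_integral_push_one pre_def emeasure_eq_measure)
  qed simp
  have w_push: "(\<integral>\<^sup>+x\<in>pre 1 A. w (Suc k) x \<partial>M) = (\<integral>\<^sup>+x\<in>A. w k x \<partial>M)"
    if [measurable]: "A \<in> sets M" for A k
  proof -
    have "(\<integral>\<^sup>+x\<in>pre 1 A. w (Suc k) x \<partial>M) = (\<integral>\<^sup>+x. w k (T x) / p (T x) * indicator A (T x) \<partial>M)"
      by (intro nn_integral_cong) (auto simp: w_Suc pre_def split: split_indicator)
    also have "\<dots> = (\<integral>\<^sup>+x. w k x / p x * indicator A x \<partial>distr M M T)"
      by (subst nn_integral_distr) auto
    also have "\<dots> = (\<integral>\<^sup>+x. p x * (w k x / p x * indicator A x) \<partial>M)"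
      unfolding distr by (subst nn_integral_density) auto
    also have "\<dots> = (\<integral>\<^sup>+x\<in>A. w k x \<partial>M)"
      using p_pos p_fin
    proof (intro nn_integral_cong_AE, eventually_elim)
      case (elim x)
      then have "p x * (w k x / p x) = w k x"
        by (simp add: ennreal_times_divide mult.commute[of "p x"] ennreal_mult_divide_eq)
      then show ?case
        by (simp add: mult.assoc[symmetric])
    qed
    finally show ?thesis .
  qed
  have w_zero: "w k x = 0" if "x \<in> space M" "x \<notin> pre k W" for k x
    using that
  proof (induction k arbitrary: x)
    case 0
    then show ?case by (simp add: w_0 pre_0)
  next
    case (Suc k)
    have "T x \<in> space M"
      using Suc.prems(1) measurable_space[OF T_measurable] by blast
    moreover have "T x \<notin> pre k W"
      using Suc.prems by (simp add: pre_def funpow_swap1)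
    ultimately show ?case
      using Suc.IH by (simp add: w_Suc)
  qed
  have w_int: "(\<integral>\<^sup>+x. w k x \<partial>M) = ennreal (measure M W)" for k
  proof (induction k)
    case 0
    then show ?case by (simp add: w_0 emeasure_eq_measure)
  next
    case (Suc k)
    have "pre 1 (space M) = space M"
      using iterate_space[of _ 1] by (auto simp: pre_def)
    then have "(\<integral>\<^sup>+x. w (Suc k) x \<partial>M) = (\<integral>\<^sup>+x\<in>pre 1 (space M). w (Suc k) x \<partial>M)"
      by (intro nn_integral_cong) simp
    also have "\<dots> = (\<integral>\<^sup>+x\<in>space M. w k x \<partial>M)"
      by (rule w_push) simp
    also have "\<dots> = (\<integral>\<^sup>+x. w k x \<partial>M)"
      by (intro nn_integral_cong) auto
    finally show ?case
      using Suc by simp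
  qed
  \<comment> \<open>\<open>w k\<close> lives on \<open>pre k W\<close>, and these sets are disjoint,
    so at each point at most one summand is nonzero.\<close>
  have w_fin: "AE x in M. (\<Sum>k. w (Suc k) x) \<noteq> \<infinity>"
  proof -
    have "AE x in M. w k x \<noteq> \<infinity>" for k
      by (rule nn_integral_noteq_infinite) (simp_all add: w_int)
    then have "AE x in M. \<forall>k. w k x \<noteq> \<infinity>"
      by (simp add: AE_all_countable)
    with AE_space show ?thesis
    proof eventually_elim
      case (elim x)
      define k where "k = (SOME k. x \<in> pre (Suc k) W)"
      have zero: "w (Suc j) x = 0" if "j \<notin> {k}" for j
      proof (rule w_zero)
        show "x \<notin> pre (Suc j) W"
        proof
          assume j: "x \<in> pre (Suc j) W"
          then have "x \<in> pre (Suc k) W"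
            unfolding k_def by (rule someI)
          with j have "pre (Suc j) W \<inter> pre (Suc k) W \<noteq> {}"
            by blast
          with disjoint_pre_wandering[OF W(1)] that show False
            by (auto simp: disjoint_family_on_def)
        qed
      qed fact
      have "(\<Sum>k. w (Suc k) x) = (\<Sum>j\<in>{k}. w (Suc j) x)"
        by (rule suminf_finite) (use zero in auto)
      with elim show ?case by simp
    qed
  qed

  define v where "v k = push (indicator W) k" for k
  have [measurable]: "v k \<in> borel_measurable M" for k
    by (simp add: v_def)
  have v_int: "(\<integral>\<^sup>+x\<in>A. v k x \<partial>M) = ennreal (measure M (W \<inter> pre k A))"
    if [measurable]: "A \<in> sets M" for A k
  proof -
    have "(\<integral>\<^sup>+x\<in>A. v k x \<partial>M) = (\<integral>\<^sup>+x\<in>pre k A. indicator W x \<partial>M)"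
      unfolding v_def by (rule nn_integral_push) measurable
    also have "\<dots> = (\<integral>\<^sup>+x. indicator (W \<inter> pre k A) x \<partial>M)"
      by (intro nn_integral_cong) (simp split: split_indicator)
    finally have "(\<integral>\<^sup>+x\<in>A. v k x \<partial>M) = (\<integral>\<^sup>+x. indicator (W \<inter> pre k A) x \<partial>M)" .
    then show ?thesis
      by (simp add: emeasure_eq_measure)
  qed
  \<comment> \<open>The future terms need not have disjoint supports. Their integrals over
    \<open>J\<close> are at most \<open>measure M (pre k J)\<close>, which is summable by
    assumption.\<close>
  have v_fin: "AE x in M. (\<Sum>k. v k x) \<noteq> \<infinity>"
  proof (rule AE_of_parts)
    fix J assume J: "J \<in> \<J>"
    then have [measurable]: "J \<in> sets M"
      by (rule \<J>_sets)
    have "AE x in M. (\<Sum>k. v k x) * indicator J x \<noteq> \<infinity>"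
    proof (rule nn_integral_noteq_infinite)
      have "(\<integral>\<^sup>+x\<in>J. (\<Sum>k. v k x) \<partial>M) = (\<Sum>k. ennreal (measure M (W \<inter> pre k J)))"
        unfolding ennreal_suminf_multc[symmetric] by (subst nn_integral_suminf) (simp_all add: v_int)
      also have "\<dots> \<noteq> top"
        by (intro ennreal_suminf_neq_top summable_comparison_test'[OF sum[OF J]])
          (auto intro: finite_measure_mono)
      finally show "(\<integral>\<^sup>+x\<in>J. (\<Sum>k. v k x) \<partial>M) \<noteq> \<infinity>"
        by simp
    qed simp
    then show "AE x in M. x \<in> J \<longrightarrow> (\<Sum>k. v k x) \<noteq> \<infinity>"
      by eventually_elim auto
  qed

  \<comment> \<open>A two-sided orbit of densities through \<open>indicator W\<close>. One
    push-forward moves every term one place up, from \<open>w 1\<close> to \<open>w 0\<close> and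
    from \<open>v 0\<close> to \<open>v 1\<close>; it is invariant because \<open>v 0\<close> and
    \<open>w 0\<close> represent the same density. The sum over \<open>w\<close> starts at 1 to
    count that density once.\<close>
  define h where "h x = (\<Sum>k. v k x) + (\<Sum>k. w (Suc k) x)" for x
  have [measurable]: "h \<in> borel_measurable M"
    unfolding h_def by measurable
  have h_int: "(\<integral>\<^sup>+x\<in>A. h x \<partial>M) = (\<Sum>k. \<integral>\<^sup>+x\<in>A. v k x \<partial>M) + (\<Sum>k. \<integral>\<^sup>+x\<in>A. w (Suc k) x \<partial>M)"
    if [measurable]: "A \<in> sets M" for A
  proof -
    have "(\<integral>\<^sup>+x\<in>A. h x \<partial>M)
        = (\<integral>\<^sup>+x. (\<Sum>k. v k x * indicator A x) + (\<Sum>k. w (Suc k) x * indicator A x) \<partial>M)"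
      unfolding h_def distrib_right ennreal_suminf_multc ..
    also have "\<dots> = (\<integral>\<^sup>+x. (\<Sum>k. v k x * indicator A x) \<partial>M)
        + (\<integral>\<^sup>+x. (\<Sum>k. w (Suc k) x * indicator A x) \<partial>M)"
      by (rule nn_integral_add) measurable
    also have "(\<integral>\<^sup>+x. (\<Sum>k. v k x * indicator A x) \<partial>M) = (\<Sum>k. \<integral>\<^sup>+x\<in>A. v k x \<partial>M)"
      by (rule nn_integral_suminf) measurable
    also have "(\<integral>\<^sup>+x. (\<Sum>k. w (Suc k) x * indicator A x) \<partial>M) = (\<Sum>k. \<integral>\<^sup>+x\<in>A. w (Suc k) x \<partial>M)"
      by (rule nn_integral_suminf) measurable
    finally show ?thesis .
  qed
  show ?thesis
  proof (rule has_sigma_finite_acimI)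
    show "AE x in M. h x \<noteq> \<infinity>"
      using v_fin w_fin by eventually_elim (simp add: h_def)
    show "(\<integral>\<^sup>+x\<in>pre 1 A. h x \<partial>M) = (\<integral>\<^sup>+x\<in>A. h x \<partial>M)" if A [measurable]: "A \<in> sets M" for A
    proof -
      have shift: "(\<Sum>k. f k) = (\<Sum>k. f (Suc k)) + f 0" for f :: "nat \<Rightarrow> ennreal"
        using suminf_offset[of f 1] by simp
      have v_pre: "(\<integral>\<^sup>+x\<in>pre 1 A. v k x \<partial>M) = (\<integral>\<^sup>+x\<in>A. v (Suc k) x \<partial>M)" for k
        by (simp add: v_int pre_pre)
      have "(\<integral>\<^sup>+x\<in>A. v 0 x \<partial>M) = (\<integral>\<^sup>+x\<in>A. w 0 x \<partial>M)"
      proof -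
        have "(\<integral>\<^sup>+x\<in>A. w 0 x \<partial>M) = (\<integral>\<^sup>+x. indicator (W \<inter> A) x \<partial>M)"
          unfolding w_0 by (intro nn_integral_cong) (simp split: split_indicator)
        then show ?thesis
          using A by (simp add: v_int pre_0 emeasure_eq_measure)
      qed
      then show ?thesis
        unfolding h_int[OF A] h_int[OF pre_sets[OF A]] v_pre w_push[OF A]
          shift[of "\<lambda>k. \<integral>\<^sup>+x\<in>A. v k x \<partial>M"] shift[of "\<lambda>k. \<integral>\<^sup>+x\<in>A. w k x \<partial>M"]
        by (simp only: ac_simps)
    qed
    show "\<not> (AE x in M. h x = 0)"
    proof
      assume "AE x in M. h x = 0"
      then have "(\<integral>\<^sup>+x\<in>W. h x \<partial>M) = (\<integral>\<^sup>+x. 0 \<partial>M)"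
        by (intro nn_integral_cong_AE) auto
      then have "(\<integral>\<^sup>+x\<in>W. v 0 x \<partial>M) = 0"
        by (simp add: h_int suminf_eq_zero_iff)
      then have "emeasure M W = 0"
        by (simp add: v_int pre_0 emeasure_eq_measure)
      with W(2) show False
        by auto
    qed
  qed simp
qed

theorem acim: "has_sigma_finite_acim M T"
proof (cases "\<exists>J\<in>\<J>. summable (\<lambda>n. measure M (pre n J))")
  case True
  then show ?thesis
    by (intro dissipative_acim) (auto intro: summable_transfer)
next
  case False
  then show ?thesis
    by (intro conservative_acim) blast
qed

end

section \<open>Koebe distortion for inverse branches\<close>

text \<open>For smooth \<psi> the function \<open>r = \<bar>\<psi>'\<bar> powr (- 1/2)\<close>
  satisfies \<open>r'' = - (S\<psi> / 2) * r\<close>, so this says that \<psi> has nonnegative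
  Schwarzian derivative. The weak inequality admits the identity and translations; \<open>e\<close>
  is the orientation.\<close>

definition concave_branch :: "(real \<Rightarrow> real) \<Rightarrow> real set \<Rightarrow> bool" where
  "concave_branch \<psi> I \<longleftrightarrow> (\<exists>e\<in>{-1, 1}. \<exists>r r' r''. \<forall>y\<in>I. 0 < r y \<and> r'' y \<le> 0 \<and>
     (\<psi> has_real_derivative e / (r y)\<^sup>2) (at y) \<and>
     (r has_real_derivative r' y) (at y) \<and> (r' has_real_derivative r'' y) (at y))"

lemma concave_branch_id: "concave_branch (\<lambda>y. y) I"
  unfolding concave_branch_def
  by (rule bexI[of _ 1], rule exI[of _ "\<lambda>_. 1"], rule exI[of _ "\<lambda>_. 0"], rule exI[of _ "\<lambda>_. 0"])
    (auto intro: DERIV_ident)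

text \<open>
  With \<open>r = \<bar>\<psi>'\<bar> powr (- 1/2)\<close> and \<open>s = \<bar>\<eta>'\<bar> powr (- 1/2)\<close>, the corresponding function of \<open>\<eta> \<circ> \<psi>\<close> is
  \<open>(s \<circ> \<psi>) * r\<close>, whose second derivative is \<open>(s'' \<circ> \<psi>) / r\<^sup>3 + (s \<circ> \<psi>) * r''\<close>.
\<close>

lemma concave_branch_compose:
  assumes \<psi>: "concave_branch \<psi> I" and \<eta>: "concave_branch \<eta> (\<psi> ` I)"
  shows "concave_branch (\<lambda>y. \<eta> (\<psi> y)) I"
proof -
  obtain e r r' r'' where e: "e \<in> {-1, 1}" and r: "\<And>y. y \<in> I \<Longrightarrow> 0 < r y" "\<And>y. y \<in> I \<Longrightarrow> r'' y \<le> 0"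
    and d\<psi>: "\<And>y. y \<in> I \<Longrightarrow> (\<psi> has_real_derivative e / (r y)\<^sup>2) (at y)"
    and dr: "\<And>y. y \<in> I \<Longrightarrow> (r has_real_derivative r' y) (at y)"
    and dr': "\<And>y. y \<in> I \<Longrightarrow> (r' has_real_derivative r'' y) (at y)"
    using \<psi> unfolding concave_branch_def by metis
  obtain d s s' s'' where d: "d \<in> {-1, 1}" and s: "\<And>y. y \<in> I \<Longrightarrow> 0 < s (\<psi> y)" "\<And>y. y \<in> I \<Longrightarrow> s'' (\<psi> y) \<le> 0"
    and d\<eta>: "\<And>y. y \<in> I \<Longrightarrow> (\<eta> has_real_derivative d / (s (\<psi> y))\<^sup>2) (at (\<psi> y))"
    and ds: "\<And>y. y \<in> I \<Longrightarrow> (s has_real_derivative s' (\<psi> y)) (at (\<psi> y))"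
    and ds': "\<And>y. y \<in> I \<Longrightarrow> (s' has_real_derivative s'' (\<psi> y)) (at (\<psi> y))"
    using \<eta> unfolding concave_branch_def by (metis imageI)
  define R where "R y = s (\<psi> y) * r y" for y
  define R' where "R' y = e * s' (\<psi> y) / r y + s (\<psi> y) * r' y" for y
  define R'' where "R'' y = s'' (\<psi> y) / (r y)^3 + s (\<psi> y) * r'' y" for y
  have ee: "e * e = 1"
    using e by auto
  have "0 < R y \<and> R'' y \<le> 0 \<and> ((\<lambda>y. \<eta> (\<psi> y)) has_real_derivative (d * e) / (R y)\<^sup>2) (at y) \<and>
     (R has_real_derivative R' y) (at y) \<and> (R' has_real_derivative R'' y) (at y)" if y: "y \<in> I" for y
  proof (intro conjI)
    note pos = r(1)[OF y] s(1)[OF y]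
    show "0 < R y"
      using pos by (simp add: R_def)
    show "R'' y \<le> 0"
      unfolding R''_def using pos r(2)[OF y] s(2)[OF y]
      by (intro add_nonpos_nonpos divide_nonpos_pos mult_nonneg_nonpos) auto
    have "((\<lambda>y. \<eta> (\<psi> y)) has_real_derivative d / (s (\<psi> y))\<^sup>2 * (e / (r y)\<^sup>2)) (at y)"
      by (rule DERIV_chain2[OF d\<eta>[OF y] d\<psi>[OF y]])
    then show "((\<lambda>y. \<eta> (\<psi> y)) has_real_derivative (d * e) / (R y)\<^sup>2) (at y)"
      by (simp add: R_def power_mult_distrib)
    have s\<psi>: "((\<lambda>y. s (\<psi> y)) has_real_derivative s' (\<psi> y) * (e / (r y)\<^sup>2)) (at y)"
      by (rule DERIV_chain2[OF ds[OF y] d\<psi>[OF y]])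
    have s'\<psi>: "((\<lambda>y. s' (\<psi> y)) has_real_derivative s'' (\<psi> y) * (e / (r y)\<^sup>2)) (at y)"
      by (rule DERIV_chain2[OF ds'[OF y] d\<psi>[OF y]])
    have "s' (\<psi> y) * (e / (r y)\<^sup>2) * r y + r' y * s (\<psi> y) = R' y"
      using pos by (simp add: R'_def field_simps power2_eq_square)
    with DERIV_mult[OF s\<psi> dr[OF y]] show "(R has_real_derivative R' y) (at y)"
      by (simp add: R_def[abs_def])
    \<comment> \<open>The two mixed terms in \<open>s' (\<psi> y) * r' y\<close> cancel, which
      leaves a sum of two nonpositive terms.\<close>
    have eq: "(e * (s'' (\<psi> y) * (e / (r y)\<^sup>2)) * r y - e * s' (\<psi> y) * r' y) / (r y * r y)
        + (s' (\<psi> y) * (e / (r y)\<^sup>2) * r' y + r'' y * s (\<psi> y)) = R'' y"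
    proof -
      have "(e * (s'' (\<psi> y) * (e / (r y)\<^sup>2)) * r y) = s'' (\<psi> y) / r y"
        using pos ee by (simp add: field_simps power2_eq_square)
      then show ?thesis
        using pos by (simp add: R''_def field_simps power2_eq_square power3_eq_cube)
    qed
    have "((\<lambda>y. e * s' (\<psi> y)) has_real_derivative e * (s'' (\<psi> y) * (e / (r y)\<^sup>2))) (at y)"
      by (rule DERIV_cmult[OF s'\<psi>])
    from DERIV_add[OF DERIV_divide[OF this dr[OF y]] DERIV_mult[OF s\<psi> dr'[OF y]]] pos eq
    show "(R' has_real_derivative R'' y) (at y)"
      by (simp add: R'_def[abs_def])
  qed
  moreover have "d * e \<in> {-1, 1}"
    using d e by auto
  ultimately show ?thesis
    unfolding concave_branch_def by blast
qed

lemma concave_branch_deriv: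
  assumes "concave_branch \<psi> I" "y \<in> I"
  obtains D where "D \<noteq> 0" "(\<psi> has_real_derivative D) (at y)"
proof -
  obtain e r where "e \<in> {-1, 1}" "0 < r y" "(\<psi> has_real_derivative e / (r y)\<^sup>2) (at y)"
    using assms unfolding concave_branch_def by metis
  then show thesis
    by (intro that[of "e / (r y)\<^sup>2"]) auto
qed

lemma concave_branch_continuous:
  assumes "concave_branch \<psi> I"
  shows "continuous_on I \<psi>"
proof (rule continuous_at_imp_continuous_on, rule)
  fix y assume "y \<in> I"
  then obtain D where "(\<psi> has_real_derivative D) (at y)"
    using concave_branch_deriv[OF assms] by metis
  then show "isCont \<psi> y"
    by (rule DERIV_isCont)
qed

lemma concave_branch_inj:
  assumes "concave_branch \<psi> I" "connected I"
  shows "inj_on \<psi> I"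
proof (rule linorder_inj_onI)
  fix x y assume xy: "x < y" "x \<in> I" "y \<in> I"
  have I: "z \<in> I" if "x \<le> z" "z \<le> y" for z
    using connectedD_interval[OF assms(2) xy(2,3) that] .
  have diff: "\<psi> differentiable (at z)" if "x < z" "z < y" for z
    using concave_branch_deriv[OF assms(1) I] that by (meson less_imp_le real_differentiable_def)
  have "continuous_on {x..y} \<psi>"
    by (rule continuous_on_subset[OF concave_branch_continuous[OF assms(1)]]) (auto intro: I)
  from MVT[OF xy(1) this diff] obtain l z where z: "x < z" "z < y"
    "(\<psi> has_real_derivative l) (at z)" "\<psi> y - \<psi> x = (y - x) * l"
    by auto
  obtain D where "D \<noteq> 0" "(\<psi> has_real_derivative D) (at z)"
    using concave_branch_deriv[OF assms(1) I] z by (metis less_imp_le)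
  with z have "l \<noteq> 0"
    using DERIV_unique by blast
  with z xy show "\<psi> x \<noteq> \<psi> y"
    by auto
qed auto

lemma concave_branch_open_image:
  assumes "concave_branch \<psi> I" "connected I" "open I"
  shows "open (\<psi> ` I)"
  using invariance_of_domain concave_branch_continuous concave_branch_inj assms by blast

text \<open>\<open>y\<close> is a convex combination of \<open>y'\<close> and a point
  \<open>w\<close> beyond it. Concavity bounds \<open>r y\<close> below by the same combination of
  values, and positivity allows the term at \<open>w\<close> to be dropped. The constant is a lower
  bound for the weight of \<open>y'\<close>.\<close>

lemma concave_harnack:
  fixes r :: "real \<Rightarrow> real"
  assumes conc: "concave_on {\<alpha><..<\<beta>} r" and pos: "\<And>z. z \<in> {\<alpha><..<\<beta>} \<Longrightarrow> 0 < r z"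
    and ord: "\<alpha> < c" "d < \<beta>" and y: "y \<in> {c..d}" and y': "y' \<in> {c..d}"
  shows "min (c - \<alpha>) (\<beta> - d) / (2 * (\<beta> - \<alpha>)) * r y' \<le> r y"
proof -
  define \<delta> where "\<delta> = min (c - \<alpha>) (\<beta> - d)"
  \<comment> \<open>Half of the gap outside \<open>{c..d}\<close>, on the side of \<open>y\<close>
    away from \<open>y'\<close>: inside the open interval, where \<open>r\<close> is controlled, and
    still at distance at least \<open>\<delta> / 2\<close> from \<open>y\<close>.\<close>
  define w where "w = (if y \<le> y' then (\<alpha> + c) / 2 else (d + \<beta>) / 2)"
  define t where "t = (if y = y' then 1 else (y - w) / (y' - w))"
  have w: "w \<in> {\<alpha><..<\<beta>}"
    using ord y by (auto simp: w_def)
  have \<delta>: "\<delta> > 0"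
    using ord by (simp add: \<delta>_def)
  have \<alpha>\<beta>: "\<alpha> < \<beta>"
    using w by auto
  have t: "\<delta> / (2 * (\<beta> - \<alpha>)) \<le> t" "t \<le> 1" "(1 - t) * w + t * y' = y"
  proof -
    consider "y = y'" | "y < y'" | "y' < y" by linarith
    then have "\<delta> / (2 * (\<beta> - \<alpha>)) \<le> t \<and> t \<le> 1 \<and> (1 - t) * w + t * y' = y"
    proof cases
      case 1
      then show ?thesis
        using ord y \<alpha>\<beta> by (auto simp: t_def \<delta>_def)
    next
      case 2
      then have w_eq: "w = (\<alpha> + c) / 2" and t_eq: "t = (y - w) / (y' - w)"
        by (simp_all add: w_def t_def)
      have *: "0 < y' - w" "y' - w \<le> \<beta> - \<alpha>" "\<delta> / 2 \<le> y - w"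
        using 2 y y' ord by (auto simp: w_eq \<delta>_def min_def field_simps)
      have "\<delta> / (2 * (\<beta> - \<alpha>)) = \<delta> / 2 / (\<beta> - \<alpha>)"
        by simp
      also have "\<dots> \<le> t"
        unfolding t_eq using * \<delta> by (intro frac_le) auto
      moreover have "(1 - t) * w + t * y' = w + t * (y' - w)"
        by (simp add: algebra_simps)
      ultimately show ?thesis
        using * 2 by (simp add: t_eq)
    next
      case 3
      then have w_eq: "w = (d + \<beta>) / 2" and t_eq: "t = (y - w) / (y' - w)"
        by (simp_all add: w_def t_def)
      have *: "0 < w - y'" "w - y' \<le> \<beta> - \<alpha>" "\<delta> / 2 \<le> w - y"
        using 3 y y' ord by (auto simp: w_eq \<delta>_def min_def field_simps)
      have t_eq': "t = (w - y) / (w - y')"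
        unfolding t_eq by (metis minus_diff_eq minus_divide_divide)
      have "\<delta> / (2 * (\<beta> - \<alpha>)) = \<delta> / 2 / (\<beta> - \<alpha>)"
        by simp
      also have "\<dots> \<le> t"
        unfolding t_eq' using * \<delta> by (intro frac_le) auto
      moreover have "(1 - t) * w + t * y' = w - t * (w - y')"
        by (simp add: algebra_simps)
      ultimately show ?thesis
        using * 3 by (simp add: t_eq')
    qed
    then show "\<delta> / (2 * (\<beta> - \<alpha>)) \<le> t" "t \<le> 1" "(1 - t) * w + t * y' = y"
      by auto
  qed
  have "0 \<le> \<delta> / (2 * (\<beta> - \<alpha>))"
    using \<delta> \<alpha>\<beta> by simp
  then have "0 \<le> t"
    using t(1) by linarith
  have y'_in: "y' \<in> {\<alpha><..<\<beta>}"
    using y' ord by auto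
  have "(1 - t) * r w + t * r y' \<le> r y"
    using concave_onD[OF conc \<open>0 \<le> t\<close> t(2) w y'_in] t(3) by simp
  moreover have "0 \<le> (1 - t) * r w"
    using t(2) pos[OF w] by simp
  moreover have "\<delta> / (2 * (\<beta> - \<alpha>)) * r y' \<le> t * r y'"
    using t(1) pos[OF y'_in] by (intro mult_right_mono) auto
  ultimately show ?thesis
    unfolding \<delta>_def by linarith
qed

lemma measure_image_bounds:
  fixes \<psi> \<psi>' :: "real \<Rightarrow> real"
  assumes der: "\<And>y. y \<in> {c..d} \<Longrightarrow> (\<psi> has_real_derivative \<psi>' y) (at y)"
    and cont: "continuous_on {c..d} \<psi>'" and inj: "inj_on \<psi> {c..d}"
    and bounds: "\<And>y. y \<in> {c..d} \<Longrightarrow> p \<le> \<bar>\<psi>' y\<bar> \<and> \<bar>\<psi>' y\<bar> \<le> q"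
    and A: "A \<in> sets borel" "A \<subseteq> {c..d}"
  shows "p * measure lebesgue A \<le> measure lebesgue (\<psi> ` A)"
    and "measure lebesgue (\<psi> ` A) \<le> q * measure lebesgue A"
    and "\<psi> ` A \<in> lmeasurable"
proof -
  have A_meas: "A \<in> lmeasurable"
    by (rule bounded_set_imp_lmeasurable) (use A bounded_subset[OF bounded_closed_interval] in auto)
  have abs_int: "(\<lambda>y. \<bar>\<psi>' y\<bar> * 1) absolutely_integrable_on A"
  proof (rule set_integrable_subset)
    show "set_integrable lebesgue {c..d} (\<lambda>y. \<bar>\<psi>' y\<bar> * 1)"
      by (rule absolutely_integrable_continuous_real) (intro continuous_intros cont)
  qed (use A in auto)
  have int: "(\<lambda>y. 1::real) absolutely_integrable_on (\<psi> ` A) \<and>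
      integral (\<psi> ` A) (\<lambda>y. 1::real) = integral A (\<lambda>y. \<bar>\<psi>' y\<bar> * 1)"
    by (subst has_absolute_integral_change_of_variables_1'[symmetric, where g' = \<psi>'])
      (use A der inj abs_int A_meas in
        \<open>auto intro: inj_on_subset simp: subset_iff has_field_derivative_at_within\<close>)
  then show im: "\<psi> ` A \<in> lmeasurable"
    by (simp add: lmeasurable_iff_integrable_on absolutely_integrable_on_def)
  have eq: "measure lebesgue (\<psi> ` A) = integral A (\<lambda>y. \<bar>\<psi>' y\<bar>)"
    using int im by (simp add: lmeasure_integral)
  have i: "(\<lambda>y. \<bar>\<psi>' y\<bar>) integrable_on A"
    using abs_int by (simp add: absolutely_integrable_on_def)
  have const: "(\<lambda>y. k) integrable_on A" "integral A (\<lambda>y. k) = k * measure lebesgue A" for k :: real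
    using A_meas lmeasure_integral[OF A_meas] integral_mult_right[of A k "\<lambda>_. 1"]
    by (auto simp: integrable_on_const)
  have "integral A (\<lambda>y. p) \<le> integral A (\<lambda>y. \<bar>\<psi>' y\<bar>)"
    by (rule integral_le[OF const(1) i]) (use bounds A in auto)
  then show "p * measure lebesgue A \<le> measure lebesgue (\<psi> ` A)"
    by (simp add: const eq)
  have "integral A (\<lambda>y. \<bar>\<psi>' y\<bar>) \<le> integral A (\<lambda>y. q)"
    by (rule integral_le[OF i const(1)]) (use bounds A in auto)
  then show "measure lebesgue (\<psi> ` A) \<le> q * measure lebesgue A"
    by (simp add: const eq)
qed

text \<open>The Koebe principle. \<open>C\<close> is obtained before \<psi> and depends only on the
  four end points, so it serves all branches of all iterates; only the scale \<open>q\<close> varies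
  with the branch.\<close>

lemma concave_branch_distortion:
  assumes ord: "\<alpha> < c" "c < d" "d < \<beta>"
  obtains C where "C > 0"
    "\<And>\<psi>. concave_branch \<psi> {\<alpha><..<\<beta>} \<Longrightarrow> \<exists>q>0. \<forall>A\<in>sets borel. A \<subseteq> {c..d} \<longrightarrow>
        \<psi> ` A \<in> lmeasurable \<and> q * measure lebesgue A \<le> measure lebesgue (\<psi> ` A) \<and>
        measure lebesgue (\<psi> ` A) \<le> C * q * measure lebesgue A"
proof -
  define \<kappa> where "\<kappa> = min (c - \<alpha>) (\<beta> - d) / (2 * (\<beta> - \<alpha>))"
  have \<kappa>: "\<kappa> > 0"
    using ord by (simp add: \<kappa>_def)
  show thesis
  proof (rule that[of "1 / \<kappa>^4"])
    show "0 < 1 / \<kappa>^4"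
      using \<kappa> by simp
    fix \<psi> assume \<psi>: "concave_branch \<psi> {\<alpha><..<\<beta>}"
    obtain e r r' r'' where e: "e \<in> {-1, 1}"
      and r: "\<And>y. y \<in> {\<alpha><..<\<beta>} \<Longrightarrow> 0 < r y" "\<And>y. y \<in> {\<alpha><..<\<beta>} \<Longrightarrow> r'' y \<le> 0"
      and d\<psi>: "\<And>y. y \<in> {\<alpha><..<\<beta>} \<Longrightarrow> (\<psi> has_real_derivative e / (r y)\<^sup>2) (at y)"
      and dr: "\<And>y. y \<in> {\<alpha><..<\<beta>} \<Longrightarrow> (r has_real_derivative r' y) (at y)"
      and dr': "\<And>y. y \<in> {\<alpha><..<\<beta>} \<Longrightarrow> (r' has_real_derivative r'' y) (at y)"
      using \<psi> unfolding concave_branch_def by metis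
    have sub: "{c..d} \<subseteq> {\<alpha><..<\<beta>}"
      using ord by auto
    have conc: "concave_on {\<alpha><..<\<beta>} r"
      by (rule f''_le0_imp_concave[OF _ dr dr' r(2)]) auto
    have harnack: "\<kappa> * r y' \<le> r y" if "y \<in> {c..d}" "y' \<in> {c..d}" for y y'
      using concave_harnack[OF conc r(1) ord(1,3) that] by (simp add: \<kappa>_def)
    have c: "c \<in> {c..d}"
      using ord by auto
    \<comment> \<open>Since \<open>\<bar>\<psi>'\<bar> = 1 / r\<^sup>2\<close>, comparing
      \<open>r y\<close> with \<open>r c\<close> in both directions puts it between
      \<open>\<kappa>\<^sup>2 / (r c)\<^sup>2\<close> and
      \<open>1 / (\<kappa>\<^sup>2 * (r c)\<^sup>2)\<close>. The quotient of these bounds is the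
      constant \<open>1 / \<kappa>^4\<close>.\<close>
    define q where "q = \<kappa>\<^sup>2 / (r c)\<^sup>2"
    have rc: "r c > 0"
      using r(1) c sub by blast
    have bounds: "q \<le> \<bar>e / (r y)\<^sup>2\<bar> \<and> \<bar>e / (r y)\<^sup>2\<bar> \<le> 1 / \<kappa>^4 * q" if y: "y \<in> {c..d}" for y
    proof -
      have ry: "r y > 0"
        using r(1) y sub by blast
      have 1: "\<bar>e / (r y)\<^sup>2\<bar> = 1 / (r y)\<^sup>2"
        using e by auto
      have "(\<kappa> * r y)\<^sup>2 \<le> (r c)\<^sup>2" "(\<kappa> * r c)\<^sup>2 \<le> (r y)\<^sup>2"
        using harnack[OF c y] harnack[OF y c] \<kappa> rc ry by (auto intro!: power_mono)
      then show ?thesis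
        unfolding 1 q_def using \<kappa> rc ry
        by (auto simp: field_simps power_mult_distrib power2_eq_square power4_eq_xxxx)
    qed
    have "continuous_on {c..d} r"
      using dr sub by (intro continuous_at_imp_continuous_on) (meson DERIV_isCont subsetD)
    moreover have "(r y)\<^sup>2 \<noteq> 0" if "y \<in> {c..d}" for y
      using r(1)[OF subsetD[OF sub that]] by simp
    ultimately have cont: "continuous_on {c..d} (\<lambda>y. e / (r y)\<^sup>2)"
      by (intro continuous_on_divide continuous_on_const continuous_on_power) auto
    have inj: "inj_on \<psi> {c..d}"
      using concave_branch_inj[OF \<psi>] sub by (auto intro: inj_on_subset)
    have der: "(\<psi> has_real_derivative e / (r y)\<^sup>2) (at y)" if "y \<in> {c..d}" for y
      using d\<psi> sub that by blast
    show "\<exists>q>0. \<forall>A\<in>sets borel. A \<subseteq> {c..d} \<longrightarrow>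
        \<psi> ` A \<in> lmeasurable \<and> q * measure lebesgue A \<le> measure lebesgue (\<psi> ` A) \<and>
        measure lebesgue (\<psi> ` A) \<le> 1 / \<kappa>^4 * q * measure lebesgue A"
    proof (intro exI[of _ q] conjI ballI impI)
      show "q > 0"
        using \<kappa> rc by (simp add: q_def)
    qed (use measure_image_bounds[OF der cont inj bounds] in blast)+
  qed
qed

text \<open>Common frame for the interval and for the circle cut open. No continuity of
  \<open>g\<close> is assumed, as reduction modulo 1 destroys it. \<open>branch\<close> concerns a
  single step and lands in \<open>D\<close> only; \<open>preimage_Y\<close> improves this to
  \<open>Y\<close>, so that branches can be composed. The clause \<open>n > 0\<close> in
  \<open>transit\<close> is what later shows that preimages of intervals are not null.\<close>

locale branched_map =
  fixes D Y :: "real set" and g :: "real \<Rightarrow> real"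
  assumes D: "D \<in> sets borel" "bounded D"
    and g_measurable: "g \<in> measurable (restrict_space lborel D) (restrict_space lborel D)"
    and Y: "open Y" "Y \<subseteq> D" "Y \<noteq> {}"
    and Y_full: "emeasure lborel (D - Y) = 0"
    and preimage_Y: "t \<in> D \<Longrightarrow> g t \<in> Y \<Longrightarrow> t \<in> Y"
    and preimage_Y_full: "emeasure lborel {t \<in> D. g t \<notin> Y} = 0"
    and branch: "open I \<Longrightarrow> connected I \<Longrightarrow> I \<subseteq> Y \<Longrightarrow> t \<in> D \<Longrightarrow> g t \<in> I \<Longrightarrow>
      \<exists>\<eta>. concave_branch \<eta> I \<and> \<eta> ` I \<subseteq> D \<and> \<eta> (g t) = t \<and> (\<forall>y\<in>I. g (\<eta> y) = y)"
    and transit: "open U \<Longrightarrow> U \<noteq> {} \<Longrightarrow> U \<subseteq> Y \<Longrightarrow> open V \<Longrightarrow> V \<noteq> {} \<Longrightarrow> V \<subseteq> Y \<Longrightarrow>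
      \<exists>n>0. \<exists>t\<in>U. (g ^^ n) t \<in> V"
begin

definition branch_of :: "nat \<Rightarrow> real set \<Rightarrow> (real \<Rightarrow> real) \<Rightarrow> bool" where
  "branch_of n I \<psi> \<longleftrightarrow> concave_branch \<psi> I \<and> \<psi> ` I \<subseteq> Y \<and> (\<forall>y\<in>I. (g ^^ n) (\<psi> y) = y)"

definition M :: "real measure" where "M = restrict_space lborel D"

lemma space_M [simp]: "space M = D"
  by (simp add: M_def space_restrict_space)

lemma sets_M: "A \<in> sets M \<longleftrightarrow> A \<in> sets borel \<and> A \<subseteq> D"
  using D by (auto simp: M_def sets_restrict_space_iff)

lemma emeasure_M: "A \<subseteq> D \<Longrightarrow> emeasure M A = emeasure lborel A"
  using D by (simp add: M_def emeasure_restrict_space)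

lemma measure_M: "A \<subseteq> D \<Longrightarrow> measure M A = measure lborel A"
  by (simp add: measure_def emeasure_M)

lemma finite_measure_M: "finite_measure M"
  using D emeasure_bounded_finite[of D] by (intro finite_measureI) (simp add: emeasure_M)

lemma g_M: "g \<in> measurable M M"
  using g_measurable by (simp add: M_def)

definition hits :: "nat \<Rightarrow> real set \<Rightarrow> real set" where
  "hits n A = {t \<in> D. (g ^^ n) t \<in> A}"

lemma hits_borel: "A \<in> sets borel \<Longrightarrow> hits n A \<in> sets borel"
proof -
  assume A: "A \<in> sets borel"
  have "A \<inter> D \<in> sets M"
    using A D by (simp add: sets_M)
  from measurable_sets[OF measurable_compose_n[OF g_M] this]
  have "(g ^^ n) -` (A \<inter> D) \<inter> D \<in> sets borel"
    by (simp add: sets_M)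
  moreover have "(g ^^ n) t \<in> D" if "t \<in> D" for t
    using measurable_space[OF measurable_compose_n[OF g_M], of t n] that by simp
  then have "(g ^^ n) -` (A \<inter> D) \<inter> D = hits n A"
    by (auto simp: hits_def)
  ultimately show ?thesis by simp
qed

lemma hits_D: "hits n A \<subseteq> D"
  by (auto simp: hits_def)

text \<open>Induction along the orbit from its end: a branch \<psi> of the last \<open>n\<close>
  steps has an open connected image in \<open>Y\<close> containing \<open>g t\<close>, and over this
  image the one-step hypothesis applies again. No shrinking of \<open>I\<close> occurs, which is
  what keeps the distortion uniform.\<close>

lemma iterated_branch:
  assumes I: "open I" "connected I" "I \<subseteq> Y" and t: "t \<in> D" "(g ^^ n) t \<in> I"
  shows "\<exists>\<psi>. branch_of n I \<psi> \<and> \<psi> ((g ^^ n) t) = t"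
  using t
proof (induction n arbitrary: t)
  case 0
  have "branch_of 0 I (\<lambda>y. y)"
    using I(3) by (simp add: branch_of_def concave_branch_id)
  then have "branch_of 0 I (\<lambda>y. y) \<and> (\<lambda>y. y) ((g ^^ 0) t) = t"
    by simp
  then show ?case
    by (rule exI[of "\<lambda>\<psi>. branch_of 0 I \<psi> \<and> \<psi> ((g ^^ 0) t) = t"])
next
  case (Suc n)
  have gt: "g t \<in> D"
    using measurable_space[OF g_M, of t] Suc.prems(1) by simp
  have "(g ^^ n) (g t) \<in> I"
    using Suc.prems(2) by (simp only: funpow_Suc_right o_apply)
  from Suc.IH[OF gt this] obtain \<psi> where \<psi>: "branch_of n I \<psi>" and \<psi>t: "\<psi> ((g ^^ n) (g t)) = g t"
    by blast
  have cb: "concave_branch \<psi> I"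
    using \<psi> by (simp add: branch_of_def)
  have "open (\<psi> ` I)" "connected (\<psi> ` I)" "\<psi> ` I \<subseteq> Y"
    using concave_branch_open_image[OF cb] connected_continuous_image[OF concave_branch_continuous[OF cb]] I \<psi>
    by (auto simp: branch_of_def)
  moreover have "g t \<in> \<psi> ` I"
    using imageI[OF \<open>(g ^^ n) (g t) \<in> I\<close>, of \<psi>] by (simp only: \<psi>t)
  ultimately have "\<exists>\<eta>. concave_branch \<eta> (\<psi> ` I) \<and> \<eta> ` \<psi> ` I \<subseteq> D \<and> \<eta> (g t) = t \<and> (\<forall>y\<in>\<psi> ` I. g (\<eta> y) = y)"
    by (intro branch Suc.prems(1))
  then obtain \<eta> where \<eta>: "concave_branch \<eta> (\<psi> ` I)" "\<eta> ` \<psi> ` I \<subseteq> D" "\<eta> (g t) = t"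
      "\<And>y. y \<in> \<psi> ` I \<Longrightarrow> g (\<eta> y) = y"
    by blast
  have Y': "\<eta> (\<psi> y) \<in> Y" if "y \<in> I" for y
    using that \<eta>(2,4) \<psi> by (intro preimage_Y[of "\<eta> (\<psi> y)"]) (auto simp: branch_of_def)
  show ?case
  proof (intro exI[of _ "\<lambda>y. \<eta> (\<psi> y)"] conjI)
    show "branch_of (Suc n) I (\<lambda>y. \<eta> (\<psi> y))"
      unfolding branch_of_def
    proof (intro conjI ballI)
      show "concave_branch (\<lambda>y. \<eta> (\<psi> y)) I"
        by (rule concave_branch_compose[OF cb \<eta>(1)])
      show "(\<lambda>y. \<eta> (\<psi> y)) ` I \<subseteq> Y"
        using Y' by blast
      fix y assume "y \<in> I"
      then have "g (\<eta> (\<psi> y)) = \<psi> y" "(g ^^ n) (\<psi> y) = y"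
        using \<eta>(4) \<psi> by (simp_all add: branch_of_def)
      then show "(g ^^ Suc n) (\<eta> (\<psi> y)) = y"
        by (simp only: funpow_Suc_right o_apply)
    qed
    show "\<eta> (\<psi> ((g ^^ Suc n) t)) = t"
      using \<psi>t \<eta>(3) by (simp only: funpow_Suc_right o_apply)
  qed
qed

text \<open>Applying \<open>g ^^ n\<close> shows that \<psi> can meet the image of \<phi> only where
  the two agree. The set of agreement is thus open, as a preimage of an open image, and closed in
  \<open>I\<close> by continuity; connectedness finishes the argument.\<close>

lemma branch_images_disjoint:
  assumes I: "open I" "connected I" and \<phi>: "branch_of n I \<phi>" and \<psi>: "branch_of n I \<psi>"
    and meet: "\<phi> ` I \<inter> \<psi> ` I \<noteq> {}"
  shows "\<phi> ` I = \<psi> ` I"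
proof -
  define E where "E = {y \<in> I. \<psi> y \<in> \<phi> ` I}"
  have E: "E = {y \<in> I. \<phi> y = \<psi> y}"
  proof (intro equalityI subsetI)
    fix y assume "y \<in> E"
    then obtain z where z: "y \<in> I" "z \<in> I" "\<psi> y = \<phi> z"
      by (auto simp: E_def)
    moreover have "(g ^^ n) (\<psi> y) = y" "(g ^^ n) (\<phi> z) = z"
      using \<phi> \<psi> z by (auto simp: branch_of_def)
    ultimately show "y \<in> {y \<in> I. \<phi> y = \<psi> y}"
      by simp
  next
    fix y assume "y \<in> {y \<in> I. \<phi> y = \<psi> y}"
    then show "y \<in> E"
      unfolding E_def by (metis (mono_tags, lifting) imageI mem_Collect_eq)
  qed
  have cont: "continuous_on I \<phi>" "continuous_on I \<psi>"
    using \<phi> \<psi> by (auto simp: branch_of_def intro: concave_branch_continuous)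
  have "open (\<phi> ` I)"
    using \<phi> I by (auto simp: branch_of_def intro: concave_branch_open_image)
  then have "open (I \<inter> \<psi> -` (\<phi> ` I))"
    using cont(2) I(1) by (simp add: continuous_on_open_vimage Int_commute)
  moreover have "I \<inter> \<psi> -` (\<phi> ` I) = E"
    by (auto simp: E_def)
  ultimately have "open E"
    by simp
  have "open (I \<inter> (\<lambda>y. \<phi> y - \<psi> y) -` (- {0}))"
    using continuous_on_open_vimage[OF I(1), of "\<lambda>y. \<phi> y - \<psi> y"] continuous_on_diff[OF cont]
    by (simp add: Int_commute open_Compl)
  moreover have "I \<inter> (\<lambda>y. \<phi> y - \<psi> y) -` (- {0}) = I - E"
    by (auto simp: E)
  ultimately have "open (I - E)"
    by simp
  obtain a b where "a \<in> I" "b \<in> I" "\<phi> a = \<psi> b"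
    using meet by blast
  then have "b \<in> E"
    unfolding E_def by (metis (mono_tags, lifting) imageI mem_Collect_eq)
  then have "E \<noteq> {}"
    by blast
  have "E \<inter> I = {} \<or> (I - E) \<inter> I = {}"
    by (rule connectedD[OF I(2) \<open>open E\<close> \<open>open (I - E)\<close>]) auto
  with \<open>E \<noteq> {}\<close> have "I \<subseteq> E"
    by (auto simp: E_def)
  then show ?thesis
    by (force simp: E)
qed

text \<open>\<open>hits n A\<close> is the disjoint union of the images of \<open>A\<close> under
  the branches of order \<open>n\<close>. Every branch has its own scale but all share
  \<open>C\<close>, so the bounds add up, with the sum of the scales as common factor.\<close>

lemma hits_distortion:
  assumes ord: "\<alpha> < c" "c < d" "d < \<beta>" and sub: "{\<alpha><..<\<beta>} \<subseteq> Y"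
  obtains C where "C > 0" "\<And>n. \<exists>q\<ge>0. \<forall>A\<in>sets borel. A \<subseteq> {c..d} \<longrightarrow>
      q * measure lborel A \<le> measure lborel (hits n A) \<and> measure lborel (hits n A) \<le> C * q * measure lborel A"
proof -
  let ?I = "{\<alpha><..<\<beta>}"
  obtain C where C: "C > 0" and dist: "\<And>\<psi>. concave_branch \<psi> ?I \<Longrightarrow> \<exists>q>0. \<forall>A\<in>sets borel. A \<subseteq> {c..d} \<longrightarrow>
        \<psi> ` A \<in> lmeasurable \<and> q * measure lebesgue A \<le> measure lebesgue (\<psi> ` A) \<and>
        measure lebesgue (\<psi> ` A) \<le> C * q * measure lebesgue A"
    using concave_branch_distortion[OF ord] by metis
  have I: "open ?I" "connected ?I"
    by auto
  have "\<exists>q\<ge>0. \<forall>A\<in>sets borel. A \<subseteq> {c..d} \<longrightarrow>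
      q * measure lborel A \<le> measure lborel (hits n A) \<and> measure lborel (hits n A) \<le> C * q * measure lborel A" for n
  proof -
    define \<K> where "\<K> = {\<psi> ` ?I | \<psi>. branch_of n ?I \<psi>}"
    have \<K>_open: "open K" if "K \<in> \<K>" for K
      using that I concave_branch_open_image by (auto simp: \<K>_def branch_of_def)
    have \<K>_disj: "pairwise disjnt \<K>"
      unfolding pairwise_def disjnt_def
    proof (intro ballI impI)
      fix K L assume "K \<in> \<K>" "L \<in> \<K>" "K \<noteq> L"
      then show "K \<inter> L = {}"
        using branch_images_disjoint[OF I] unfolding \<K>_def by blast
    qed
    have \<K>_count: "countable \<K>"
      using countable_disjoint_open_subsets \<K>_open \<K>_disj by blast
    have "\<exists>q>0. \<forall>A\<in>sets borel. A \<subseteq> {c..d} \<longrightarrow>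
        q * emeasure lborel A \<le> emeasure lborel (hits n A \<inter> K) \<and>
        emeasure lborel (hits n A \<inter> K) \<le> C * q * emeasure lborel A" if K_in: "K \<in> \<K>" for K
    proof -
      obtain \<psi> where K: "K = \<psi> ` ?I" and \<psi>: "branch_of n ?I \<psi>"
        using K_in unfolding \<K>_def by blast
      then obtain q where q: "q > 0" and qA: "\<And>A. A \<in> sets borel \<Longrightarrow> A \<subseteq> {c..d} \<Longrightarrow> \<psi> ` A \<in> lmeasurable \<and>
          q * measure lebesgue A \<le> measure lebesgue (\<psi> ` A) \<and>
          measure lebesgue (\<psi> ` A) \<le> C * q * measure lebesgue A"
        using dist by (metis branch_of_def)
      have "q * emeasure lborel A \<le> emeasure lborel (hits n A \<inter> K) \<and>
        emeasure lborel (hits n A \<inter> K) \<le> C * q * emeasure lborel A"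
        if A: "A \<in> sets borel" "A \<subseteq> {c..d}" for A
      proof -
        have AI: "A \<subseteq> ?I"
          using A ord by auto
        have im: "hits n A \<inter> K = \<psi> ` A"
          using \<psi> AI Y(2) by (fastforce simp: hits_def K branch_of_def)
        have borel: "hits n A \<inter> K \<in> sets borel"
          using hits_borel[OF A(1)] \<K>_open[OF K_in] by auto
        have A_fin: "emeasure lborel A = ennreal (measure lborel A)"
          using emeasure_bounded_finite[OF bounded_subset[OF bounded_closed_interval A(2)]]
          by (intro emeasure_eq_ennreal_measure) auto
        have e\<psi>: "emeasure lborel (hits n A \<inter> K) = ennreal (measure lebesgue (\<psi> ` A))"
        proof -
          have "emeasure lborel (hits n A \<inter> K) = emeasure lebesgue (\<psi> ` A)"
            using borel by (simp add: im)
          also have "\<dots> = ennreal (measure lebesgue (\<psi> ` A))"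
            using qA[OF A] by (intro emeasure_eq_measure2) auto
          finally show ?thesis .
        qed
        have "measure lebesgue A = measure lborel A"
          using A by simp
        then show ?thesis
          using qA[OF A] q C unfolding e\<psi> A_fin
          by (auto simp: ennreal_mult'[symmetric] intro!: ennreal_leI)
      qed
      with q show ?thesis by blast
    qed
    then obtain Q where Q: "\<And>K. K \<in> \<K> \<Longrightarrow> 0 < Q K" and QA: "\<And>K A. K \<in> \<K> \<Longrightarrow> A \<in> sets borel \<Longrightarrow> A \<subseteq> {c..d} \<Longrightarrow>
        ennreal (Q K) * emeasure lborel A \<le> emeasure lborel (hits n A \<inter> K) \<and>
        emeasure lborel (hits n A \<inter> K) \<le> ennreal (C * Q K) * emeasure lborel A"
      by metis
    \<comment> \<open>The sum is formed in \<open>ennreal\<close> because its finiteness is not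
      known in advance. It follows by testing with \<open>A = {c..d}\<close>, whose preimage lies in
      the bounded set \<open>D\<close>.\<close>
    define S where "S = (\<integral>\<^sup>+K. ennreal (Q K) \<partial>count_space \<K>)"
    have SA: "S * emeasure lborel A \<le> emeasure lborel (hits n A) \<and>
        emeasure lborel (hits n A) \<le> ennreal C * S * emeasure lborel A"
      if A: "A \<in> sets borel" "A \<subseteq> {c..d}" for A
    proof -
      have un: "hits n A = (\<Union>K\<in>\<K>. hits n A \<inter> K)"
      proof (intro equalityI subsetI)
        fix t assume t: "t \<in> hits n A"
        then have "t \<in> D" "(g ^^ n) t \<in> ?I"
          using A ord by (auto simp: hits_def)
        from iterated_branch[OF I sub this] obtain \<psi> where "branch_of n ?I \<psi>" "\<psi> ((g ^^ n) t) = t"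
          by blast
        then have "t \<in> \<psi> ` ?I" "\<psi> ` ?I \<in> \<K>"
          using \<open>(g ^^ n) t \<in> ?I\<close> by (auto simp: \<K>_def image_iff) (metis greaterThanLessThan_iff)
        with t show "t \<in> (\<Union>K\<in>\<K>. hits n A \<inter> K)"
          by blast
      qed auto
      have "emeasure lborel (hits n A) = (\<integral>\<^sup>+K. emeasure lborel (hits n A \<inter> K) \<partial>count_space \<K>)"
      proof (subst un, rule emeasure_UN_countable)
        show "hits n A \<inter> K \<in> sets lborel" if "K \<in> \<K>" for K
          using hits_borel[OF A(1)] \<K>_open[OF that] by auto
        show "disjoint_family_on (\<lambda>K. hits n A \<inter> K) \<K>"
          using \<K>_disj by (fastforce simp: disjoint_family_on_def pairwise_def disjnt_def)
      qed fact
      moreover have "S * emeasure lborel A \<le> (\<integral>\<^sup>+K. emeasure lborel (hits n A \<inter> K) \<partial>count_space \<K>)"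
        unfolding S_def by (subst nn_integral_multc[symmetric]) (use QA[OF _ A] in \<open>auto intro!: nn_integral_mono\<close>)
      moreover have "(\<integral>\<^sup>+K. emeasure lborel (hits n A \<inter> K) \<partial>count_space \<K>)
          \<le> (\<integral>\<^sup>+K. ennreal C * ennreal (Q K) * emeasure lborel A \<partial>count_space \<K>)"
        using QA[OF _ A] C Q by (intro nn_integral_mono) (simp flip: ennreal_mult')
      moreover have "\<dots> = ennreal C * S * emeasure lborel A"
        by (simp add: S_def nn_integral_multc nn_integral_cmult)
      ultimately show ?thesis
        by simp
    qed
    have hits_fin: "emeasure lborel (hits n A) < \<infinity>" for A
      using D(2) hits_D by (meson bounded_subset emeasure_bounded_finite)
    have "S * ennreal (d - c) < \<infinity>"
      using SA[of "{c..d}"] hits_fin[of "{c..d}"] ord by (auto intro: le_less_trans)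
    then have "S < top"
      using ord by (auto simp: ennreal_mult_less_top)
    then obtain s where s: "s \<ge> 0" "S = ennreal s"
      by (cases S) auto
    show ?thesis
    proof (intro exI[of _ s] conjI ballI impI)
      fix A :: "real set" assume A: "A \<in> sets borel" "A \<subseteq> {c..d}"
      have A_fin: "emeasure lborel A = ennreal (measure lborel A)"
        using emeasure_bounded_finite[OF bounded_subset[OF bounded_closed_interval A(2)]]
        by (intro emeasure_eq_ennreal_measure) auto
      have h: "emeasure lborel (hits n A) = ennreal (measure lborel (hits n A))"
        using hits_fin[of A] by (intro emeasure_eq_ennreal_measure) auto
      show "s * measure lborel A \<le> measure lborel (hits n A)"
           "measure lborel (hits n A) \<le> C * s * measure lborel A"
        using SA[OF A] s C unfolding s(2) A_fin h by (auto simp flip: ennreal_mult')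
    qed fact
  qed
  with C that show thesis by blast
qed

text \<open>The margin between \<open>{c..d}\<close> and \<open>{\<alpha><..<\<beta>}\<close> is the
  room that Koebe distortion needs. Rational end points make the family countable.\<close>

definition \<J> :: "real set set" where
  "\<J> = {{c..d} | \<alpha> c d \<beta>. \<alpha> \<in> \<rat> \<and> c \<in> \<rat> \<and> d \<in> \<rat> \<and> \<beta> \<in> \<rat> \<and> \<alpha> < c \<and> c < d \<and> d < \<beta> \<and> {\<alpha><..<\<beta>} \<subseteq> Y}"

lemma \<J>_cases:
  assumes "J \<in> \<J>"
  obtains \<alpha> c d \<beta> where "J = {c..d}" "\<alpha> < c" "c < d" "d < \<beta>" "{\<alpha><..<\<beta>} \<subseteq> Y"
  using assms unfolding \<J>_def by blast

lemma \<J>_subset: "J \<in> \<J> \<Longrightarrow> J \<subseteq> Y"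
  by (erule \<J>_cases) (auto simp: subset_iff)

lemma \<J>_countable: "countable \<J>"
proof -
  have "\<J> \<subseteq> (\<lambda>(c, d). {c..d}) ` (\<rat> \<times> \<rat>)"
    by (force simp: \<J>_def)
  then show ?thesis
    by (rule countable_subset) (intro countable_image countable_SIGMA countable_rat)
qed

lemma \<J>_cover: "y \<in> Y \<Longrightarrow> \<exists>J\<in>\<J>. y \<in> J"
proof -
  assume "y \<in> Y"
  then obtain e where e: "e > 0" "ball y e \<subseteq> Y"
    using Y(1) openE by blast
  obtain \<alpha> where \<alpha>: "\<alpha> \<in> \<rat>" "y - e < \<alpha>" "\<alpha> < y"
    using Rats_dense_in_real[of "y - e" y] e by auto
  obtain c where c: "c \<in> \<rat>" "\<alpha> < c" "c < y"
    using Rats_dense_in_real[of \<alpha> y] \<alpha> by auto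
  obtain \<beta> where \<beta>: "\<beta> \<in> \<rat>" "y < \<beta>" "\<beta> < y + e"
    using Rats_dense_in_real[of y "y + e"] e by auto
  obtain d where d: "d \<in> \<rat>" "y < d" "d < \<beta>"
    using Rats_dense_in_real[of y \<beta>] \<beta> by auto
  have "{\<alpha><..<\<beta>} \<subseteq> Y"
    using \<alpha> \<beta> e(2) by (auto simp: ball_def dist_real_def subset_iff abs_if)
  then have "{c..d} \<in> \<J>"
    unfolding \<J>_def using \<alpha> \<beta> c d by force
  then show ?thesis
    using c d by (intro bexI[of _ "{c..d}"]) auto
qed

lemma \<J>_measure_pos: "J \<in> \<J> \<Longrightarrow> 0 < measure lborel J"
  by (erule \<J>_cases) simp

lemma open_positive:
  assumes "open U" "U \<noteq> {}" "U \<subseteq> A" "A \<subseteq> D" "A \<in> sets borel"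
  shows "0 < measure lborel A"
proof -
  have fin: "emeasure lborel A < \<infinity>"
    using assms(4) D(2) by (meson bounded_subset emeasure_bounded_finite)
  have "emeasure lborel A \<noteq> 0"
  proof
    assume "emeasure lborel A = 0"
    then have "A \<in> null_sets lebesgue"
      using assms(5) by (auto simp: null_sets_def)
    then have "negligible U"
      using assms(3) negligible_iff_null_sets negligible_subset by blast
    with assms(1,2) show False
      using open_not_negligible by blast
  qed
  with fin show ?thesis
    by (simp add: measure_def enn2real_positive_iff zero_less_iff_neq_zero)
qed

text \<open>\<open>transit\<close> provides a single point; the inverse branch through that point
  spreads it to an open set, which has positive measure.\<close>

lemma hits_positive:
  assumes U: "open U" "U \<noteq> {}" "U \<subseteq> Y" and J: "J \<in> \<J>"
  shows "\<exists>n>0. 0 < measure lborel (U \<inter> hits n J)"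
proof -
  obtain \<alpha> c d \<beta> where J: "J = {c..d}" "\<alpha> < c" "c < d" "d < \<beta>" "{\<alpha><..<\<beta>} \<subseteq> Y"
    using \<J>_cases[OF J] .
  have sub: "{c<..<d} \<subseteq> Y"
    using J by (auto simp: subset_iff)
  obtain n t where n: "n > 0" "t \<in> U" "(g ^^ n) t \<in> {c<..<d}"
    using transit[OF U _ _ sub] J by (metis greaterThanLessThan_empty_iff not_le open_greaterThanLessThan)
  have "t \<in> D"
    using n U Y by auto
  obtain \<psi> where \<psi>: "branch_of n {c<..<d} \<psi>" "\<psi> ((g ^^ n) t) = t"
    using iterated_branch[OF _ _ sub \<open>t \<in> D\<close> n(3)] by auto
  have "open (\<psi> ` {c<..<d} \<inter> U)"
    using \<psi>(1) U(1) by (intro open_Int concave_branch_open_image) (auto simp: branch_of_def)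
  moreover have "\<psi> ` {c<..<d} \<inter> U \<noteq> {}"
    using \<psi>(2) n by (auto simp: image_iff disjoint_iff intro!: bexI[of _ "(g ^^ n) t"])
  moreover have "\<psi> ` {c<..<d} \<inter> U \<subseteq> U \<inter> hits n J"
    using \<psi>(1) Y(2) by (fastforce simp: branch_of_def hits_def J)
  moreover have "U \<inter> hits n J \<in> sets borel"
    using U(1) hits_borel[of J n] by (auto simp: J)
  ultimately have "0 < measure lborel (U \<inter> hits n J)"
    by (intro open_positive) (auto simp: hits_def)
  with n show ?thesis by blast
qed

text \<open>Eliminates the unknown scale \<open>q\<close> of order \<open>n\<close> between the
  bounds for \<open>A\<close> and those for \<open>J\<close>.\<close>

lemma \<J>_distortion:
  assumes "J \<in> \<J>"
  shows "\<exists>C>0. \<forall>n. \<forall>A\<in>sets borel. A \<subseteq> J \<longrightarrow>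
    measure lborel (hits n A) * measure lborel J \<le> C * measure lborel A * measure lborel (hits n J) \<and>
    measure lborel A * measure lborel (hits n J) \<le> C * measure lborel (hits n A) * measure lborel J"
proof -
  obtain \<alpha> c d \<beta> where J: "J = {c..d}" "\<alpha> < c" "c < d" "d < \<beta>" "{\<alpha><..<\<beta>} \<subseteq> Y"
    using \<J>_cases[OF assms] .
  obtain C where C: "C > 0" "\<And>n. \<exists>q\<ge>0. \<forall>A\<in>sets borel. A \<subseteq> {c..d} \<longrightarrow>
      q * measure lborel A \<le> measure lborel (hits n A) \<and> measure lborel (hits n A) \<le> C * q * measure lborel A"
    using hits_distortion[OF J(2-5)] by metis
  show ?thesis
  proof (intro exI[of _ C] conjI allI ballI impI)
    fix n and A :: "real set" assume A: "A \<in> sets borel" "A \<subseteq> J"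
    obtain q where q: "q \<ge> 0" "\<And>A. A\<in>sets borel \<Longrightarrow> A \<subseteq> J \<Longrightarrow>
      q * measure lborel A \<le> measure lborel (hits n A) \<and> measure lborel (hits n A) \<le> C * q * measure lborel A"
      using C(2)[of n] J(1) by metis
    have JJ: "J \<in> sets borel"
      using J by simp
    note qA = q(2)[OF A] and qJ = q(2)[OF JJ order_refl]
    have "measure lborel (hits n A) * measure lborel J \<le> (C * q * measure lborel A) * measure lborel J"
      using qA by (intro mult_right_mono) auto
    also have "\<dots> = (C * measure lborel A) * (q * measure lborel J)"
      by simp
    also have "\<dots> \<le> (C * measure lborel A) * measure lborel (hits n J)"
      using qJ C(1) by (intro mult_left_mono) auto
    finally show "measure lborel (hits n A) * measure lborel J \<le> C * measure lborel A * measure lborel (hits n J)" .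
    have "measure lborel A * measure lborel (hits n J) \<le> measure lborel A * (C * q * measure lborel J)"
      using qJ by (intro mult_left_mono) auto
    also have "\<dots> = (q * measure lborel A) * (C * measure lborel J)"
      by simp
    also have "\<dots> \<le> measure lborel (hits n A) * (C * measure lborel J)"
      using qA C(1) by (intro mult_right_mono) auto
    finally show "measure lborel A * measure lborel (hits n J) \<le> C * measure lborel (hits n A) * measure lborel J"
      by (simp add: mult_ac)
  qed fact
qed

lemma null_sets_M: "A \<in> null_sets M \<longleftrightarrow> A \<in> sets borel \<and> A \<subseteq> D \<and> measure lborel A = 0"
proof -
  interpret finite_measure M
    by (rule finite_measure_M)
  show ?thesis
    unfolding null_sets_def by (auto simp: sets_M emeasure_eq_measure measure_M)
qed

lemma null_by_parts:
  assumes N: "A \<in> null_sets M" and B: "B \<in> sets borel" "B \<subseteq> D"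
    and sub: "B \<subseteq> A \<union> (\<Union>J\<in>\<J>. B' J)" and null: "\<And>J. J \<in> \<J> \<Longrightarrow> B' J \<in> null_sets M"
  shows "B \<in> null_sets M"
proof (rule null_sets_subset[OF _ _ sub])
  show "A \<union> (\<Union>J\<in>\<J>. B' J) \<in> null_sets M"
    using N null by (intro null_sets.Un null_sets_UN'[OF \<J>_countable])
  show "B \<in> sets M"
    using B by (simp add: sets_M)
qed

lemma bounded_distortion_map: "bounded_distortion_map M g \<J>"
proof -
  interpret finite_measure M
    by (rule finite_measure_M)
  have hits_Y_null: "{t \<in> D. g t \<notin> Y} \<in> null_sets M"
  proof -
    have "{t \<in> D. g t \<notin> Y} = hits 1 (- Y)"
      by (auto simp: hits_def)
    then have "{t \<in> D. g t \<notin> Y} \<in> sets borel"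
      using hits_borel[of "- Y" 1] Y(1) by simp
    with preimage_Y_full show ?thesis
      by (auto simp: null_sets_M measure_def)
  qed
  have D_Y_null: "D - Y \<in> null_sets M"
    using Y_full D(1) Y(1) by (auto simp: null_sets_M measure_def)
  \<comment> \<open>Proved ahead of the rest because \<open>pre_null\<close> is used for
    \<open>null_reflect\<close> below. Inside the pieces it is the upper distortion bound for
    \<open>n = 1\<close>; points mapped outside \<open>Y\<close> are null by assumption.\<close>
  interpret nonsingular_map M g
  proof
    show "g \<in> measurable M M"
      by (rule g_M)
    fix A assume A: "A \<in> null_sets M"
    show "g -` A \<inter> space M \<in> null_sets M"
    proof (rule null_by_parts[OF hits_Y_null, where B' = "\<lambda>J. hits 1 (A \<inter> J)"])
      show "g -` A \<inter> space M \<in> sets borel" "g -` A \<inter> space M \<subseteq> D"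
        using measurable_sets[OF g_M, of A] A by (auto simp: sets_M)
      show "g -` A \<inter> space M \<subseteq> {t \<in> D. g t \<notin> Y} \<union> (\<Union>J\<in>\<J>. hits 1 (A \<inter> J))"
        using \<J>_cover by (fastforce simp: hits_def)
      fix J assume J: "J \<in> \<J>"
      have JJ: "J \<in> sets borel"
        using \<J>_cases[OF J] by (metis atLeastAtMost_borel)
      have "A \<inter> J \<in> null_sets M"
        using A JJ by (intro null_sets_subset[OF A]) (auto simp: sets_M null_sets_M)
      then have AJ: "A \<inter> J \<in> sets borel" "measure lborel (A \<inter> J) = 0"
        by (auto simp: null_sets_M)
      then have "measure lborel (hits 1 (A \<inter> J)) * measure lborel J \<le> 0"
        using \<J>_distortion[OF J] by (metis Int_lower2 mult_zero_left mult_zero_right)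
      then have "measure lborel (hits 1 (A \<inter> J)) = 0"
        using \<J>_measure_pos[OF J] by (simp add: mult_le_0_iff measure_le_0_iff)
      then show "hits 1 (A \<inter> J) \<in> null_sets M"
        using hits_borel[OF AJ(1)] hits_D by (simp add: null_sets_M)
    qed
  qed
  have pre: "pre n A = hits n A" for n A
    by (auto simp: pre_def hits_def)
  have \<J>_D: "J \<subseteq> D" if "J \<in> \<J>" for J
    using \<J>_subset[OF that] Y(2) by blast
  have \<J>_borel: "J \<in> sets borel" if "J \<in> \<J>" for J
    using \<J>_cases[OF that] by (metis atLeastAtMost_borel)
  show ?thesis
  proof
    show "countable \<J>"
      by (rule \<J>_countable)
    show "\<J> \<noteq> {}"
      using Y(3) \<J>_cover by blast
    show "J \<in> sets M" if "J \<in> \<J>" for J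
      using that \<J>_D \<J>_borel by (simp add: sets_M)
    show "0 < measure M J" if "J \<in> \<J>" for J
      using that \<J>_D \<J>_measure_pos by (simp add: measure_M)
    show "AE x in M. x \<in> \<Union>\<J>"
      using AE_not_in[OF D_Y_null] AE_space by eventually_elim (use \<J>_cover in auto)
    show "\<exists>C>0. \<forall>n. \<forall>A\<in>sets M. A \<subseteq> J \<longrightarrow>
        measure M (pre n A) * measure M J \<le> C * measure M A * measure M (pre n J) \<and>
        measure M A * measure M (pre n J) \<le> C * measure M (pre n A) * measure M J" if J: "J \<in> \<J>" for J
    proof -
      obtain C where "C > 0" "\<And>n A. A \<in> sets borel \<Longrightarrow> A \<subseteq> J \<Longrightarrow>
          measure lborel (hits n A) * measure lborel J \<le> C * measure lborel A * measure lborel (hits n J) \<and>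
          measure lborel A * measure lborel (hits n J) \<le> C * measure lborel (hits n A) * measure lborel J"
        using \<J>_distortion[OF J] by metis
      then show ?thesis
        using \<J>_D[OF J] by (intro exI[of _ C]) (auto simp: pre measure_M hits_D sets_M)
    qed
    show "\<exists>n. 0 < measure M (J \<inter> pre n J')" if J: "J \<in> \<J>" and J': "J' \<in> \<J>" for J J'
    proof -
      have U: "open (interior J)" "interior J \<noteq> {}" "interior J \<subseteq> Y"
        using \<J>_cases[OF J] \<J>_subset[OF J] interior_subset[of J]
        by (auto simp: interior_atLeastAtMost_real) (metis greaterThanLessThan_empty_iff interior_atLeastAtMost_real not_le)
      obtain n where "0 < measure lborel (interior J \<inter> hits n J')"
        using hits_positive[OF U J'] by blast
      also have "measure lborel (interior J \<inter> hits n J') = measure M (interior J \<inter> hits n J')"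
        by (rule measure_M[symmetric]) (use hits_D in auto)
      also have "\<dots> \<le> measure M (J \<inter> hits n J')"
        using hits_borel[OF \<J>_borel[OF J']] \<J>_borel[OF J] interior_subset[of J] \<J>_D[OF J]
        by (intro finite_measure_mono) (auto simp: sets_M)
      finally show ?thesis
        by (auto simp: pre)
    qed
    fix A assume A: "A \<in> sets M" and preA: "pre 1 A \<in> null_sets M"
    show "A \<in> null_sets M"
    proof (rule null_by_parts[OF D_Y_null, where B' = "\<lambda>J. A \<inter> J"])
      show "A \<in> sets borel" "A \<subseteq> D"
        using A by (auto simp: sets_M)
      then show "A \<subseteq> (D - Y) \<union> (\<Union>J\<in>\<J>. A \<inter> J)"
        using \<J>_cover by blast
      fix J assume J: "J \<in> \<J>"
      \<comment> \<open>To divide by the measure of \<open>hits 1 J\<close> it must be positive. If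
        it vanished, all \<open>hits n J\<close> with \<open>n > 0\<close> would be null, contrary
        to transitivity.\<close>
      obtain n where n: "n > 0" "0 < measure lborel (Y \<inter> hits n J)"
        using hits_positive[OF Y(1,3) order_refl J] by blast
      have pos: "0 < measure lborel (hits 1 J)"
      proof (rule ccontr)
        assume "\<not> ?thesis"
        then have "hits 1 J \<in> null_sets M"
          using hits_borel[OF \<J>_borel[OF J]] hits_D
          by (simp add: null_sets_M measure_le_0_iff not_less)
        from pre_null[OF this, of "n - 1"] have "hits n J \<in> null_sets M"
          using n(1) by (simp add: pre_pre flip: pre)
        then have "Y \<inter> hits n J \<in> null_sets M"
          using Y by (intro null_set_Int1) (auto simp: sets_M)
        with n(2) show False
          by (simp add: null_sets_M)
      qed
      have AJ: "A \<inter> J \<in> sets borel"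
        using A \<J>_borel[OF J] by (auto simp: sets_M)
      have "hits 1 (A \<inter> J) \<in> null_sets M"
      proof (rule null_sets_subset[OF preA])
        show "hits 1 (A \<inter> J) \<in> sets M"
          by (simp only: sets_M hits_borel[OF AJ] hits_D)
      qed (auto simp: pre hits_def)
      then have "measure lborel (hits 1 (A \<inter> J)) = 0"
        by (simp add: null_sets_M)
      then have "measure lborel (A \<inter> J) * measure lborel (hits 1 J) \<le> 0"
        using \<J>_distortion[OF J] AJ by (metis Int_lower2 mult_zero_left mult_zero_right)
      then have "measure lborel (A \<inter> J) = 0"
        using pos by (simp add: mult_le_0_iff measure_le_0_iff)
      then show "A \<inter> J \<in> null_sets M"
        using AJ A by (auto simp: null_sets_M sets_M)
    qed
  qed
qed

theorem acim: "has_sigma_finite_acim (restrict_space lborel D) g"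
  using bounded_distortion_map.acim[OF bounded_distortion_map] by (simp add: M_def)

end

section \<open>Inverse branches and negative Schwarzian derivative\<close>

lemma open_connected_bounded_real:
  fixes I :: "real set"
  assumes I: "open I" "connected I" "bounded I" "I \<noteq> {}"
  obtains \<alpha> \<beta> where "I = {\<alpha><..<\<beta>}"
proof -
  have bdd: "bdd_below I" "bdd_above I"
    using bounded_imp_bdd_below[OF I(3)] bounded_imp_bdd_above[OF I(3)] by auto
  have "I = {Inf I<..<Sup I}"
  proof (intro equalityI subsetI)
    fix x assume "x \<in> I"
    then obtain e where e: "e > 0" "ball x e \<subseteq> I"
      using I(1) openE by blast
    then have "x - e / 2 \<in> I" "x + e / 2 \<in> I"
      by (auto simp: ball_def dist_real_def subset_iff)
    then have "Inf I \<le> x - e / 2" "x + e / 2 \<le> Sup I"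
      using bdd by (auto intro: cInf_lower cSup_upper)
    with e show "x \<in> {Inf I<..<Sup I}"
      by auto
  next
    fix x assume x: "x \<in> {Inf I<..<Sup I}"
    obtain u v where "u \<in> I" "u < x" "v \<in> I" "x < v"
      using x cInf_less_iff[OF I(4) bdd(1), of x] less_cSup_iff[OF I(4) bdd(2), of x] by auto
    then show "x \<in> I"
      using connectedD_interval[OF I(2), of u v x] by auto
  qed
  then show thesis
    by (rule that)
qed

text \<open>\<open>F\<close> need not be injective on \<open>E\<close>, nor its derivative bounded
  away from 0. \<open>E\<close> is cut into countably many pieces on which \<open>F\<close> is
  injective with Lipschitz inverse, and Lipschitz maps preserve null sets.\<close>

lemma negligible_preimage:
  fixes F :: "real \<Rightarrow> real" and E N :: "real set"
  assumes der: "\<And>t. t \<in> E \<Longrightarrow> \<exists>D. D \<noteq> 0 \<and> (F has_real_derivative D) (at t)"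
    and N: "negligible N" and sub: "F ` E \<subseteq> N"
  shows "negligible E"
proof -
  \<comment> \<open>\<open>k\<close> fixes a scale \<open>1 / Suc k\<close> below which
    \<open>F\<close> contracts distances at most by the factor \<open>Suc k\<close>;
    \<open>j\<close> restricts to an interval of that length, so that any two points of a piece can
    be compared.\<close>
  define P where "P k j = {t \<in> E. t * real (Suc k) \<in> {real_of_int j..real_of_int j + 1} \<and>
      (\<forall>s. \<bar>s - t\<bar> * real (Suc k) \<le> 1 \<longrightarrow> \<bar>s - t\<bar> \<le> real (Suc k) * \<bar>F s - F t\<bar>)}" for k :: nat and j :: int
  have neg: "negligible (P k j)" for k j
  proof -
    have lip: "\<bar>s - t\<bar> \<le> Suc k * \<bar>F s - F t\<bar>" if "s \<in> P k j" "t \<in> P k j" for s t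
    proof -
      have "\<bar>s * real (Suc k) - t * real (Suc k)\<bar> \<le> 1"
        using that by (auto simp: P_def)
      then have "\<bar>s - t\<bar> * real (Suc k) \<le> 1"
        by (simp only: left_diff_distrib[symmetric] abs_mult abs_of_nat)
      with that(2) show ?thesis
        unfolding P_def by blast
    qed
    have inj: "inj_on F (P k j)"
    proof (rule inj_onI)
      fix s t assume "s \<in> P k j" "t \<in> P k j" "F s = F t"
      with lip[of s t] show "s = t" by simp
    qed
    let ?G = "inv_into (P k j) F"
    have "negligible (?G ` F ` P k j)"
    proof (rule negligible_locally_Lipschitz_image)
      show "negligible (F ` P k j)"
        using sub by (intro negligible_subset[OF N]) (auto simp: P_def)
      fix x assume x: "x \<in> F ` P k j"
      show "\<exists>T B. open T \<and> x \<in> T \<and> (\<forall>y\<in>F ` P k j \<inter> T. norm (?G y - ?G x) \<le> B * norm (y - x))"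
      proof (intro exI[of _ UNIV] exI[of _ "real (Suc k)"] conjI ballI)
        fix y assume "y \<in> F ` P k j \<inter> UNIV"
        with x obtain s t where "s \<in> P k j" "t \<in> P k j" "y = F s" "x = F t"
          by blast
        then show "norm (?G y - ?G x) \<le> real (Suc k) * norm (y - x)"
          using lip[of s t] by (simp add: inv_into_f_f[OF inj])
      qed auto
    qed simp
    also have "?G ` F ` P k j = P k j"
      using inj by (auto simp: image_iff inv_into_f_f)
    finally show ?thesis .
  qed
  have cover: "E \<subseteq> (\<Union>k. \<Union>j. P k j)"
  proof
    fix t assume t: "t \<in> E"
    obtain D where D: "D \<noteq> 0" "(F has_real_derivative D) (at t)"
      using der[OF t] by blast
    have "((\<lambda>s. \<bar>(F s - F t) / (s - t)\<bar>) \<longlongrightarrow> \<bar>D\<bar>) (at t)"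
      using D(2) by (intro tendsto_intros) (simp add: has_field_derivative_iff)
    then have "\<forall>\<^sub>F s in at t. \<bar>D\<bar> / 2 < \<bar>(F s - F t) / (s - t)\<bar>"
      using D(1) by (intro order_tendstoD(1)) auto
    then obtain d where d: "d > 0" "\<And>s. s \<noteq> t \<Longrightarrow> \<bar>s - t\<bar> < d \<Longrightarrow> \<bar>D\<bar> / 2 < \<bar>(F s - F t) / (s - t)\<bar>"
      by (auto simp: eventually_at dist_real_def)
    \<comment> \<open>The first bound brings the scale below \<open>d\<close>, the second brings
      \<open>1 / Suc k\<close> below \<open>\<bar>D\<bar> / 2\<close>.\<close>
    obtain k :: nat where k: "k > max (1 / d) (2 / \<bar>D\<bar>)"
      using reals_Archimedean2 by blast
    have "\<bar>s - t\<bar> \<le> Suc k * \<bar>F s - F t\<bar>" if s: "\<bar>s - t\<bar> * real (Suc k) \<le> 1" for s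
    proof (cases "s = t")
      case False
      have "1 < d * Suc k"
        using k d(1) by (simp add: field_simps)
      then have "\<bar>s - t\<bar> * Suc k < d * Suc k"
        using s by linarith
      then have "\<bar>s - t\<bar> < d"
        by simp
      from d(2)[OF False this] have "\<bar>D\<bar> / 2 * \<bar>s - t\<bar> < \<bar>F s - F t\<bar>"
        using False by (simp add: field_simps)
      moreover have "1 \<le> Suc k * (\<bar>D\<bar> / 2)"
      proof -
        have "2 < \<bar>D\<bar> * k"
          using k D(1) by (simp add: field_simps)
        then have "2 \<le> \<bar>D\<bar> * k + \<bar>D\<bar>"
          using abs_ge_zero[of D] by linarith
        then show ?thesis
          by (simp add: field_simps)
      qed
      ultimately have "1 * \<bar>s - t\<bar> \<le> Suc k * (\<bar>D\<bar> / 2) * \<bar>s - t\<bar>"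
          and le: "Suc k * (\<bar>D\<bar> / 2 * \<bar>s - t\<bar>) \<le> Suc k * \<bar>F s - F t\<bar>"
        by (intro mult_right_mono mult_left_mono; simp)+
      then have "\<bar>s - t\<bar> \<le> Suc k * (\<bar>D\<bar> / 2 * \<bar>s - t\<bar>)"
        by (simp only: mult.assoc mult_1_left)
      then show ?thesis
        using le by (rule order_trans)
    qed auto
    then have "t \<in> P k \<lfloor>t * Suc k\<rfloor>"
      using t by (auto simp: P_def)
    then show "t \<in> (\<Union>k. \<Union>j. P k j)"
      by blast
  qed
  have "negligible (\<Union>k. \<Union>j. P k j)"
    by (intro negligible_countable_Union) (auto intro!: negligible_countable_Union neg)
  with cover show ?thesis
    by (rule negligible_subset[rotated])
qed

text \<open>
  If \<open>\<eta>\<close> inverts \<open>F\<close>, then \<open>r = \<bar>\<eta>'\<bar> powr (- 1/2)\<close> satisfies \<open>r'' = (SF \<circ> \<eta>) / (2 * r\<^sup>3)\<close>, so negative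
  Schwarzian derivative makes \<open>r\<close> concave.
\<close>

lemma inverse_concave_branch:
  fixes F F1 F2 F3 \<eta> :: "real \<Rightarrow> real"
  assumes K: "open K" "connected K" and I: "open I"
    and d1: "\<And>t. t \<in> K \<Longrightarrow> (F has_real_derivative F1 t) (at t)"
    and d2: "\<And>t. t \<in> K \<Longrightarrow> (F1 has_real_derivative F2 t) (at t)"
    and d3: "\<And>t. t \<in> K \<Longrightarrow> (F2 has_real_derivative F3 t) (at t)"
    and nz: "\<And>t. t \<in> K \<Longrightarrow> F1 t \<noteq> 0"
    and neg: "\<And>t. t \<in> K \<Longrightarrow> F3 t / F1 t - 3 / 2 * (F2 t / F1 t)\<^sup>2 < 0"
    and \<eta>K: "\<And>y. y \<in> I \<Longrightarrow> \<eta> y \<in> K" and F\<eta>: "\<And>y. y \<in> I \<Longrightarrow> F (\<eta> y) = y"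
    and \<eta>F: "\<And>t. t \<in> K \<Longrightarrow> \<eta> (F t) = t"
  shows "concave_branch \<eta> I"
proof (cases "K = {}")
  case True
  then show ?thesis
    using \<eta>K by (auto simp: concave_branch_def)
next
  case False
  then obtain x where x: "x \<in> K" by blast
  have F1_cont: "continuous_on K F1"
    using d2 by (intro continuous_at_imp_continuous_on) (auto intro: DERIV_isCont)
  have conn: "connected (F1 ` K)"
    by (rule connected_continuous_image[OF F1_cont K(2)])
  have sign: "sgn (F1 t) = sgn (F1 x)" if t: "t \<in> K" for t
  proof (rule ccontr)
    assume "sgn (F1 t) \<noteq> sgn (F1 x)"
    then have "F1 t \<le> 0 \<and> 0 \<le> F1 x \<or> F1 x \<le> 0 \<and> 0 \<le> F1 t"
      by (auto simp: sgn_if split: if_splits)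
    then have "0 \<in> F1 ` K"
      using connectedD_interval[OF conn] t x by (meson imageI)
    with nz show False by force
  qed
  define e where "e = sgn (F1 x)"
  have e: "e \<in> {-1, 1}"
    using nz[OF x] by (auto simp: e_def sgn_if)
  have pos: "0 < e * F1 t" if "t \<in> K" for t
    using nz[OF that] unfolding e_def sign[OF that, symmetric] by (simp add: sgn_if)
  \<comment> \<open>The derivative of \<eta> is \<open>1 / F1 (\<eta> y)\<close>, so this is
    \<open>\<bar>\<eta>'\<bar> powr (- 1/2)\<close>; \<open>e\<close> is the constant sign of
    \<open>F1\<close> on the connected set \<open>K\<close>.\<close>
  define r where "r y = sqrt (e * F1 (\<eta> y))" for y
  define r' where "r' y = F2 (\<eta> y) / (2 * (r y)^3)" for y
  define r'' where "r'' y = (F3 (\<eta> y) / F1 (\<eta> y) - 3 / 2 * (F2 (\<eta> y) / F1 (\<eta> y))\<^sup>2) / (2 * (r y)^3)" for y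
  have "0 < r y \<and> r'' y \<le> 0 \<and> (\<eta> has_real_derivative e / (r y)\<^sup>2) (at y) \<and>
     (r has_real_derivative r' y) (at y) \<and> (r' has_real_derivative r'' y) (at y)" if y: "y \<in> I" for y
  proof (intro conjI)
    have yK: "\<eta> y \<in> K"
      by (rule \<eta>K[OF y])
    show r_pos: "0 < r y"
      using pos[OF yK] by (simp add: r_def)
    show "r'' y \<le> 0"
      unfolding r''_def using neg[OF yK] r_pos by (intro divide_nonpos_pos) auto
    have r2: "(r y)\<^sup>2 = e * F1 (\<eta> y)"
      using pos[OF yK] by (simp add: r_def)
    have ee: "e * e = 1"
      using e by auto
    have F1_eq: "F1 (\<eta> y) = e * (r y)\<^sup>2"
      using ee by (simp add: r2 mult.assoc[symmetric])
    obtain \<delta> where \<delta>: "\<delta> > 0" "cball (\<eta> y) \<delta> \<subseteq> K"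
      using K(1) yK open_contains_cball by blast
    have near: "z \<in> K" if "\<bar>z - \<eta> y\<bar> \<le> \<delta>" for z
      using \<delta>(2) that by (auto simp: cball_def dist_real_def abs_minus_commute subset_iff)
    have "isCont \<eta> (F (\<eta> y))"
      by (rule isCont_inverse_function[OF \<delta>(1) \<eta>F[OF near] DERIV_isCont[OF d1[OF near]]])
    then have cont: "isCont \<eta> y"
      by (simp add: F\<eta>[OF y])
    obtain \<epsilon> where \<epsilon>: "\<epsilon> > 0" "ball y \<epsilon> \<subseteq> I"
      using I y openE by blast
    have "(\<eta> has_real_derivative inverse (F1 (\<eta> y))) (at y)"
      by (rule DERIV_inverse_function[where a = "y - \<epsilon>" and b = "y + \<epsilon>", OF d1[OF yK] nz[OF yK] _ _ _ cont])
        (use \<epsilon> F\<eta> in \<open>auto simp: ball_def dist_real_def subset_iff abs_if\<close>)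
    moreover have "inverse (F1 (\<eta> y)) = e / (r y)\<^sup>2"
      using e by (auto simp: F1_eq divide_inverse)
    ultimately show d\<eta>: "(\<eta> has_real_derivative e / (r y)\<^sup>2) (at y)"
      by simp
    have "((\<lambda>y. e * F1 (\<eta> y)) has_real_derivative e * (F2 (\<eta> y) * (e / (r y)\<^sup>2))) (at y)"
      by (rule DERIV_cmult[OF DERIV_chain2[OF d2[OF yK] d\<eta>]])
    from DERIV_chain2[OF DERIV_real_sqrt[OF pos[OF yK]] this]
    have "(r has_real_derivative inverse (r y) / 2 * (e * (F2 (\<eta> y) * (e / (r y)\<^sup>2)))) (at y)"
      by (simp add: r_def[abs_def])
    moreover have "inverse (r y) / 2 * (e * (F2 (\<eta> y) * (e / (r y)\<^sup>2))) = (e * e) * (F2 (\<eta> y) / (2 * (r y)^3))"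
      using r_pos by (simp add: field_simps power2_eq_square power3_eq_cube)
    ultimately show dr: "(r has_real_derivative r' y) (at y)"
      using ee by (simp add: r'_def)
    have "((\<lambda>y. 2 * (r y)^3) has_real_derivative 2 * (3 * (r y)\<^sup>2 * r' y)) (at y)"
      using DERIV_cmult[OF DERIV_power[OF dr, of 3], of 2] by (simp add: mult_ac)
    from DERIV_divide[OF DERIV_chain2[OF d3[OF yK] d\<eta>] this]
    have "(r' has_real_derivative (F3 (\<eta> y) * (e / (r y)\<^sup>2) * (2 * (r y)^3) - F2 (\<eta> y) * (2 * (3 * (r y)\<^sup>2 * r' y)))
        / ((2 * (r y)^3) * (2 * (r y)^3))) (at y)"
      using r_pos by (simp add: r'_def[abs_def])
    moreover have "(F3 (\<eta> y) * (e / (r y)\<^sup>2) * (2 * (r y)^3) - F2 (\<eta> y) * (2 * (3 * (r y)\<^sup>2 * r' y)))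
        / ((2 * (r y)^3) * (2 * (r y)^3)) = r'' y"
    proof -
      have S1: "F3 (\<eta> y) / F1 (\<eta> y) = e * F3 (\<eta> y) / (r y)\<^sup>2"
        using e by (auto simp: F1_eq)
      have S2: "(F2 (\<eta> y) / F1 (\<eta> y))\<^sup>2 = (F2 (\<eta> y))\<^sup>2 / (r y)^4"
        using e by (auto simp: F1_eq power_divide)
      show ?thesis
        unfolding r''_def r'_def S1 S2 using r_pos
        by (simp add: field_simps power2_eq_square power3_eq_cube power4_eq_xxxx)
    qed
    ultimately show "(r' has_real_derivative r'' y) (at y)"
      by simp
  qed
  with e show ?thesis
    unfolding concave_branch_def by blast
qed

text \<open>The component \<open>{a<..<b}\<close> of the preimage of \<open>I\<close> around
  \<open>x\<close> is mapped onto all of \<open>I\<close>: \<open>F\<close> is monotone there, and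
  at \<open>a\<close> and \<open>b\<close> it takes boundary values of \<open>I\<close>. The
  hypothesis on \<open>F p\<close> and \<open>F q\<close> prevents the component from being cut off
  by the domain.\<close>

lemma exists_inverse_branch:
  fixes F F1 F2 F3 :: "real \<Rightarrow> real"
  assumes cont: "continuous_on {p..q} F" and I: "open I" "connected I" "bounded I"
    and x: "x \<in> {p<..<q}" "F x \<in> I" and ends: "F p \<notin> I" "F q \<notin> I"
    and d1: "\<And>t. t \<in> {p<..<q} \<Longrightarrow> (F has_real_derivative F1 t) (at t)"
    and d2: "\<And>t. t \<in> {p<..<q} \<Longrightarrow> (F1 has_real_derivative F2 t) (at t)"
    and d3: "\<And>t. t \<in> {p<..<q} \<Longrightarrow> (F2 has_real_derivative F3 t) (at t)"
    and nz: "\<And>t. t \<in> {p<..<q} \<Longrightarrow> F t \<in> I \<Longrightarrow> F1 t \<noteq> 0"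
    and neg: "\<And>t. t \<in> {p<..<q} \<Longrightarrow> F t \<in> I \<Longrightarrow> F3 t / F1 t - 3 / 2 * (F2 t / F1 t)\<^sup>2 < 0"
  shows "\<exists>\<eta>. concave_branch \<eta> I \<and> \<eta> ` I \<subseteq> {p<..<q} \<and> \<eta> (F x) = x \<and> (\<forall>y\<in>I. F (\<eta> y) = y)"
proof -
  obtain \<alpha> \<beta> where I_eq: "I = {\<alpha><..<\<beta>}"
    using open_connected_bounded_real[OF I] x(2) by blast
  have closed: "closed {t \<in> {u..v}. F t \<notin> I}" if "{u..v} \<subseteq> {p..q}" for u v
  proof -
    have "closed ({u..v} \<inter> F -` (- I))"
      using I(1) by (intro continuous_closed_preimage continuous_on_subset[OF cont that]) auto
    also have "{u..v} \<inter> F -` (- I) = {t \<in> {u..v}. F t \<notin> I}"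
      by auto
    finally show ?thesis .
  qed
  define A where "A = {t \<in> {p..x}. F t \<notin> I}"
  define a where "a = Sup A"
  have A: "closed A" "A \<noteq> {}" "bdd_above A"
  proof -
    show "closed A"
      using closed[of p x] x by (auto simp: A_def)
    have "p \<in> A"
      using x ends by (simp add: A_def)
    then show "A \<noteq> {}"
      by blast
    show "bdd_above A"
      by (rule bdd_aboveI[of _ x]) (simp add: A_def)
  qed
  have aA: "a \<in> A"
    unfolding a_def by (rule closed_contains_Sup[OF A(2,3,1)])
  define B where "B = {t \<in> {x..q}. F t \<notin> I}"
  define b where "b = Inf B"
  have B: "closed B" "B \<noteq> {}" "bdd_below B"
  proof -
    show "closed B"
      using closed[of x q] x by (auto simp: B_def)
    have "q \<in> B"
      using x ends by (simp add: B_def)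
    then show "B \<noteq> {}"
      by blast
    show "bdd_below B"
      by (rule bdd_belowI[of _ x]) (simp add: B_def)
  qed
  have bB: "b \<in> B"
    unfolding b_def by (rule closed_contains_Inf[OF B(2,3,1)])
  have ab: "p \<le> a" "a < x" "x < b" "b \<le> q" "F a \<notin> I" "F b \<notin> I"
    using aA bB x(2) by (auto simp: A_def B_def less_le)
  have inI: "F t \<in> I" if "a < t" "t < b" for t
  proof (rule ccontr)
    assume "F t \<notin> I"
    then have "t \<in> A \<or> t \<in> B"
      using that ab by (auto simp: A_def B_def)
    then show False
      using that cSup_upper[OF _ A(3), of t] cInf_lower[OF _ B(3), of t] by (auto simp: a_def b_def)
  qed
  have sub: "{a..b} \<subseteq> {p..q}"
    using ab by auto
  have cont_ab: "continuous_on {a..b} F"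
    by (rule continuous_on_subset[OF cont sub])
  have K: "t \<in> {p<..<q}" "F t \<in> I" if "t \<in> {a<..<b}" for t
    using that ab inI by auto
  \<comment> \<open>By continuity \<open>F a\<close> and \<open>F b\<close> lie in the closure of
    \<open>I\<close> but not in \<open>I\<close>, so each is \<alpha> or \<beta>; injectivity makes
    them different.\<close>
  have "F ` closure {a<..<b} \<subseteq> {\<alpha>..\<beta>}"
    by (rule image_closure_subset) (use ab cont_ab K(2) I_eq in \<open>auto simp: less_imp_le\<close>)
  then have "F a \<in> {\<alpha>..\<beta>}" "F b \<in> {\<alpha>..\<beta>}"
    using ab by (auto simp: image_subset_iff)
  then have F_ends: "F a = \<alpha> \<or> F a = \<beta>" "F b = \<alpha> \<or> F b = \<beta>"
    using ab(5,6) by (auto simp: I_eq)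
  have inj: "inj_on F {a..b}"
  proof (rule linorder_inj_onI)
    fix u v assume uv: "u < v" "u \<in> {a..b}" "v \<in> {a..b}"
    have cont_uv: "continuous_on {u..v} F"
      by (rule continuous_on_subset[OF cont_ab]) (use uv in auto)
    have mem: "z \<in> {a<..<b}" if "u < z" "z < v" for z
      using uv that by auto
    have "F differentiable (at z)" if "u < z" "z < v" for z
      unfolding real_differentiable_def using d1[OF K(1)[OF mem[OF that]]] by (rule exI)
    from MVT[OF uv(1) cont_uv this] obtain l z where z: "u < z" "z < v"
      "(F has_real_derivative l) (at z)" "F v - F u = (v - u) * l"
      by auto
    have "l = F1 z"
      using DERIV_unique[OF z(3) d1[OF K(1)[OF mem[OF z(1,2)]]]] .
    then have "l \<noteq> 0"
      using nz[OF K[OF mem[OF z(1,2)]]] by simp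
    with z uv show "F u \<noteq> F v"
      by auto
  qed auto
  have "F a \<noteq> F b"
    using inj_onD[OF inj, of a b] ab by auto
  have onto: "\<exists>t\<in>{a<..<b}. F t = y" if y: "y \<in> I" for y
  proof -
    have "connected (F ` {a..b})"
      by (rule connected_continuous_image[OF cont_ab]) simp
    moreover have "F a \<in> F ` {a..b}" "F b \<in> F ` {a..b}"
      using ab by auto
    then have "\<alpha> \<in> F ` {a..b}" "\<beta> \<in> F ` {a..b}"
      using F_ends \<open>F a \<noteq> F b\<close> by metis+
    ultimately have "y \<in> F ` {a..b}"
      using connectedD_interval[of "F ` {a..b}" \<alpha> \<beta> y] y by (auto simp: I_eq)
    then obtain t where t: "t \<in> {a..b}" "F t = y"
      by blast
    moreover have "t \<noteq> a" "t \<noteq> b"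
      using t y ab by auto
    ultimately show ?thesis
      by (intro bexI[of _ t]) auto
  qed
  define \<eta> where "\<eta> y = (SOME t. t \<in> {a<..<b} \<and> F t = y)" for y
  have \<eta>: "\<eta> y \<in> {a<..<b}" "F (\<eta> y) = y" if "y \<in> I" for y
  proof -
    have "\<exists>t. t \<in> {a<..<b} \<and> F t = y"
      using onto[OF that] by blast
    then have "\<eta> y \<in> {a<..<b} \<and> F (\<eta> y) = y"
      unfolding \<eta>_def by (rule someI_ex)
    then show "\<eta> y \<in> {a<..<b}" "F (\<eta> y) = y"
      by auto
  qed
  have \<eta>F: "\<eta> (F t) = t" if t: "t \<in> {a<..<b}" for t
    using inj_onD[OF inj \<eta>(2)[OF K(2)[OF t]]] \<eta>(1)[OF K(2)[OF t]] t by auto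
  have "concave_branch \<eta> I"
  proof (rule inverse_concave_branch[where K = "{a<..<b}" and F = F and ?F1.0 = F1 and ?F2.0 = F2 and ?F3.0 = F3])
    fix t assume t: "t \<in> {a<..<b}"
    show "(F has_real_derivative F1 t) (at t)" "(F1 has_real_derivative F2 t) (at t)"
        "(F2 has_real_derivative F3 t) (at t)" "F1 t \<noteq> 0" "F3 t / F1 t - 3 / 2 * (F2 t / F1 t)\<^sup>2 < 0"
      using d1 d2 d3 nz neg K[OF t] by blast+
  qed (use \<eta> \<eta>F I(1) in auto)
  moreover have "\<eta> ` I \<subseteq> {p<..<q}"
    using \<eta>(1) K(1) by blast
  moreover have "\<eta> (F x) = x"
    using ab by (intro \<eta>F) auto
  ultimately show ?thesis
    using \<eta>(2) by blast
qed

section \<open>Maps of the interval\<close>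

lemma orbit_of_image: "f x \<in> orbit_of f x"
  unfolding orbit_of_def by (rule CollectI, rule exI[of _ 1]) simp

text \<open>A dense orbit visits both sets, but the visit to \<open>V\<close> must come later. An
  infinite \<open>V \<inter> X\<close> survives removal of a finite initial piece of the orbit, so
  \<open>V\<close> is still visited outside that piece.\<close>

lemma orbit_transit:
  fixes f :: "'a::t1_space \<Rightarrow> 'a"
  assumes dense: "X \<subseteq> closure (orbit_of f z)" and U: "open U" "U \<inter> X \<noteq> {}" and V: "open V" "infinite (V \<inter> X)"
  obtains k n where "n > 0" "(f ^^ k) z \<in> U" "(f ^^ n) ((f ^^ k) z) \<in> V"
proof -
  have meets: "\<exists>k. (f ^^ k) z \<in> W" if W: "open W" "W \<inter> X \<noteq> {}" for W
  proof -
    have "W \<inter> closure (orbit_of f z) \<noteq> {}"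
      using W(2) dense by blast
    then have "W \<inter> orbit_of f z \<noteq> {}"
      using open_Int_closure_eq_empty[OF W(1)] by blast
    then show ?thesis
      by (auto simp: orbit_of_def)
  qed
  obtain k where k: "(f ^^ k) z \<in> U"
    using meets[OF U] by blast
  \<comment> \<open>Includes index \<open>k\<close> itself, which makes the transit time strictly
    positive.\<close>
  define E where "E = (\<lambda>j. (f ^^ j) z) ` {..k}"
  have "finite E"
    by (simp add: E_def)
  then have "open (V - E)"
    using V(1) by (intro open_Diff finite_imp_closed)
  moreover have "(V - E) \<inter> X \<noteq> {}"
  proof
    assume "(V - E) \<inter> X = {}"
    then have "V \<inter> X \<subseteq> E"
      by blast
    with \<open>finite E\<close> V(2) show False
      using finite_subset by blast
  qed
  ultimately obtain m where m: "(f ^^ m) z \<in> V - E"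
    using meets by blast
  have "m > k"
  proof (rule ccontr)
    assume "\<not> m > k"
    then have "(f ^^ m) z \<in> E"
      unfolding E_def by (intro imageI) simp
    with m show False by blast
  qed
  then have "(f ^^ (m - k)) ((f ^^ k) z) = (f ^^ m) z"
    by (simp add: funpow_add[symmetric, THEN fun_cong, unfolded o_apply])
  with m k \<open>m > k\<close> show thesis
    by (intro that[of "m - k" k]) auto
qed

lemma Ck_on_has_derivative:
  assumes Ck: "Ck_on n S f" and k: "k < n" and t: "t \<in> interior S"
  shows "(nderiv S k f has_real_derivative nderiv S (Suc k) f t) (at t)"
proof -
  have "nderiv S k f differentiable (at t within S)"
    using Ck k t interior_subset by (auto simp: Ck_on_def differentiable_on_def)
  then have "nderiv S k f differentiable (at t)"
    by (simp add: at_within_interior[OF t])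
  then show ?thesis
    by (simp add: nderiv_Suc at_within_interior[OF t] has_real_derivative_iff_has_vector_derivative
        vector_derivative_works)
qed

lemma nderiv_0 [simp]: "nderiv S 0 f = f"
  by (simp add: nderiv_def)

lemma Ck_on_continuous:
  assumes "Ck_on n S f"
  shows "continuous_on S f"
proof (cases n)
  case 0
  then show ?thesis
    using assms by (simp add: Ck_on_def)
next
  case (Suc m)
  then have "nderiv S 0 f differentiable_on S"
    using assms unfolding Ck_on_def by blast
  then show ?thesis
    by (simp add: differentiable_imp_continuous_on)
qed

lemma negligible_emeasure:
  assumes "negligible S" "S \<in> sets borel"
  shows "emeasure lborel S = 0"
  using assms by (simp add: negligible_iff_null_sets null_sets_def)

lemma emeasure_negligible:
  assumes "emeasure lborel S = 0" "S \<in> sets borel"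
  shows "negligible S"
  using assms by (simp add: negligible_iff_null_sets null_sets_def)

lemma dense_orbit_surj:
  fixes f :: "'a::t2_space \<Rightarrow> 'a"
  assumes dense: "X \<subseteq> closure (orbit_of f z)" and z: "z \<in> X" and f: "f ` X \<subseteq> X"
    and X: "compact X" "X \<subseteq> closure (X - {z})" and cont: "continuous_on X f"
  shows "X \<subseteq> f ` X"
proof -
  have orbit: "(f ^^ n) z \<in> X" for n
    using z f by (induction n) auto
  have closed: "closed (f ` X)"
    by (intro compact_imp_closed compact_continuous_image cont X)
  have "orbit_of f z \<subseteq> insert z (f ` X)"
  proof
    fix w assume "w \<in> orbit_of f z"
    then obtain n where "w = (f ^^ n) z"
      by (auto simp: orbit_of_def)
    then show "w \<in> insert z (f ` X)"
      using orbit by (cases n) auto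
  qed
  then have "closure (orbit_of f z) \<subseteq> insert z (f ` X)"
    by (rule closure_minimal) (use closed in auto)
  then have "X - {z} \<subseteq> f ` X"
    using dense by blast
  then have "closure (X - {z}) \<subseteq> f ` X"
    using closed by (rule closure_minimal)
  with X(2) show ?thesis
    by blast
qed

text \<open>
  If an end point \<open>t\<close> of the interval lies outside \<open>\<Lambda>\<close>, then all its preimages are end points, because an
  interior preimage is an extremum and hence critical. So \<open>\<Lambda>\<close> can be enlarged by both end points.
\<close>

lemma interval_has_sigma_finite_acim:
  fixes f :: "real \<Rightarrow> real"
  assumes img: "f ` {0..1} \<subseteq> {0..1}" and Ck: "Ck_on 3 {0..1} f"
    and dyn: "dynamical_hypotheses {0..1} (\<lambda>k. nderiv {0..1} k f) interval_lebesgue f"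
  shows "has_sigma_finite_acim interval_lebesgue f"
proof -
  define F where "F k = nderiv {0..1} k f" for k
  have F0: "F 0 = f"
    by (simp add: F_def)
  have der: "(F k has_real_derivative F (Suc k) t) (at t)" if "k < 3" "t \<in> {0<..<1}" for k t
    unfolding F_def by (rule Ck_on_has_derivative[OF Ck that(1)]) (use that(2) in simp)
  have cont: "continuous_on {0..1} f"
    using Ck by (rule Ck_on_continuous)
  define Crit where "Crit = critical_points {0..1} F"
  have hyp: "finite Crit" "\<forall>x\<in>{0..1} - Crit. schwarzian F x < 0" "\<exists>z\<in>{0..1}. {0..1} \<subseteq> closure (orbit_of f z)"
    "\<exists>\<Lambda>. closed \<Lambda> \<and> \<Lambda> \<subseteq> {0..1} \<and> f ` \<Lambda> \<subseteq> \<Lambda> \<and> emeasure interval_lebesgue \<Lambda> = 0 \<and>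
        (\<forall>c\<in>Crit. orbit_of f c \<subseteq> \<Lambda>)"
    using dyn unfolding dynamical_hypotheses_def Crit_def F_def[abs_def] by simp_all
  note fin = hyp(1) and schw = bspec[OF hyp(2)]
  obtain z where z: "z \<in> {0..1}" "{0..1} \<subseteq> closure (orbit_of f z)"
    using hyp(3) by (elim bexE)
  obtain \<Lambda> where \<Lambda>: "closed \<Lambda>" "\<Lambda> \<subseteq> {0..1}" "f ` \<Lambda> \<subseteq> \<Lambda>" "emeasure interval_lebesgue \<Lambda> = 0"
    and crit': "\<forall>c\<in>Crit. orbit_of f c \<subseteq> \<Lambda>"
    using hyp(4) by (elim exE conjE)
  note crit = bspec[OF crit']
  have crit_img: "f c \<in> \<Lambda>" if "c \<in> Crit" for c
    by (rule subsetD[OF crit[OF that] orbit_of_image])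
  define Y where "Y = {0<..<1} - \<Lambda>"
  have Y_D: "Y \<subseteq> {0..1}"
    by (auto simp: Y_def)
  have Y_open: "open Y"
    using \<Lambda>(1) by (simp add: Y_def open_Diff)
  have \<Lambda>_borel: "\<Lambda> \<in> sets borel"
    using \<Lambda>(1) by simp
  have neg_\<Lambda>: "negligible \<Lambda>"
    using \<Lambda>(2,4) \<Lambda>_borel
    by (intro emeasure_negligible) (auto simp: interval_lebesgue_def emeasure_restrict_space)
  have neg_\<Lambda>01: "negligible (\<Lambda> \<union> {0, 1})"
    by (rule negligible_Un[OF neg_\<Lambda> negligible_finite]) simp
  have onto: "{0..1} \<subseteq> f ` {0..1}"
  proof (rule dense_orbit_surj[OF z(2,1) img compact_Icc _ cont])
    have "z islimpt {0..1}"
      using z(1) by (rule connected_imp_perfect[OF connected_Icc]) simp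
    then have "z \<in> closure ({0..1} - {z})"
      by (simp only: islimpt_in_closure)
    then show "{0..1} \<subseteq> closure ({0..1} - {z})"
      using closure_subset[of "{0..1} - {z}"] by blast
  qed
  have interior_preimage: "f y \<in> \<Lambda>" if y: "y \<in> {0<..<1}" "f y = 0 \<or> f y = 1" for y
  proof -
    have near: "f s \<in> {0..1}" if "\<bar>y - s\<bar> < min y (1 - y)" for s
    proof (rule subsetD[OF img imageI])
      show "s \<in> {0..1}"
        using that by (auto simp: abs_if split: if_splits)
    qed
    have d: "(f has_real_derivative F 1 y) (at y)"
      using der[of 0 y] y F0 by simp
    have m: "0 < min y (1 - y)"
      using y by auto
    from y(2) have "F 1 y = 0"
    proof
      assume "f y = 0"
      then have "\<forall>s. \<bar>y - s\<bar> < min y (1 - y) \<longrightarrow> f y \<le> f s"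
        using near by auto
      then show ?thesis
        by (rule DERIV_local_min[OF d m])
    next
      assume "f y = 1"
      then have "\<forall>s. \<bar>y - s\<bar> < min y (1 - y) \<longrightarrow> f s \<le> f y"
        using near by auto
      then show ?thesis
        by (rule DERIV_local_max[OF d m])
    qed
    then have "y \<in> Crit"
      using y by (simp add: Crit_def critical_points_def)
    then show ?thesis
      by (rule crit_img)
  qed
  have end_preimage: "\<exists>y\<in>{0, 1}. f y = t" if t: "t \<in> {0, 1}" "t \<notin> \<Lambda>" for t
  proof -
    have "t \<in> f ` {0..1}"
      using onto t(1) by auto
    then obtain y where y: "y \<in> {0..1}" "f y = t"
      by blast
    then have "y \<notin> {0<..<1}"
      using interior_preimage[of y] t by auto
    with y show ?thesis
      by (intro bexI[of _ y]) auto
  qed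
  have preimage_Y: "t \<in> Y" if t: "t \<in> {0..1}" "f t \<in> Y" for t
  proof (rule ccontr)
    assume "t \<notin> Y"
    moreover have "t \<notin> \<Lambda>"
      using t(2) \<Lambda>(3) by (auto simp: Y_def)
    ultimately have ends: "t \<in> {0, 1}"
      using t(1) by (auto simp: Y_def)
    have ft: "f t \<noteq> 0" "f t \<noteq> 1"
      using t(2) by (auto simp: Y_def)
    \<comment> \<open>A bad end point \<open>t\<close> outside \<open>\<Lambda>\<close> has interior
      image. Its end-point preimage \<open>y\<close> is then the other end point, also outside
      \<open>\<Lambda>\<close>, and has an end-point preimage too. That one cannot be
      \<open>t\<close>, whose image is interior, nor \<open>y\<close>, whose image is
      \<open>t\<close>.\<close>
    obtain y where y: "y \<in> {0, 1}" "f y = t"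
      using end_preimage[OF ends \<open>t \<notin> \<Lambda>\<close>] by blast
    then have "y \<noteq> t" "y \<notin> \<Lambda>"
      using ft ends \<open>t \<notin> \<Lambda>\<close> \<Lambda>(3) by auto
    then obtain x where "x \<in> {0, 1}" "f x = y"
      using end_preimage[OF y(1)] by blast
    then show False
      using y ends ft \<open>y \<noteq> t\<close> by auto
  qed
  have neg_pre: "negligible {t \<in> {0..1}. f t \<notin> Y}"
  proof -
    \<comment> \<open>Discarding the finitely many critical points and the two end points leaves a
      set on which the derivative is nonzero.\<close>
    let ?E = "{t \<in> {0<..<1} - Crit. f t \<in> \<Lambda> \<union> {0, 1}}"
    have "negligible ?E"
    proof (rule negligible_preimage[where N = "\<Lambda> \<union> {0, 1}" and F = f])
      show "negligible (\<Lambda> \<union> {0, 1})"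
        by (rule neg_\<Lambda>01)
      fix t assume t: "t \<in> ?E"
      then have "F 1 t \<noteq> 0"
        by (auto simp: Crit_def critical_points_def)
      moreover have "(f has_real_derivative F 1 t) (at t)"
        using der[of 0 t] t F0 by simp
      ultimately show "\<exists>D. D \<noteq> 0 \<and> (f has_real_derivative D) (at t)"
        by blast
    qed auto
    moreover have "negligible (Crit \<union> {0, 1})"
      using fin by (intro negligible_finite) auto
    ultimately have "negligible (?E \<union> (Crit \<union> {0, 1}))"
      by (rule negligible_Un)
    then show ?thesis
      by (rule negligible_subset) (use img in \<open>auto simp: Y_def image_subset_iff less_le\<close>)
  qed
  interpret branched_map "{0..1}" Y f
  proof
    show "f \<in> measurable (restrict_space lborel {0..1}) (restrict_space lborel {0..1})"
    proof (rule measurable_restrict_space2)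
      show "f \<in> restrict_space lborel {0..1} \<rightarrow>\<^sub>M lborel"
        using borel_measurable_continuous_on_restrict[OF cont]
        by (simp cong: measurable_cong_sets sets_restrict_space_cong)
    qed (use img in \<open>auto simp: space_restrict_space\<close>)
    show "Y \<noteq> {}"
    proof
      assume "Y = {}"
      then have "{0<..<1} \<subseteq> \<Lambda>"
        by (auto simp: Y_def)
      with neg_\<Lambda> have "negligible {0<..<1::real}"
        by (rule negligible_subset)
      then show False
        using open_not_negligible[of "{0<..<1::real}"] by simp
    qed
    have "{0..1} - Y = \<Lambda> \<union> {0, 1}"
      using \<Lambda>(2) by (auto simp: Y_def)
    moreover have "negligible (\<Lambda> \<union> {0, 1})"
      by (rule neg_\<Lambda>01)
    ultimately show "emeasure lborel ({0..1} - Y) = 0"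
      using \<Lambda>_borel by (intro negligible_emeasure) auto
    have "closed ({0..1} \<inter> f -` (- Y))"
      using Y_open by (intro continuous_closed_preimage cont) auto
    moreover have "{0..1} \<inter> f -` (- Y) = {t \<in> {0..1}. f t \<notin> Y}"
      by auto
    ultimately show "emeasure lborel {t \<in> {0..1}. f t \<notin> Y} = 0"
      using neg_pre by (intro negligible_emeasure) auto
  next
    fix I t assume I: "open I" "connected I" "I \<subseteq> Y" and t: "t \<in> {0..1}" "f t \<in> I"
    have "t \<in> Y"
      using preimage_Y[OF t(1)] t(2) I(3) by blast
    then have t01: "t \<in> {0<..<1}"
      by (simp add: Y_def)
    \<comment> \<open>By \<open>preimage_Y\<close> nothing outside \<open>Y\<close> is mapped into
      \<open>Y\<close>, and the end points are outside \<open>Y\<close>.\<close>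
    have ends: "f 0 \<notin> I" "f 1 \<notin> I"
      using preimage_Y[of 0] preimage_Y[of 1] I(3) by (auto simp: Y_def)
    have bdd: "bounded I"
      using I(3) Y_D by (meson bounded_closed_interval bounded_subset)
    have crit: "s \<notin> Crit" if "f s \<in> I" for s
      using crit_img[of s] that I(3) by (auto simp: Y_def)
    have nz: "F 1 s \<noteq> 0" if "s \<in> {0<..<1}" "f s \<in> I" for s
      using crit[OF that(2)] that(1) by (auto simp: Crit_def critical_points_def)
    have neg: "F 3 s / F 1 s - 3 / 2 * (F 2 s / F 1 s)\<^sup>2 < 0" if "s \<in> {0<..<1}" "f s \<in> I" for s
      using schw[of s] crit[OF that(2)] that(1) by (simp add: schwarzian_def)
    have d: "(f has_real_derivative F 1 s) (at s)" "(F 1 has_real_derivative F 2 s) (at s)"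
        "(F 2 has_real_derivative F 3 s) (at s)" if "s \<in> {0<..<1}" for s
      using der[of 0 s] der[of 1 s] der[of 2 s] that F0 by (simp_all add: numeral_2_eq_2 numeral_3_eq_3)
    have "\<exists>\<eta>. concave_branch \<eta> I \<and> \<eta> ` I \<subseteq> {0<..<1} \<and> \<eta> (f t) = t \<and> (\<forall>y\<in>I. f (\<eta> y) = y)"
      by (rule exists_inverse_branch[OF cont I(1,2) bdd t01 t(2) ends d nz neg])
    then obtain \<eta> where \<eta>: "concave_branch \<eta> I" "\<eta> ` I \<subseteq> {0<..<1}" "\<eta> (f t) = t" "\<forall>y\<in>I. f (\<eta> y) = y"
      by (elim exE conjE)
    have "\<eta> ` I \<subseteq> {0..1}"
      using \<eta>(2) by (rule order_trans) auto
    with \<eta> show "\<exists>\<eta>. concave_branch \<eta> I \<and> \<eta> ` I \<subseteq> {0..1} \<and> \<eta> (f t) = t \<and> (\<forall>y\<in>I. f (\<eta> y) = y)"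
      by (intro exI[of _ \<eta>] conjI)
  next
    fix U V assume U: "open U" "U \<noteq> {}" "U \<subseteq> Y" and V: "open V" "V \<noteq> {}" "V \<subseteq> Y"
    have U01: "U \<inter> {0..1} \<noteq> {}" and V01: "V \<inter> {0..1} = V"
      using U V Y_D by auto
    have "infinite (V \<inter> {0..1})"
      unfolding V01 using V finite_imp_not_open[of V] by auto
    then obtain k n where "n > 0" "(f ^^ k) z \<in> U" "(f ^^ n) ((f ^^ k) z) \<in> V"
      using orbit_transit[OF z(2) U(1) U01 V(1)] by metis
    then show "\<exists>n>0. \<exists>t\<in>U. (f ^^ n) t \<in> V"
      by (intro exI[of _ n] conjI bexI[of _ "(f ^^ k) z"])
  qed (fact Y_open Y_D preimage_Y | simp)+
  show ?thesis
    using acim by (simp add: interval_lebesgue_def)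
qed

section \<open>Maps of the circle\<close>

definition wrap :: "real \<Rightarrow> real \<Rightarrow> real" where
  "wrap p x = p + frac (x - p)"

lemma wrap_range: "wrap p x \<in> {p..<p + 1}"
  by (simp add: wrap_def frac_lt_1)

lemma wrap_eq: "wrap p x = x - of_int \<lfloor>x - p\<rfloor>"
  by (simp add: wrap_def frac_def)

lemma wrap_add_int: "wrap p (x + of_int k) = wrap p x"
  by (simp add: wrap_eq diff_add_eq[symmetric])

lemma wrap_id: "x \<in> {p..<p + 1} \<Longrightarrow> wrap p x = x"
  by (simp add: wrap_def frac_eq)

lemma circ_add_int [simp]: "circ (x + of_int k) = circ x"
  using circ_eq_iff by blast

lemma circ_add_1: "circ (x + 1) = circ x"
  using circ_add_int[of x 1] by simp

lemma circ_wrap: "circ (wrap p x) = circ x"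
  using circ_add_int[of x "- \<lfloor>x - p\<rfloor>"] by (simp add: wrap_eq)

lemma norm_circ [simp]: "norm (circ x) = 1"
  by (simp add: circ_def)

lemma continuous_circ: "continuous_on A circ"
  unfolding circ_def by (intro continuous_intros)

lemma inj_on_circ: "inj_on circ {p..<p + 1}"
proof (rule inj_onI)
  fix s t assume st: "s \<in> {p..<p + 1}" "t \<in> {p..<p + 1}" "circ s = circ t"
  then obtain k :: int where "s = t + of_int k"
    using circ_eq_iff by blast
  with wrap_add_int[of p t k] st show "s = t"
    by (simp add: wrap_id)
qed

lemma circ_surj:
  assumes "z \<in> circle"
  obtains t where "t \<in> {p..<p + 1}" "circ t = z"
proof
  have "cis (Arg z) = z"
    using assms by (subst cis_Arg) (auto simp: sgn_div_norm)
  then have "circ (Arg z / (2 * pi)) = z"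
    by (simp add: circ_def)
  then show "circ (wrap p (Arg z / (2 * pi))) = z"
    by (simp add: circ_wrap)
  show "wrap p (Arg z / (2 * pi)) \<in> {p..<p + 1}"
    by (rule wrap_range)
qed

section \<open>Lebesgue measure on the circle and change of the cut point\<close>

lemma emeasure_translate:
  fixes S :: "real set"
  assumes "S \<in> sets borel"
  shows "emeasure lborel ((\<lambda>x. x + a) -` S) = emeasure lborel S"
proof -
  have "emeasure lborel S = emeasure (distr lborel borel ((+) a)) S"
    by (simp add: lborel_distr_plus)
  also have "\<dots> = emeasure lborel ((+) a -` S)"
    using assms by (simp add: emeasure_distr)
  also have "(+) a -` S = (\<lambda>x. x + a) -` S"
    by (auto simp: add.commute)
  finally show ?thesis ..
qed

lemma emeasure_periodic:
  fixes B :: "real set"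
  assumes B: "B \<in> sets borel" and per: "\<And>x. x + 1 \<in> B \<longleftrightarrow> x \<in> B" and p: "p \<in> {0..1}"
  shows "emeasure lborel ({p..<p + 1} \<inter> B) = emeasure lborel ({0..<1} \<inter> B)"
proof -
  have "{p..<p + 1} \<inter> B = ({p..<1} \<inter> B) \<union> ({1..<p + 1} \<inter> B)"
    using p by auto
  then have "emeasure lborel ({p..<p + 1} \<inter> B) = emeasure lborel ({p..<1} \<inter> B) + emeasure lborel ({1..<p + 1} \<inter> B)"
    using B by (simp add: plus_emeasure[symmetric] Int_assoc) (subst plus_emeasure, auto)
  also have "emeasure lborel ({1..<p + 1} \<inter> B) = emeasure lborel ((\<lambda>x. x + 1) -` ({1..<p + 1} \<inter> B))"
    using B by (intro emeasure_translate[symmetric]) auto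
  also have "(\<lambda>x. x + 1) -` ({1..<p + 1} \<inter> B) = {0..<p} \<inter> B"
    by (auto simp: per)
  also have "emeasure lborel ({p..<1} \<inter> B) + emeasure lborel ({0..<p} \<inter> B)
      = emeasure lborel (({p..<1} \<inter> B) \<union> ({0..<p} \<inter> B))"
    using B by (intro plus_emeasure) auto
  also have "({p..<1} \<inter> B) \<union> ({0..<p} \<inter> B) = {0..<1} \<inter> B"
    using p by auto
  finally show ?thesis .
qed

lemma measurable_circ':
  "circ \<in> measurable (restrict_space lborel {p..<p + 1}) (restrict_space borel circle)"
proof (rule measurable_restrict_space2)
  have "circ \<in> borel_measurable lborel"
    by (simp add: borel_measurable_continuous_onI continuous_circ)
  then show "circ \<in> borel_measurable (restrict_space lborel {p..<p + 1})"
    by (rule measurable_restrict_space1)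
qed simp

lemma circ_vimage_borel: "A \<in> sets borel \<Longrightarrow> circ -` A \<in> sets borel"
  using measurable_sets[OF borel_measurable_continuous_onI[OF continuous_circ], of A] by simp

text \<open>Allows the circle to be cut at a point of \<open>\<Lambda>\<close> instead of at
  \<open>circ 0\<close>.\<close>

lemma circle_lebesgue_rotate:
  assumes p: "p \<in> {0..1}"
  shows "circle_lebesgue = distr (restrict_space lborel {p..<p + 1}) (restrict_space borel circle) circ"
  unfolding circle_lebesgue_def
proof (rule measure_eqI)
  fix A assume "A \<in> sets (distr (restrict_space lborel {0..<1}) (restrict_space borel circle) circ)"
  then have A: "A \<in> sets (restrict_space borel circle)" and A': "A \<in> sets borel"
    by (auto simp: sets_restrict_space_iff)
  have eq: "emeasure (distr (restrict_space lborel {q..<q + 1}) (restrict_space borel circle) circ) A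
      = emeasure lborel ({q..<q + 1} \<inter> circ -` A)" for q :: real
    using A by (simp add: emeasure_distr[OF measurable_circ'] space_restrict_space emeasure_restrict_space Int_commute)
  show "emeasure (distr (restrict_space lborel {0..<1}) (restrict_space borel circle) circ) A
      = emeasure (distr (restrict_space lborel {p..<p + 1}) (restrict_space borel circle) circ) A"
    using eq[of 0] eq[of p] emeasure_periodic[OF circ_vimage_borel[OF A'] _ p] by (simp add: circ_add_1)
qed simp

lemma measurable_inv_circ:
  "inv_into {p..<p + 1} circ \<in> measurable (restrict_space borel circle) (restrict_space lborel {p..<p + 1})"
proof (rule measurable_restrict_space2)
  let ?\<rho> = "inv_into {p..<p + 1} circ"
  have range: "?\<rho> z \<in> {p..<p + 1}" "circ (?\<rho> z) = z" if "z \<in> circle" for z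
  proof -
    have "z \<in> circ ` {p..<p + 1}"
      using circ_surj[OF that, of p] by (metis imageI)
    then show "?\<rho> z \<in> {p..<p + 1}" "circ (?\<rho> z) = z"
      by (rule inv_into_into, rule f_inv_into_f)
  qed
  show "?\<rho> \<in> space (restrict_space borel circle) \<rightarrow> {p..<p + 1}"
    using range by (auto simp: space_restrict_space)
  have "?\<rho> \<in> borel_measurable (restrict_space borel circle)"
    unfolding borel_measurable_iff_le
  proof
    fix a
    let ?S = "{z \<in> space (restrict_space borel circle). ?\<rho> z \<le> a}"
    have "?S = (if a < p + 1 then circ ` {p..a} else circle)"
    proof (cases "a < p + 1")
      case True
      have "?S = circ ` {p..a}"
      proof (intro equalityI subsetI)
        fix z assume "z \<in> ?S"
        then have "z \<in> circle" "?\<rho> z \<le> a"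
          by (auto simp: space_restrict_space)
        then have "?\<rho> z \<in> {p..a}" "z = circ (?\<rho> z)"
          using range[of z] by auto
        then show "z \<in> circ ` {p..a}"
          by (rule image_eqI[rotated])
      next
        fix z assume "z \<in> circ ` {p..a}"
        then obtain t where t: "t \<in> {p..a}" "z = circ t"
          by blast
        then have "?\<rho> z = t"
          using True by (auto intro!: inv_into_f_f[OF inj_on_circ])
        with t show "z \<in> ?S"
          by (simp add: space_restrict_space)
      qed
      with True show ?thesis by simp
    next
      case False
      have "?\<rho> z \<le> a" if "z \<in> circle" for z
        using range(1)[OF that] False by auto
      with False show ?thesis
        by (auto simp: space_restrict_space)
    qed
    moreover have "circ ` {p..a} \<in> sets borel"
      by (intro borel_closed compact_imp_closed compact_continuous_image continuous_circ compact_Icc)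
    moreover have "circ ` {p..a} \<subseteq> circle"
      by auto
    ultimately show "?S \<in> sets (restrict_space borel circle)"
      by (auto simp: sets_restrict_space_iff)
  qed
  then show "?\<rho> \<in> restrict_space borel circle \<rightarrow>\<^sub>M lborel"
    by (simp cong: measurable_cong_sets)
qed

text \<open>Image measures of \<sigma>-finite measures need not be \<sigma>-finite. The measurable
  left inverse \<rho> carries a countable cover by sets of finite measure over to
  \<open>N\<close>.\<close>

lemma has_sigma_finite_acim_distr:
  assumes acim: "has_sigma_finite_acim M g" and \<pi> [measurable]: "\<pi> \<in> measurable M N"
    and \<rho> [measurable]: "\<rho> \<in> measurable N M" and \<rho>\<pi>: "\<And>x. x \<in> space M \<Longrightarrow> \<rho> (\<pi> x) = x"
    and f [measurable]: "f \<in> measurable N N" and conj: "\<And>x. x \<in> space M \<Longrightarrow> \<pi> (g x) = f (\<pi> x)"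
  shows "has_sigma_finite_acim (distr M N \<pi>) f"
proof -
  obtain \<mu> where sets: "sets \<mu> = sets M" and nz: "emeasure \<mu> (space \<mu>) \<noteq> 0" and sf: "sigma_finite_measure \<mu>"
    and inv: "invariant_measure g \<mu>" and ac: "absolutely_continuous M \<mu>"
    using acim unfolding has_sigma_finite_acim_def by blast
  have space: "space \<mu> = space M"
    using sets by (rule sets_eq_imp_space_eq)
  have \<pi>\<mu>: "\<pi> \<in> measurable \<mu> N" and \<rho>\<mu>: "\<rho> \<in> measurable N \<mu>"
    using \<pi> \<rho> by (simp_all add: measurable_cong_sets[OF sets refl] measurable_cong_sets[OF refl sets])
  let ?\<nu> = "distr \<mu> N \<pi>"
  have em: "emeasure ?\<nu> A = emeasure \<mu> (\<pi> -` A \<inter> space M)" if "A \<in> sets N" for A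
    using emeasure_distr[OF \<pi>\<mu> that] by (simp add: space)
  show ?thesis
    unfolding has_sigma_finite_acim_def
  proof (intro exI[of _ ?\<nu>] conjI)
    show "sets ?\<nu> = sets (distr M N \<pi>)"
      by simp
    have "\<pi> -` space N \<inter> space M = space M"
      using measurable_space[OF \<pi>] by auto
    then show "emeasure ?\<nu> (space ?\<nu>) \<noteq> 0"
      using nz by (simp add: em space)
    show "sigma_finite_measure ?\<nu>"
    proof
      obtain A where A: "countable A" "A \<subseteq> sets \<mu>" "\<Union>A = space \<mu>" "\<forall>a\<in>A. emeasure \<mu> a \<noteq> \<infinity>"
        using sf unfolding sigma_finite_measure_def by blast
      show "\<exists>A. countable A \<and> A \<subseteq> sets ?\<nu> \<and> \<Union>A = space ?\<nu> \<and> (\<forall>a\<in>A. emeasure ?\<nu> a \<noteq> \<infinity>)"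
      proof (intro exI[of _ "(\<lambda>a. \<rho> -` a \<inter> space N) ` A"] conjI ballI)
        show "countable ((\<lambda>a. \<rho> -` a \<inter> space N) ` A)"
          using A(1) by (rule countable_image)
        show "(\<lambda>a. \<rho> -` a \<inter> space N) ` A \<subseteq> sets ?\<nu>"
          using A(2) measurable_sets[OF \<rho>\<mu>] by auto
        have "\<rho> z \<in> \<Union>A" if "z \<in> space N" for z
          unfolding A(3) by (rule measurable_space[OF \<rho>\<mu> that])
        then show "\<Union>((\<lambda>a. \<rho> -` a \<inter> space N) ` A) = space ?\<nu>"
          by auto
        fix B assume "B \<in> (\<lambda>a. \<rho> -` a \<inter> space N) ` A"
        then obtain a where a: "a \<in> A" "B = \<rho> -` a \<inter> space N"
          by blast
        have "a \<subseteq> space M"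
          using a(1) A(3) space by blast
        then have "\<pi> -` B \<inter> space M = a"
          using a(2) \<rho>\<pi> measurable_space[OF \<pi>] by auto
        moreover have "B \<in> sets N"
          using a A(2) measurable_sets[OF \<rho>\<mu>, of a] by auto
        ultimately show "emeasure ?\<nu> B \<noteq> \<infinity>"
          using A(4) a(1) by (simp add: em)
      qed
    qed
    show "invariant_measure f ?\<nu>"
      unfolding invariant_measure_def
    proof (intro conjI ballI)
      show "f \<in> measurable ?\<nu> ?\<nu>"
        by simp
      fix A assume "A \<in> sets ?\<nu>"
      then have A: "A \<in> sets N"
        by simp
      have gM: "g x \<in> space M" if "x \<in> space M" for x
        using inv measurable_space[of g \<mu> \<mu> x] that by (simp add: invariant_measure_def space)
      have "\<pi> -` (f -` A \<inter> space N) \<inter> space M = g -` (\<pi> -` A \<inter> space M) \<inter> space \<mu>"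
        using measurable_space[OF \<pi>] conj gM by (auto simp: space)
      moreover have "\<pi> -` A \<inter> space M \<in> sets \<mu>"
        using measurable_sets[OF \<pi> A] by (simp add: sets)
      moreover have fA: "f -` A \<inter> space N \<in> sets N"
        using A by measurable
      moreover have "emeasure \<mu> (g -` B \<inter> space \<mu>) = emeasure \<mu> B" if "B \<in> sets \<mu>" for B
        using inv that by (simp add: invariant_measure_def)
      ultimately show "emeasure ?\<nu> (f -` A \<inter> space ?\<nu>) = emeasure ?\<nu> A"
        by (simp only: em[OF A] em[OF fA] space_distr)
    qed
    show "absolutely_continuous (distr M N \<pi>) ?\<nu>"
      unfolding absolutely_continuous_def
    proof
      fix A assume A: "A \<in> null_sets (distr M N \<pi>)"
      then have AN: "A \<in> sets N"
        by auto
      have "\<pi> -` A \<inter> space M \<in> null_sets M"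
        using A measurable_sets[OF \<pi> AN] by (auto simp: null_sets_def emeasure_distr)
      then have "\<pi> -` A \<inter> space M \<in> null_sets \<mu>"
        using ac by (auto simp: absolutely_continuous_def)
      then show "A \<in> null_sets ?\<nu>"
        using AN by (auto simp: null_sets_def em)
    qed
  qed
qed

text \<open>
  Without critical points, \<open>F'' / \<bar>F'\<bar> powr (3/2)\<close> would be a strictly monotone periodic function, its
  derivative being \<open>F' * SF / \<bar>F'\<bar> powr (3/2)\<close>.
\<close>

lemma negative_schwarzian_not_periodic:
  fixes F1 F2 F3 :: "real \<Rightarrow> real"
  assumes d1: "\<And>t. (F1 has_real_derivative F2 t) (at t)"
    and d2: "\<And>t. (F2 has_real_derivative F3 t) (at t)"
    and per: "F1 1 = F1 0" "F2 1 = F2 0"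
    and nz: "\<And>t. F1 t \<noteq> 0"
    and neg: "\<And>t. F3 t / F1 t - 3 / 2 * (F2 t / F1 t)\<^sup>2 < 0"
  shows False
proof -
  have "continuous_on UNIV F1"
    using d1 by (intro continuous_at_imp_continuous_on) (auto intro: DERIV_isCont)
  then have conn: "connected (range F1)"
    by (rule connected_continuous_image) simp
  have sign: "sgn (F1 t) = sgn (F1 0)" for t
  proof (rule ccontr)
    assume "sgn (F1 t) \<noteq> sgn (F1 0)"
    then have "F1 t \<le> 0 \<and> 0 \<le> F1 0 \<or> F1 0 \<le> 0 \<and> 0 \<le> F1 t"
      by (auto simp: sgn_if split: if_splits)
    then have "0 \<in> range F1"
      using connectedD_interval[OF conn] by (meson rangeI)
    with nz show False by force
  qed
  define e where "e = sgn (F1 0)"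
  have e: "e \<in> {-1, 1}"
    using nz[of 0] by (auto simp: e_def sgn_if)
  have pos: "0 < e * F1 t" for t
    using nz[of t] unfolding e_def sign[of t, symmetric] by (simp add: sgn_if)
  define u where "u t = sqrt (e * F1 t)" for t
  have u: "u t > 0" for t
    using pos by (simp add: u_def)
  have ee: "e * e = 1"
    using e by auto
  have "(u t)\<^sup>2 = e * F1 t" for t
    using pos[of t] by (simp add: u_def)
  then have F1_eq: "F1 t = e * (u t)\<^sup>2" for t
    using ee by (simp add: mult.assoc[symmetric])
  have du: "(u has_real_derivative e * F2 t / (2 * u t)) (at t)" for t
  proof -
    have "(u has_real_derivative inverse (u t) / 2 * (e * F2 t)) (at t)"
      using DERIV_chain2[OF DERIV_real_sqrt[OF pos] DERIV_cmult[OF d1]] by (simp add: u_def[abs_def])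
    then show ?thesis
      by (simp add: field_simps)
  qed
  \<comment> \<open>The factor \<open>e\<close> makes the derivative equal to the Schwarzian
    expression divided by \<open>u t\<close>, negative for either orientation.\<close>
  have "(\<lambda>t. e * F2 t / (u t)^3) 0 > (\<lambda>t. e * F2 t / (u t)^3) 1"
  proof (rule DERIV_neg_imp_decreasing[where f = "\<lambda>t. e * F2 t / (u t)^3"])
    fix t :: real
    have "((\<lambda>t. (u t)^3) has_real_derivative 3 * (u t)\<^sup>2 * (e * F2 t / (2 * u t))) (at t)"
      using DERIV_power[OF du, of 3] by (simp add: mult_ac)
    from DERIV_divide[OF DERIV_cmult[OF d2] this]
    have "((\<lambda>t. e * F2 t / (u t)^3) has_real_derivative
        (e * F3 t * (u t)^3 - e * F2 t * (3 * (u t)\<^sup>2 * (e * F2 t / (2 * u t)))) / ((u t)^3 * (u t)^3)) (at t)"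
      using u[of t] by simp
    moreover have "(e * F3 t * (u t)^3 - e * F2 t * (3 * (u t)\<^sup>2 * (e * F2 t / (2 * u t)))) / ((u t)^3 * (u t)^3)
        = (F3 t / F1 t - 3 / 2 * (F2 t / F1 t)\<^sup>2) / u t"
    proof -
      have 1: "F3 t / F1 t = e * F3 t / (u t)\<^sup>2"
        using e by (auto simp: F1_eq)
      have 2: "(F2 t / F1 t)\<^sup>2 = (F2 t)\<^sup>2 / (u t)^4"
        using e by (auto simp: F1_eq power_divide)
      have 3: "e * F2 t * (3 * (u t)\<^sup>2 * (e * F2 t / (2 * u t))) = (e * e) * (3 / 2 * (F2 t)\<^sup>2 * u t)"
        using u[of t] by (simp add: field_simps power2_eq_square)
      show ?thesis
        unfolding 1 2 3 ee using u[of t]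
        by (simp add: field_simps power2_eq_square power3_eq_cube power4_eq_xxxx)
    qed
    moreover have "(F3 t / F1 t - 3 / 2 * (F2 t / F1 t)\<^sup>2) / u t < 0"
      using neg[of t] u[of t] by (rule divide_neg_pos)
    ultimately show "\<exists>y. ((\<lambda>t. e * F2 t / (u t)^3) has_real_derivative y) (at t) \<and> y < 0"
      by auto
  qed simp
  with per show False
    by (simp add: u_def)
qed

lemma concave_branch_shift: "concave_branch (\<lambda>y. y + a) I"
  unfolding concave_branch_def
  by (rule bexI[of _ 1], rule exI[of _ "\<lambda>_. 1"], rule exI[of _ "\<lambda>_. 0"], rule exI[of _ "\<lambda>_. 0"])
    (auto intro!: derivative_eq_intros)

lemma circ_image_open:
  assumes U: "open U" "U \<subseteq> {p<..<p + 1}"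
  obtains P where "open P" "P \<inter> circle = circ ` U"
proof
  let ?P = "- circ ` ({p..p + 1} - U)"
  have "compact ({p..p + 1} - U)"
    using U(1) by (intro compact_diff) auto
  then show "open ?P"
    by (intro open_Compl compact_imp_closed compact_continuous_image continuous_circ)
  show "?P \<inter> circle = circ ` U"
  proof (intro equalityI subsetI)
    fix z assume z: "z \<in> ?P \<inter> circle"
    then obtain t where "t \<in> {p..<p + 1}" "circ t = z"
      using circ_surj by blast
    with z show "z \<in> circ ` U"
      by force
  next
    fix z assume "z \<in> circ ` U"
    then obtain u where u: "u \<in> U" "z = circ u"
      by blast
    have "s = u" if "s \<in> {p..p + 1}" "circ s = circ u" for s
    proof -
      obtain k :: int where k: "s = u + of_int k"
        using \<open>circ s = circ u\<close> circ_eq_iff by blast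
      have "\<bar>s - u\<bar> < 1"
        using that(1) u(1) U(2) by (force simp: abs_less_iff)
      with k show "s = u"
        by simp
    qed
    with u show "z \<in> ?P \<inter> circle"
      by auto
  qed
qed

text \<open>Cut at a point of \<open>\<Lambda>\<close>, the circle map becomes a lift reduced modulo
  1. Since the cut lies in the forward invariant set, its image under the lift avoids every interval
  over which branches are sought, and no branch crosses it.\<close>

lemma circle_has_sigma_finite_acim:
  fixes f :: "complex \<Rightarrow> complex"
  assumes img: "f ` circle \<subseteq> circle" and Ck: "Ck_circle 3 f"
    and dyn: "dynamical_hypotheses circle (\<lambda>k. circle_nderiv k f) circle_lebesgue f"
  shows "has_sigma_finite_acim circle_lebesgue f"
proof -
  obtain F where lift: "circle_lift f F" and CkF: "Ck_on 3 UNIV F"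
    using Ck by (auto simp: Ck_circle_def)
  have F_cont: "continuous_on A F" for A
    using lift by (auto simp: circle_lift_def intro: continuous_on_subset)
  have F_circ: "circ (F t) = f (circ t)" for t
    using lift by (simp add: circle_lift_def)
  define G where "G k = nderiv UNIV k F" for k
  have G0: "G 0 = F"
    by (simp add: G_def)
  have der: "(G k has_real_derivative G (Suc k) t) (at t)" if "k < 3" for k t
    unfolding G_def by (rule Ck_on_has_derivative[OF CkF that]) simp
  have G_der: "(F has_real_derivative G 1 s) (at s)" "(G 1 has_real_derivative G 2 s) (at s)"
      "(G 2 has_real_derivative G 3 s) (at s)" for s
    using der[of 0 s] der[of 1 s] der[of 2 s] G0 by (simp_all add: numeral_2_eq_2 numeral_3_eq_3)
  define E where "E k = circle_nderiv k f" for k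
  have E_G: "E k (circ t) = G k t" if "k > 0" for k t
    unfolding E_def G_def by (rule circle_nderiv_circ[OF lift that])
  define Crit where "Crit = critical_points circle E"
  have hyp: "finite Crit" "\<forall>x\<in>circle - Crit. schwarzian E x < 0" "\<exists>z\<in>circle. circle \<subseteq> closure (orbit_of f z)"
    "\<exists>\<Lambda>. closed \<Lambda> \<and> \<Lambda> \<subseteq> circle \<and> f ` \<Lambda> \<subseteq> \<Lambda> \<and> emeasure circle_lebesgue \<Lambda> = 0 \<and>
        (\<forall>c\<in>Crit. orbit_of f c \<subseteq> \<Lambda>)"
    using dyn unfolding dynamical_hypotheses_def Crit_def E_def[abs_def] by simp_all
  note fin = hyp(1) and schw = bspec[OF hyp(2)]
  obtain z where z: "z \<in> circle" "circle \<subseteq> closure (orbit_of f z)"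
    using hyp(3) by (elim bexE)
  obtain \<Lambda> where \<Lambda>: "closed \<Lambda>" "\<Lambda> \<subseteq> circle" "f ` \<Lambda> \<subseteq> \<Lambda>" "emeasure circle_lebesgue \<Lambda> = 0"
    and crit': "\<forall>c\<in>Crit. orbit_of f c \<subseteq> \<Lambda>"
    using hyp(4) by (elim exE conjE)
  note crit = bspec[OF crit']
  have f_\<Lambda>: "f w \<in> \<Lambda>" if "w \<in> \<Lambda>" for w
    using \<Lambda>(3) that by (rule subsetD[OF _ imageI])
  have crit_img: "f c \<in> \<Lambda>" if "c \<in> Crit" for c
    by (rule subsetD[OF crit[OF that] orbit_of_image])
  have Crit_iff: "circ t \<in> Crit \<longleftrightarrow> G 1 t = 0" for t
    using E_G[of 1 t] by (simp add: Crit_def critical_points_def)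
  have neg: "G 3 t / G 1 t - 3 / 2 * (G 2 t / G 1 t)\<^sup>2 < 0" if "circ t \<notin> Crit" for t
    using schw[of "circ t"] that by (simp add: schwarzian_def E_G)
  have "Crit \<noteq> {}"
  proof
    assume empty: "Crit = {}"
    show False
    proof (rule negative_schwarzian_not_periodic[where ?F1.0 = "G 1" and ?F2.0 = "G 2" and ?F3.0 = "G 3"])
      have "G k 1 = G k 0" if "k > 0" for k
        using E_G[OF that, of 1] E_G[OF that, of 0] circ_add_1[of 0] by simp
      then show "G 1 1 = G 1 0" "G 2 1 = G 2 0"
        by simp_all
      show "G 1 t \<noteq> 0" for t
        using Crit_iff[of t] empty by simp
    qed (use G_der neg empty in auto)
  qed
  then obtain c where "c \<in> Crit"
    by blast
  then have "f c \<in> \<Lambda>"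
    by (rule crit_img)
  \<comment> \<open>The cut point. A critical value is a point of \<open>\<Lambda>\<close>, which is
    how the existence of a critical point enters.\<close>
  then obtain p where p: "p \<in> {0..<0 + 1}" "circ p \<in> \<Lambda>"
    using circ_surj[of "f c" 0] \<Lambda>(2) by (metis subsetD)
  let ?D = "{p..<p + 1}"
  define L where "L = circ -` \<Lambda>"
  have L: "closed L"
    unfolding L_def using \<Lambda>(1) continuous_circ by (rule closed_vimage)
  have L_shift: "t + of_int k \<in> L \<longleftrightarrow> t \<in> L" for t k
    by (simp add: L_def)
  have L_F: "F t \<in> L" if "t \<in> L" for t
    using f_\<Lambda> that by (simp add: L_def F_circ)
  have pL: "p \<in> L" "p + 1 \<in> L"
    using p(2) L_shift[of p 1] by (simp_all add: L_def)
  have neg_L: "negligible L"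
  proof -
    have "emeasure lborel ({0..<1} \<inter> L) = 0"
    proof -
      have A: "\<Lambda> \<in> sets (restrict_space borel circle)"
        using \<Lambda>(1,2) by (simp add: sets_restrict_space_iff)
      show ?thesis
        using \<Lambda>(4) unfolding circle_lebesgue_def L_def
        by (simp add: emeasure_distr[OF measurable_circ A] space_restrict_space emeasure_restrict_space Int_commute)
    qed
    then have "negligible ({0..<1} \<inter> L)"
      using L by (intro emeasure_negligible) auto
    then have "negligible (\<Union>k::int. (+) (of_int k) ` ({0..<1} \<inter> L))"
      by (intro negligible_countable_Union) (auto intro: negligible_translation)
    moreover have "L \<subseteq> (\<Union>k::int. (+) (of_int k) ` ({0..<1} \<inter> L))"
    proof
      fix t assume t: "t \<in> L"
      have "t = of_int \<lfloor>t\<rfloor> + wrap 0 t"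
        by (simp add: wrap_eq)
      moreover have "wrap 0 t \<in> {0..<1} \<inter> L"
        using wrap_range[of 0 t] t by (simp add: L_def circ_wrap)
      ultimately show "t \<in> (\<Union>k::int. (+) (of_int k) ` ({0..<1} \<inter> L))"
        by blast
    qed
    ultimately show ?thesis
      by (rule negligible_subset)
  qed
  define Y where "Y = {p<..<p + 1} - L"
  define g where "g t = wrap p (F t)" for t
  have Y_D: "Y \<subseteq> ?D"
    by (auto simp: Y_def)
  have Y_open: "open Y"
    using L by (simp add: Y_def open_Diff)
  have g_circ: "circ (g t) = f (circ t)" for t
    by (simp add: g_def circ_wrap F_circ)
  have g_D: "g t \<in> ?D" for t
    unfolding g_def by (rule wrap_range)
  have Y_iff: "t \<in> Y \<longleftrightarrow> t \<notin> L" if "t \<in> ?D" for t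
    using that pL by (auto simp: Y_def less_le)
  have gY: "g t \<in> Y \<longleftrightarrow> F t \<notin> L" for t
    using Y_iff[OF g_D] by (simp add: L_def g_circ F_circ)
  have preimage_Y: "t \<in> Y" if "t \<in> ?D" "g t \<in> Y" for t
    using that L_F by (auto simp: gY Y_iff)
  have g_meas: "g \<in> measurable (restrict_space lborel ?D) (restrict_space lborel ?D)"
  proof (rule measurable_restrict_space2)
    have [measurable]: "F \<in> borel_measurable borel"
      using F_cont by (rule borel_measurable_continuous_onI)
    have "g \<in> borel_measurable borel"
      unfolding g_def[abs_def] wrap_eq by measurable
    then show "g \<in> restrict_space lborel ?D \<rightarrow>\<^sub>M lborel"
      by (intro measurable_restrict_space1) simp
  qed (use g_D in auto)
  have neg_pre: "negligible {t \<in> ?D. g t \<notin> Y}"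
  proof -
    let ?E = "{t \<in> ?D. G 1 t \<noteq> 0 \<and> F t \<in> L}"
    have "negligible ?E"
      by (rule negligible_preimage[OF _ neg_L, where F = F]) (use G_der in auto)
    moreover have "finite {t \<in> ?D. G 1 t = 0}"
    proof (rule finite_imageD)
      show "finite (circ ` {t \<in> ?D. G 1 t = 0})"
        using fin by (rule finite_subset[rotated]) (auto simp: Crit_iff)
      show "inj_on circ {t \<in> ?D. G 1 t = 0}"
        using inj_on_circ by (rule inj_on_subset) auto
    qed
    ultimately have "negligible (?E \<union> {t \<in> ?D. G 1 t = 0})"
      by (rule negligible_Un[OF _ negligible_finite])
    then show ?thesis
      by (rule negligible_subset) (auto simp: gY)
  qed
  interpret branched_map ?D Y g
  proof
    show "?D \<in> sets borel" "bounded ?D" "open Y" "Y \<subseteq> ?D"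
      using Y_open Y_D by (simp_all add: bounded_Ico)
    show "g \<in> measurable (restrict_space lborel ?D) (restrict_space lborel ?D)"
      by (rule g_meas)
    show "Y \<noteq> {}"
    proof
      assume "Y = {}"
      then have "{p<..<p + 1} \<subseteq> L"
        by (auto simp: Y_def)
      with neg_L have "negligible {p<..<p + 1}"
        by (rule negligible_subset)
      then show False
        using open_not_negligible[of "{p<..<p + 1}"] by simp
    qed
    have "negligible (?D - Y)"
      by (rule negligible_subset[OF neg_L]) (auto simp: Y_iff)
    then show "emeasure lborel (?D - Y) = 0"
      using Y_open by (intro negligible_emeasure) auto
    have "{t \<in> ?D. g t \<notin> Y} = ?D \<inter> F -` L"
      by (auto simp: gY)
    moreover have "closed (F -` L)"
      using L F_cont by (rule closed_vimage)
    ultimately show "emeasure lborel {t \<in> ?D. g t \<notin> Y} = 0"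
      using neg_pre by (intro negligible_emeasure) auto
    show "t \<in> Y" if "t \<in> ?D" "g t \<in> Y" for t
      using that by (rule preimage_Y)
  next
    fix I t assume I: "open I" "connected I" "I \<subseteq> Y" and t: "t \<in> ?D" "g t \<in> I"
    \<comment> \<open>The number of turns removed by \<open>wrap\<close> at \<open>t\<close>. Near
      \<open>t\<close> a branch of \<open>g\<close> over \<open>I\<close> is a branch of the lift
      over \<open>I + k\<close>, preceded by the translation; \<open>L\<close> has period 1, so
      \<open>I + k\<close> avoids it too.\<close>
    define k where "k = \<lfloor>F t - p\<rfloor>"
    define I' where "I' = (\<lambda>y. y + of_int k) ` I"
    have I'_L: "y \<notin> L" if "y \<in> I'" for y
      using that I(3) L_shift by (auto simp: I'_def Y_def)
    have I': "open I'" "connected I'"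
      unfolding I'_def using I(1,2) open_translation[of I "of_int k"]
      by (auto simp: add.commute[of _ "of_int k"] intro!: connected_continuous_image continuous_intros)
    have "bounded I"
      using I(3) Y_D bounded_Ico by (meson bounded_subset)
    then have bdd: "bounded I'"
      unfolding I'_def using bounded_translation[of I "of_int k"] by (simp add: add.commute[of _ "of_int k"])
    have "t \<in> Y"
      using preimage_Y[OF t(1)] t(2) I(3) by blast
    then have t': "t \<in> {p<..<p + 1}"
      by (simp add: Y_def)
    have "F t = g t + of_int k"
      by (simp add: g_def wrap_eq k_def)
    then have Ft: "F t \<in> I'"
      using t(2) by (simp add: I'_def)
    have ends: "F p \<notin> I'" "F (p + 1) \<notin> I'"
      using I'_L L_F pL by blast+
    have crit: "circ s \<notin> Crit" if "F s \<in> I'" for s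
      using crit_img[of "circ s"] I'_L[OF that] by (auto simp: L_def F_circ)
    have nz: "G 1 s \<noteq> 0" if "s \<in> {p<..<p + 1}" "F s \<in> I'" for s
      using crit[OF that(2)] by (simp add: Crit_iff)
    have "\<exists>\<eta>. concave_branch \<eta> I' \<and> \<eta> ` I' \<subseteq> {p<..<p + 1} \<and> \<eta> (F t) = t \<and> (\<forall>y\<in>I'. F (\<eta> y) = y)"
      by (rule exists_inverse_branch[OF F_cont I' bdd t' Ft ends G_der nz neg[OF crit]])
    then obtain \<eta> where \<eta>: "concave_branch \<eta> I'" "\<eta> ` I' \<subseteq> {p<..<p + 1}" "\<eta> (F t) = t" "\<forall>y\<in>I'. F (\<eta> y) = y"
      by (elim exE conjE)
    show "\<exists>\<eta>. concave_branch \<eta> I \<and> \<eta> ` I \<subseteq> ?D \<and> \<eta> (g t) = t \<and> (\<forall>y\<in>I. g (\<eta> y) = y)"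
    proof (intro exI[of _ "\<lambda>y. \<eta> (y + of_int k)"] conjI ballI)
      show "concave_branch (\<lambda>y. \<eta> (y + of_int k)) I"
        using concave_branch_compose[OF concave_branch_shift \<eta>(1)[unfolded I'_def]] .
      have "(\<lambda>y. \<eta> (y + of_int k)) ` I = \<eta> ` I'"
        by (simp add: I'_def image_image)
      also have "\<dots> \<subseteq> ?D"
        using \<eta>(2) by (rule order_trans) auto
      finally show "(\<lambda>y. \<eta> (y + of_int k)) ` I \<subseteq> ?D" .
      show "\<eta> (g t + of_int k) = t"
        using \<eta>(3) \<open>F t = g t + of_int k\<close> by simp
      fix y assume y: "y \<in> I"
      then have "F (\<eta> (y + of_int k)) = y + of_int k"
        using \<eta>(4) by (simp add: I'_def)
      moreover have "y \<in> ?D"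
        using y I(3) Y_D by blast
      ultimately show "g (\<eta> (y + of_int k)) = y"
        by (simp only: g_def wrap_add_int wrap_id)
    qed
  next
    fix U V assume U: "open U" "U \<noteq> {}" "U \<subseteq> Y" and V: "open V" "V \<noteq> {}" "V \<subseteq> Y"
    have U': "U \<subseteq> {p<..<p + 1}" and V': "V \<subseteq> {p<..<p + 1}"
      using U(3) V(3) by (auto simp: Y_def)
    have VD: "V \<subseteq> ?D"
      using V(3) Y_D by (rule order_trans)
    obtain P where P: "open P" "P \<inter> circle = circ ` U"
      using circ_image_open[OF U(1) U'] .
    obtain Q where Q: "open Q" "Q \<inter> circle = circ ` V"
      using circ_image_open[OF V(1) V'] .
    have "P \<inter> circle \<noteq> {}"
      using U(2) by (simp add: P(2))
    moreover have "infinite (Q \<inter> circle)"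
    proof -
      have "infinite V"
        using V finite_imp_not_open[of V] by auto
      moreover have "inj_on circ V"
        using inj_on_circ VD by (rule inj_on_subset)
      ultimately show ?thesis
        unfolding Q(2) using finite_imageD by blast
    qed
    ultimately obtain k n where n: "n > 0" "(f ^^ k) z \<in> P" "(f ^^ n) ((f ^^ k) z) \<in> Q"
      using orbit_transit[OF z(2) P(1) _ Q(1)] by metis
    have circle: "(f ^^ j) w \<in> circle" if "w \<in> circle" for j w
    proof (induction j)
      case (Suc j)
      then show ?case
        using subsetD[OF img imageI] by simp
    qed (use that in simp)
    have "(f ^^ k) z \<in> circ ` U"
      using n(2) circle[OF z(1)] P(2) by blast
    then obtain u where u: "u \<in> U" "(f ^^ k) z = circ u"
      by blast
    have "(f ^^ n) (circ u) \<in> circ ` V"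
      using n(3) circle[OF circle[OF z(1)]] Q(2) u(2) by (metis IntI)
    then obtain v where v: "v \<in> V" "(f ^^ n) (circ u) = circ v"
      by blast
    \<comment> \<open>\<open>circ\<close> semiconjugates \<open>g\<close> to \<open>f\<close>, and
      its injectivity on one period brings the transit found on the circle back to the line.\<close>
    have "circ ((g ^^ j) u) = (f ^^ j) (circ u)" for j
      by (induction j) (simp_all add: g_circ)
    then have "circ ((g ^^ n) u) = circ v"
      using v(2) by simp
    moreover have "(g ^^ n) u \<in> ?D"
      using n(1) g_D by (cases n) auto
    ultimately have "(g ^^ n) u = v"
      using inj_onD[OF inj_on_circ] v(1) VD by blast
    with n(1) u(1) v(1) show "\<exists>n>0. \<exists>t\<in>U. (g ^^ n) t \<in> V"
      by (intro exI[of _ n] conjI bexI[of _ u]) simp_all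
  qed
  have "f \<in> measurable (restrict_space borel circle) (restrict_space borel circle)"
  proof (rule measurable_restrict_space2)
    show "f \<in> space (restrict_space borel circle) \<rightarrow> circle"
      using img by (auto simp: space_restrict_space)
    \<comment> \<open>Nothing is assumed about \<open>f\<close> off the circle, so measurability is
      derived from the lift through the inverse coordinate.\<close>
    have "continuous_on UNIV (\<lambda>t. circ (F t))"
      using continuous_on_compose[OF F_cont continuous_circ] by (simp add: o_def)
    then have "(\<lambda>t. circ (F t)) \<in> borel_measurable borel"
      by (rule borel_measurable_continuous_onI)
    then have "(\<lambda>t. circ (F t)) \<in> borel_measurable (restrict_space lborel ?D)"
      by (intro measurable_restrict_space1) simp
    from measurable_compose[OF measurable_inv_circ this]
    have "(\<lambda>w. circ (F (inv_into ?D circ w))) \<in> borel_measurable (restrict_space borel circle)" .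
    moreover have "circ (F (inv_into ?D circ w)) = f w" if "w \<in> space (restrict_space borel circle)" for w
    proof -
      have "w \<in> circle"
        using that by (simp add: space_restrict_space)
      then have "w \<in> circ ` ?D"
        using circ_surj[of w p] by (metis imageI)
      then show ?thesis
        by (simp add: F_circ f_inv_into_f)
    qed
    ultimately show "f \<in> borel_measurable (restrict_space borel circle)"
      by (subst measurable_cong[of _ f "\<lambda>w. circ (F (inv_into ?D circ w))"]) auto
  qed
  from has_sigma_finite_acim_distr[OF acim measurable_circ' measurable_inv_circ _ this]
  have "has_sigma_finite_acim (distr (restrict_space lborel ?D) (restrict_space borel circle) circ) f"
    using g_circ inj_on_circ by (simp add: space_restrict_space)
  then show ?thesis
    using circle_lebesgue_rotate[of p] p(1) by simp
qed

theorem theoremB: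
  shows
    "(\<forall>f::real \<Rightarrow> real.
        f ` {0..1} \<subseteq> {0..1} \<longrightarrow>
        Ck_on 3 {0..1} f \<longrightarrow>
        dynamical_hypotheses {0..1} (\<lambda>k. nderiv {0..1} k f) interval_lebesgue f \<longrightarrow>
        has_sigma_finite_acim interval_lebesgue f) \<and>
     (\<forall>f::complex \<Rightarrow> complex.
        f ` circle \<subseteq> circle \<longrightarrow>
        Ck_circle 3 f \<longrightarrow>
        dynamical_hypotheses circle (\<lambda>k. circle_nderiv k f) circle_lebesgue f \<longrightarrow>
        has_sigma_finite_acim circle_lebesgue f)"
  using interval_has_sigma_finite_acim circle_has_sigma_finite_acim by simp

end
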